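(* Let $Z=c_0$ or $Z=\ell_p$ for some $1\le p<+\infty$. Let $X=(\sum_{n\in\mathbb N}E_n)_Z$ be the $Z$-sum of a sequence $(E_n)_{n\in\mathbb N}$ of nonzero finite-dimensional spaces. Assume that the UFDD $(E_n)_{n\in\mathbb N}$ of $X$ is not perfect or that $X$ is not ergodic. Then $X\sim(\sum X)_Z$, where $(\sum X)_Z$ denotes the $Z$-sum of infinitely (countably) many copies of $X$. Consequently $X$ has the Schroeder-Bernstein Property.
   Context: Banach spaces are real; $X\sim Y$ means $X$ and $Y$ are isomorphic (linearly homeomorphic). $\mathbb N=\{1,2,3,\dots\}$; $2^\omega$ is the Cantor space of $0$-$1$ sequences, whose elements are here indexed by $n\in\mathbb N$. The $Z$-sum $(\sum_n E_n)_Z$ is the space of sequences $(x_n)$ with $x_n\in E_n$ and $(\|x_n\|)_n\in Z$, with norm $\|(\|x_n\|)_n\|_Z$. A Schauder decomposition $X=\sum_{n\in\mathbb N}E_n$ is a sequence of closed subspaces of $X$ such that every $x\in X$ can be written uniquely as $x=\sum_n x_n$ with $x_n\in E_n$; it is unconditional if there is $C$ with $\|\sum_{n\in I}x_n\|\le C\|\sum_n x_n\|$ for all $x=\sum_n x_n\in X$ and all $I\subset\mathbb N$. A UFDD is an unconditional Schauder decomposition into finite-dimensional subspaces. For $I\subset\mathbb N$, $\sum_{n\in I}E_n$ is the closed subspace of those $x$ whose components $x_n$ vanish for $n\notin I$. The decomposition is perfect if there is a nonempty perfect subset $P$ of $2^\omega$ such that for all $\alpha\ne\beta$ in $P$: $\sum_{\alpha(n)=1}E_n\not\sim\sum_{\beta(n)=1}E_n$,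 $\sum_{\alpha(n)=0}E_n\not\sim\sum_{\beta(n)=1}E_n$ and $\sum_{\alpha(n)=0}E_n\not\sim\sum_{\beta(n)=0}E_n$. $E_0$ is the equivalence relation on $2^\omega$ given by $\alpha E_0\beta$ iff there is $m$ with $\alpha(n)=\beta(n)$ for all $n\ge m$. A separable Banach space $X$ is ergodic if $E_0$ is Borel reducible to isomorphism between subspaces of $X$, i.e. there is a Borel map $f$ from $2^\omega$ to the set of closed subspaces of $X$ (with the Effros-Borel structure, generated by the sets $\{F:F\cap U\ne\emptyset\}$, $U\subset X$ open) such that $\alpha E_0\beta$ if and only if $f(\alpha)\sim f(\beta)$. $X$ has the Schroeder-Bernstein Property if whenever a Banach space $Y$ is isomorphic to a complemented subspace of $X$ and $X$ is isomorphic to a complemented subspace of $Y$, it follows that $Y\sim X$. *)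

theory Defs
  imports "HOL-Analysis.Analysis" "HOL-Library.Function_Algebras"
begin

text \<open>Pointwise scaling, completing the pointwise group structure on functions to that of a real
  vector space.\<close>

instantiation "fun" :: (type, real_vector) real_vector
begin

definition scaleR_fun :: "real \<Rightarrow> ('a \<Rightarrow> 'b) \<Rightarrow> 'a \<Rightarrow> 'b"
  where "scaleR_fun c f = (\<lambda>x. c *\<^sub>R f x)"

instance
  by standard (simp_all add: scaleR_fun_def fun_eq_iff scaleR_add_right scaleR_add_left)

end


section \<open>Normed spaces on a carrier\<close>

text \<open>
  The spaces of a \<open>Z\<close>-sum vary with the index, so a normed space is given by a linear subspace
  \<open>carr X\<close> of an ambient real vector space, which carries no topology of its own (or an irrelevant
  one), and a norm \<open>nrm X\<close> whose values matter on \<open>carr X\<close> only.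
\<close>

record 'a nspace =
  carr :: "'a set"
  nrm :: "'a \<Rightarrow> real"

definition normed_space :: "'a::real_vector nspace \<Rightarrow> bool" where
  "normed_space X \<longleftrightarrow> subspace (carr X) \<and>
     (\<forall>x\<in>carr X. 0 \<le> nrm X x \<and> (nrm X x = 0 \<longleftrightarrow> x = 0)) \<and>
     (\<forall>c. \<forall>x\<in>carr X. nrm X (c *\<^sub>R x) = \<bar>c\<bar> * nrm X x) \<and>
     (\<forall>x\<in>carr X. \<forall>y\<in>carr X. nrm X (x + y) \<le> nrm X x + nrm X y)"

text \<open>The value outside the carrier makes \<^term>\<open>Metric_space\<close> applicable, which demands
  nonnegativity and symmetry everywhere.\<close>

definition ndist :: "'a::real_vector nspace \<Rightarrow> 'a \<Rightarrow> 'a \<Rightarrow> real" where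
  "ndist X x y = (if x \<in> carr X \<and> y \<in> carr X then nrm X (x - y) else 0)"

abbreviation ntop :: "'a::real_vector nspace \<Rightarrow> 'a topology" where
  "ntop X \<equiv> Metric_space.mtopology (carr X) (ndist X)"

definition banach_space :: "'a::real_vector nspace \<Rightarrow> bool" where
  "banach_space X \<longleftrightarrow> normed_space X \<and> Metric_space.mcomplete (carr X) (ndist X)"

definition finite_dimensional :: "'a::real_vector set \<Rightarrow> bool" where
  "finite_dimensional V \<longleftrightarrow> (\<exists>B. finite B \<and> V = span B)"

definition closed_subspace :: "'a::real_vector nspace \<Rightarrow> 'a set \<Rightarrow> bool" where
  "closed_subspace X F \<longleftrightarrow> subspace F \<and> closedin (ntop X) F"

abbreviation restrict_to :: "'a nspace \<Rightarrow> 'a set \<Rightarrow> 'a nspace" where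
  "restrict_to X F \<equiv> X\<lparr>carr := F\<rparr>"

definition linear_between ::
    "'a::real_vector nspace \<Rightarrow> 'b::real_vector nspace \<Rightarrow> ('a \<Rightarrow> 'b) \<Rightarrow> bool" where
  "linear_between X Y T \<longleftrightarrow> T ` carr X \<subseteq> carr Y \<and>
     (\<forall>x\<in>carr X. \<forall>y\<in>carr X. T (x + y) = T x + T y) \<and>
     (\<forall>c. \<forall>x\<in>carr X. T (c *\<^sub>R x) = c *\<^sub>R T x)"

definition nisomorphic :: "'a::real_vector nspace \<Rightarrow> 'b::real_vector nspace \<Rightarrow> bool"
    (infix "\<sim>\<^sub>B" 50) where
  "X \<sim>\<^sub>B Y \<longleftrightarrow> (\<exists>T. linear_between X Y T \<and> homeomorphic_map (ntop X) (ntop Y) T)"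

definition complemented_in :: "'a::real_vector nspace \<Rightarrow> 'a set \<Rightarrow> bool" where
  "complemented_in X M \<longleftrightarrow> closed_subspace X M \<and>
     (\<exists>P. linear_between X (restrict_to X M) P \<and> continuous_map (ntop X) (ntop X) P \<and>
          (\<forall>x\<in>M. P x = x))"

text \<open>HOL cannot quantify over types inside a formula; the type argument is the ambient vector
  space of the competitor \<open>Y\<close>, and the property is meant for all instances of \<open>'c\<close>.\<close>

definition schroeder_bernstein :: "'c::real_vector itself \<Rightarrow> 'a::real_vector nspace \<Rightarrow> bool" where
  "schroeder_bernstein _ X \<longleftrightarrow>
     (\<forall>Y :: 'c nspace. banach_space Y \<longrightarrow>
        (\<exists>M. complemented_in X M \<and> Y \<sim>\<^sub>B restrict_to X M) \<longrightarrow>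
        (\<exists>N. complemented_in Y N \<and> X \<sim>\<^sub>B restrict_to Y N) \<longrightarrow>
        Y \<sim>\<^sub>B X)"


section \<open>Sequence spaces and \<open>Z\<close>-sums\<close>

definition c0_space :: "(nat \<Rightarrow> real) nspace" where
  "c0_space = \<lparr>carr = {a. a \<longlonglongrightarrow> 0}, nrm = (\<lambda>a. SUP n. \<bar>a n\<bar>)\<rparr>"

definition lp_space :: "real \<Rightarrow> (nat \<Rightarrow> real) nspace" where
  "lp_space p = \<lparr>carr = {a. summable (\<lambda>n. \<bar>a n\<bar> powr p)},
                 nrm = (\<lambda>a. (\<Sum>n. \<bar>a n\<bar> powr p) powr (1 / p))\<rparr>"

definition zsum ::
    "(nat \<Rightarrow> real) nspace \<Rightarrow> (nat \<Rightarrow> 'a::real_vector nspace) \<Rightarrow> (nat \<Rightarrow> 'a) nspace" where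
  "zsum Z E = \<lparr>carr = {x. (\<forall>n. x n \<in> carr (E n)) \<and> (\<lambda>n. nrm (E n) (x n)) \<in> carr Z},
               nrm = (\<lambda>x. nrm Z (\<lambda>n. nrm (E n) (x n)))\<rparr>"

text \<open>The copy of the \<open>n\<close>-th summand inside a \<open>Z\<close>-sum.\<close>

definition summand :: "(nat \<Rightarrow> 'a::real_vector) nspace \<Rightarrow> nat \<Rightarrow> (nat \<Rightarrow> 'a) set" where
  "summand X n = {x \<in> carr X. \<forall>k. k \<noteq> n \<longrightarrow> x k = 0}"


section \<open>Decompositions\<close>

definition nsums :: "'a::real_vector nspace \<Rightarrow> (nat \<Rightarrow> 'a) \<Rightarrow> 'a \<Rightarrow> bool" where
  "nsums X \<xi> x \<longleftrightarrow> limitin (ntop X) (\<lambda>k. \<Sum>n<k. \<xi> n) x sequentially"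

definition schauder_decomposition :: "'a::real_vector nspace \<Rightarrow> (nat \<Rightarrow> 'a set) \<Rightarrow> bool" where
  "schauder_decomposition X D \<longleftrightarrow>
     (\<forall>n. closed_subspace X (D n)) \<and>
     (\<forall>x\<in>carr X. \<exists>!\<xi>. (\<forall>n. \<xi> n \<in> D n) \<and> nsums X \<xi> x)"

definition unconditional_decomposition :: "'a::real_vector nspace \<Rightarrow> (nat \<Rightarrow> 'a set) \<Rightarrow> bool" where
  "unconditional_decomposition X D \<longleftrightarrow>
     (\<exists>C. \<forall>\<xi> x. (\<forall>n. \<xi> n \<in> D n) \<and> nsums X \<xi> x \<longrightarrow>
        (\<forall>I. \<exists>y. nsums X (\<lambda>n. if n \<in> I then \<xi> n else 0) y \<and> nrm X y \<le> C * nrm X x))"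

definition UFDD :: "'a::real_vector nspace \<Rightarrow> (nat \<Rightarrow> 'a set) \<Rightarrow> bool" where
  "UFDD X D \<longleftrightarrow> schauder_decomposition X D \<and> unconditional_decomposition X D \<and>
     (\<forall>n. finite_dimensional (D n))"

text \<open>The elements whose components vanish outside \<open>I\<close>; for a Schauder decomposition the
  components \<open>\<xi>\<close> are unique.\<close>

definition partial_sum :: "'a::real_vector nspace \<Rightarrow> (nat \<Rightarrow> 'a set) \<Rightarrow> nat set \<Rightarrow> 'a nspace" where
  "partial_sum X D I = restrict_to X
     {x \<in> carr X. \<exists>\<xi>. (\<forall>n. \<xi> n \<in> D n) \<and> nsums X \<xi> x \<and> (\<forall>n. n \<notin> I \<longrightarrow> \<xi> n = 0)}"

text \<open>The Cantor space is \<^typ>\<open>nat \<Rightarrow> bool\<close> with the product topology of the library.\<close>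

definition perfect_set :: "'a::topological_space set \<Rightarrow> bool" where
  "perfect_set P \<longleftrightarrow> closed P \<and> (\<forall>x\<in>P. x islimpt P)"

definition perfect_decomposition :: "'a::real_vector nspace \<Rightarrow> (nat \<Rightarrow> 'a set) \<Rightarrow> bool" where
  "perfect_decomposition X D \<longleftrightarrow>
     (\<exists>P :: (nat \<Rightarrow> bool) set. perfect_set P \<and> P \<noteq> {} \<and>
        (\<forall>\<alpha>\<in>P. \<forall>\<beta>\<in>P. \<alpha> \<noteq> \<beta> \<longrightarrow>
           \<not> partial_sum X D {n. \<alpha> n} \<sim>\<^sub>B partial_sum X D {n. \<beta> n} \<and>
           \<not> partial_sum X D {n. \<not> \<alpha> n} \<sim>\<^sub>B partial_sum X D {n. \<beta> n} \<and>
           \<not> partial_sum X D {n. \<not> \<alpha> n} \<sim>\<^sub>B partial_sum X D {n. \<not> \<beta> n}))"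


section \<open>Ergodic spaces\<close>

definition E0 :: "(nat \<Rightarrow> bool) \<Rightarrow> (nat \<Rightarrow> bool) \<Rightarrow> bool" where
  "E0 \<alpha> \<beta> \<longleftrightarrow> (\<exists>m. \<forall>n\<ge>m. \<alpha> n = \<beta> n)"

definition effros_borel :: "'a::real_vector nspace \<Rightarrow> 'a set measure" where
  "effros_borel X = sigma {F. closed_subspace X F}
     {{F. closed_subspace X F \<and> F \<inter> U \<noteq> {}} | U. openin (ntop X) U}"

text \<open>A property of separable Banach spaces; a \<open>Z\<close>-sum of finite-dimensional spaces is one.\<close>

definition ergodic :: "'a::real_vector nspace \<Rightarrow> bool" where
  "ergodic X \<longleftrightarrow>
     (\<exists>f \<in> borel \<rightarrow>\<^sub>M effros_borel X.
        \<forall>\<alpha> \<beta>. E0 \<alpha> \<beta> \<longleftrightarrow> restrict_to X (f \<alpha>) \<sim>\<^sub>B restrict_to X (f \<beta>))"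

section \<open>The summands of a \<open>Z\<close>-sum form a UFDD\<close>

locale normed =
  fixes X :: "'a::real_vector nspace"
  assumes normed_space: "normed_space X"
begin

lemma subsp: "subspace (carr X)"
  using normed_space by (simp add: normed_space_def)

lemmas carr_add = subspace_add[OF subsp] and carr_diff = subspace_diff[OF subsp]
  and carr_scale = subspace_scale[OF subsp] and carr_0 = subspace_0[OF subsp]

lemma nrm_nonneg: "x \<in> carr X \<Longrightarrow> 0 \<le> nrm X x"
  and nrm_eq_0: "x \<in> carr X \<Longrightarrow> nrm X x = 0 \<longleftrightarrow> x = 0"
  and nrm_scale: "x \<in> carr X \<Longrightarrow> nrm X (c *\<^sub>R x) = \<bar>c\<bar> * nrm X x"
  and nrm_triangle: "x \<in> carr X \<Longrightarrow> y \<in> carr X \<Longrightarrow> nrm X (x + y) \<le> nrm X x + nrm X y"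
  using normed_space by (auto simp: normed_space_def)

lemma nrm_minus: "x \<in> carr X \<Longrightarrow> nrm X (- x) = nrm X x"
  using nrm_scale[of x "-1"] by simp

lemma nrm_commute: "x \<in> carr X \<Longrightarrow> y \<in> carr X \<Longrightarrow> nrm X (x - y) = nrm X (y - x)"
  using nrm_minus[of "x - y"] carr_diff by simp

sublocale Metric_space "carr X" "ndist X"
proof
  show "ndist X x z \<le> ndist X x y + ndist X y z"
    if "x \<in> carr X" "y \<in> carr X" "z \<in> carr X" for x y z
    using nrm_triangle[of "x - y" "y - z"] that by (simp add: ndist_def carr_diff)
qed (auto simp: ndist_def nrm_nonneg nrm_eq_0 carr_diff nrm_commute)

lemma limitin_iff:
  assumes "\<And>k. \<sigma> k \<in> carr X"
  shows "limitin mtopology \<sigma> x sequentially \<longleftrightarrow>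
    x \<in> carr X \<and> (\<lambda>k. nrm X (\<sigma> k - x)) \<longlonglongrightarrow> 0"
  using assms nrm_nonneg carr_diff
  by (auto simp: limit_metric_sequentially ndist_def lim_sequentially dist_real_def)

end

locale sequence_space =
  fixes Z :: "(nat \<Rightarrow> real) nspace"
  assumes solid: "b \<in> carr Z \<Longrightarrow> (\<And>n. \<bar>a n\<bar> \<le> \<bar>b n\<bar>) \<Longrightarrow> a \<in> carr Z \<and> nrm Z a \<le> nrm Z b"
    and add: "a \<in> carr Z \<Longrightarrow> b \<in> carr Z \<Longrightarrow>
      (\<lambda>n. a n + b n) \<in> carr Z \<and> nrm Z (\<lambda>n. a n + b n) \<le> nrm Z a + nrm Z b"
    and scale: "a \<in> carr Z \<Longrightarrow> (\<lambda>n. c * a n) \<in> carr Z \<and> nrm Z (\<lambda>n. c * a n) = \<bar>c\<bar> * nrm Z a"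
    and coord: "a \<in> carr Z \<Longrightarrow> \<bar>a n\<bar> \<le> nrm Z a"
    and tail: "a \<in> carr Z \<Longrightarrow> (\<lambda>k. nrm Z (\<lambda>n. if n < k then 0 else a n)) \<longlonglongrightarrow> 0"
    and unit: "(\<lambda>k. if k = n then r else 0) \<in> carr Z"

lemma sequence_space_c0: "sequence_space c0_space"
proof
  have bdd: "bdd_above (range (\<lambda>n. \<bar>a n\<bar>))" if "a \<longlonglongrightarrow> 0" for a :: "nat \<Rightarrow> real"
    using convergent_imp_Bseq[OF convergentI[OF that]]
    by (auto simp: Bseq_def bdd_above_def)
  have coord: "\<bar>a n\<bar> \<le> (SUP n. \<bar>a n\<bar>)" if "a \<longlonglongrightarrow> 0" for a :: "nat \<Rightarrow> real" and n
    using bdd[OF that] by (auto intro: cSUP_upper)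
  show "\<bar>a n\<bar> \<le> nrm c0_space a" if "a \<in> carr c0_space" for a n
    using coord that by (simp add: c0_space_def)
  show "a \<in> carr c0_space \<and> nrm c0_space a \<le> nrm c0_space b"
    if b: "b \<in> carr c0_space" and ab: "\<And>n. \<bar>a n\<bar> \<le> \<bar>b n\<bar>" for a b
  proof -
    have b0: "b \<longlonglongrightarrow> 0" using b by (simp add: c0_space_def)
    have "a \<longlonglongrightarrow> 0"
      by (rule Lim_null_comparison[OF _ tendsto_rabs_zero[OF b0]]) (simp add: ab)
    moreover have "(SUP n. \<bar>a n\<bar>) \<le> (SUP n. \<bar>b n\<bar>)"
      by (rule cSUP_least) (auto intro: order_trans[OF ab coord[OF b0]])
    ultimately show ?thesis by (simp add: c0_space_def)
  qed
  show "(\<lambda>n. a n + b n) \<in> carr c0_space \<and>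
      nrm c0_space (\<lambda>n. a n + b n) \<le> nrm c0_space a + nrm c0_space b"
    if "a \<in> carr c0_space" "b \<in> carr c0_space" for a b
  proof -
    have ab: "a \<longlonglongrightarrow> 0" "b \<longlonglongrightarrow> 0" using that by (auto simp: c0_space_def)
    have "(SUP n. \<bar>a n + b n\<bar>) \<le> (SUP n. \<bar>a n\<bar>) + (SUP n. \<bar>b n\<bar>)"
      by (rule cSUP_least)
        (auto intro: order_trans[OF abs_triangle_ineq add_mono[OF coord[OF ab(1)] coord[OF ab(2)]]])
    then show ?thesis using tendsto_add[OF ab] by (simp add: c0_space_def)
  qed
  show "(\<lambda>n. c * a n) \<in> carr c0_space \<and> nrm c0_space (\<lambda>n. c * a n) = \<bar>c\<bar> * nrm c0_space a"
    if "a \<in> carr c0_space" for a c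
  proof -
    have a: "a \<longlonglongrightarrow> 0" using that by (auto simp: c0_space_def)
    have ca: "(\<lambda>n. c * a n) \<longlonglongrightarrow> 0" using tendsto_mult_left[OF a, of c] by simp
    have "(SUP n. \<bar>c * a n\<bar>) = \<bar>c\<bar> * (SUP n. \<bar>a n\<bar>)"
    proof (cases "c = 0")
      case False
      show ?thesis
      proof (rule antisym)
        show "(SUP n. \<bar>c * a n\<bar>) \<le> \<bar>c\<bar> * (SUP n. \<bar>a n\<bar>)"
          by (rule cSUP_least) (auto simp: abs_mult intro!: mult_left_mono coord[OF a])
        have "(SUP n. \<bar>a n\<bar>) \<le> (SUP n. \<bar>c * a n\<bar>) / \<bar>c\<bar>"
        proof (rule cSUP_least)
          show "\<bar>a n\<bar> \<le> (SUP n. \<bar>c * a n\<bar>) / \<bar>c\<bar>" for n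
            using coord[OF ca, of n] False by (simp add: field_simps abs_mult)
        qed simp
        then show "\<bar>c\<bar> * (SUP n. \<bar>a n\<bar>) \<le> (SUP n. \<bar>c * a n\<bar>)"
          using False by (simp add: field_simps)
      qed
    qed simp
    then show ?thesis using ca by (simp add: c0_space_def)
  qed
  show "(\<lambda>k. nrm c0_space (\<lambda>n. if n < k then 0 else a n)) \<longlonglongrightarrow> 0"
    if "a \<in> carr c0_space" for a
  proof -
    have a: "a \<longlonglongrightarrow> 0" using that by (auto simp: c0_space_def)
    have t: "(\<lambda>n. if n < k then 0 else a n) \<longlonglongrightarrow> 0" for k
      by (rule Lim_null_comparison[OF _ tendsto_rabs_zero[OF a]]) simp
    have "\<exists>K. \<forall>k\<ge>K. \<bar>SUP n. \<bar>if n < k then 0 else a n\<bar>\<bar> < e" if "e > 0" for e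
    proof -
      obtain K where K: "\<And>n. n \<ge> K \<Longrightarrow> \<bar>a n\<bar> < e / 2"
        using LIMSEQ_D[OF a, of "e / 2"] \<open>e > 0\<close> by auto
      have "\<bar>SUP n. \<bar>if n < k then 0 else a n\<bar>\<bar> < e" if "k \<ge> K" for k
      proof -
        have "0 \<le> (SUP n. \<bar>if n < k then 0 else a n\<bar>)"
          by (rule order_trans[OF abs_ge_zero coord[OF t, where n=0]])
        moreover have "(SUP n. \<bar>if n < k then 0 else a n\<bar>) \<le> e / 2"
        proof (rule cSUP_least)
          show "\<bar>if n < k then 0 else a n\<bar> \<le> e / 2" for n
            using K[of n] \<open>e > 0\<close> \<open>k \<ge> K\<close> by (cases "n < k") auto
        qed simp
        ultimately show ?thesis using \<open>e > 0\<close> by simp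
      qed
      then show ?thesis by blast
    qed
    then show ?thesis by (simp add: c0_space_def lim_sequentially dist_real_def)
  qed
  show "(\<lambda>k. if k = n then r else 0) \<in> carr c0_space" for n :: nat and r
    unfolding c0_space_def
    by (auto intro!: tendsto_eventually eventually_sequentiallyI[of "Suc n"])
qed

lemma powr_convex_nonneg:
  fixes x y t u p :: real
  assumes p: "p \<ge> 1" and xy: "x \<ge> 0" "y \<ge> 0" and tu: "t \<ge> 0" "u \<ge> 0" "t + u = 1"
  shows "(t * x + u * y) powr p \<le> t * x powr p + u * y powr p"
proof -
  have *: "(s * z) powr p \<le> s * z powr p" if "0 \<le> s" "s \<le> 1" "0 \<le> z" for s z :: real
  proof -
    have "s powr p \<le> s powr 1"
      using powr_mono'[of 1 p s] that p by simp
    then show ?thesis using that by (simp add: powr_mult mult_right_mono)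
  qed
  show ?thesis
  proof (cases "x = 0 \<or> y = 0")
    case True
    then show ?thesis using *[of u y] *[of t x] assms by auto
  next
    case False
    have t: "t = 1 - u" using tu by simp
    show ?thesis
      unfolding t using convex_onD[OF powr_convex[OF p], of u x y] False assms by simp
  qed
qed

lemma lp_minkowski:
  fixes a b :: "nat \<Rightarrow> real"
  assumes p: "p \<ge> 1"
    and sa: "summable (\<lambda>n. \<bar>a n\<bar> powr p)" and sb: "summable (\<lambda>n. \<bar>b n\<bar> powr p)"
  shows "summable (\<lambda>n. \<bar>a n + b n\<bar> powr p) \<and>
    (\<Sum>n. \<bar>a n + b n\<bar> powr p) powr (1 / p)
      \<le> (\<Sum>n. \<bar>a n\<bar> powr p) powr (1 / p) + (\<Sum>n. \<bar>b n\<bar> powr p) powr (1 / p)"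
proof -
  define A where "A = (\<Sum>n. \<bar>a n\<bar> powr p) powr (1 / p)"
  define B where "B = (\<Sum>n. \<bar>b n\<bar> powr p) powr (1 / p)"
  have A0: "A \<ge> 0" "B \<ge> 0" by (simp_all add: A_def B_def)
  have nn: "(\<Sum>n. \<bar>a n\<bar> powr p) \<ge> 0" "(\<Sum>n. \<bar>b n\<bar> powr p) \<ge> 0"
    by (auto intro!: suminf_nonneg sa sb)
  have Ap: "A powr p = (\<Sum>n. \<bar>a n\<bar> powr p)" "B powr p = (\<Sum>n. \<bar>b n\<bar> powr p)"
    using p nn by (simp_all add: A_def B_def powr_powr)
  have zero: "\<forall>n. c n = 0" if "(\<Sum>n. \<bar>c n\<bar> powr p) powr (1 / p) = 0"
    "summable (\<lambda>n. \<bar>c n\<bar> powr p)" for c :: "nat \<Rightarrow> real"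
  proof -
    have "(\<Sum>n. \<bar>c n\<bar> powr p) = 0" using that by simp
    then show ?thesis using suminf_eq_zero_iff[OF that(2)] by simp
  qed
  show ?thesis
  proof (cases "A = 0 \<or> B = 0")
    case True
    then show ?thesis
    proof
      assume 0: "A = 0"
      have "\<forall>n. a n = 0" by (rule zero[OF 0[unfolded A_def] sa])
      then show ?thesis using sb p by simp
    next
      assume 0: "B = 0"
      have "\<forall>n. b n = 0" by (rule zero[OF 0[unfolded B_def] sb])
      then show ?thesis using sa p by simp
    qed
  next
    case False
    then have pos: "A > 0" "B > 0" using A0 by auto
    define S where "S = A + B"
    have S: "S > 0" using pos by (simp add: S_def)
    define f where "f n = S powr p * ((A / S) * (\<bar>a n\<bar> powr p / A powr p)
        + (B / S) * (\<bar>b n\<bar> powr p / B powr p))" for n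
    have le: "\<bar>a n + b n\<bar> powr p \<le> f n" for n
    proof -
      have "((A / S) * (\<bar>a n\<bar> / A) + (B / S) * (\<bar>b n\<bar> / B)) powr p
          \<le> (A / S) * (\<bar>a n\<bar> / A) powr p + (B / S) * (\<bar>b n\<bar> / B) powr p"
        using pos S by (intro powr_convex_nonneg p) (auto simp: S_def add_divide_distrib[symmetric])
      moreover have "(A / S) * (\<bar>a n\<bar> / A) + (B / S) * (\<bar>b n\<bar> / B) = (\<bar>a n\<bar> + \<bar>b n\<bar>) / S"
        using pos by (simp add: add_divide_distrib)
      ultimately have "((\<bar>a n\<bar> + \<bar>b n\<bar>) / S) powr p
          \<le> (A / S) * (\<bar>a n\<bar> powr p / A powr p) + (B / S) * (\<bar>b n\<bar> powr p / B powr p)"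
        using pos by (simp add: powr_divide)
      then have "S powr p * ((\<bar>a n\<bar> + \<bar>b n\<bar>) / S) powr p \<le> f n"
        unfolding f_def by (intro mult_left_mono) auto
      moreover have "S powr p * ((\<bar>a n\<bar> + \<bar>b n\<bar>) / S) powr p = (\<bar>a n\<bar> + \<bar>b n\<bar>) powr p"
        using S by (simp add: powr_divide)
      moreover have "\<bar>a n + b n\<bar> powr p \<le> (\<bar>a n\<bar> + \<bar>b n\<bar>) powr p"
        using p by (intro powr_mono2) auto
      ultimately show ?thesis by simp
    qed
    have "f sums (S powr p * ((A / S) * ((\<Sum>n. \<bar>a n\<bar> powr p) / A powr p)
        + (B / S) * ((\<Sum>n. \<bar>b n\<bar> powr p) / B powr p)))"
      unfolding f_def by (intro sums_mult sums_add sums_divide summable_sums sa sb)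
    moreover have "(A / S) * ((\<Sum>n. \<bar>a n\<bar> powr p) / A powr p)
        + (B / S) * ((\<Sum>n. \<bar>b n\<bar> powr p) / B powr p) = 1"
      using pos S by (simp add: Ap[symmetric] S_def add_divide_distrib[symmetric])
    ultimately have fs: "f sums (S powr p)" by simp
    have sab: "summable (\<lambda>n. \<bar>a n + b n\<bar> powr p)"
      by (rule summable_comparison_test'[OF sums_summable[OF fs], of 0]) (simp add: le)
    have "(\<Sum>n. \<bar>a n + b n\<bar> powr p) \<le> S powr p"
      using suminf_le[OF le sab sums_summable[OF fs]] sums_unique[OF fs] by simp
    then have "(\<Sum>n. \<bar>a n + b n\<bar> powr p) powr (1 / p) \<le> (S powr p) powr (1 / p)"
      using p by (intro powr_mono2 suminf_nonneg sab) auto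
    then show ?thesis using sab p S by (simp add: powr_powr S_def A_def B_def)
  qed
qed

lemma sequence_space_lp:
  assumes p: "p \<ge> 1"
  shows "sequence_space (lp_space p)"
proof
  show "a \<in> carr (lp_space p) \<and> nrm (lp_space p) a \<le> nrm (lp_space p) b"
    if b: "b \<in> carr (lp_space p)" and ab: "\<And>n. \<bar>a n\<bar> \<le> \<bar>b n\<bar>" for a b
  proof -
    have sb: "summable (\<lambda>n. \<bar>b n\<bar> powr p)" using b by (simp add: lp_space_def)
    have le: "\<bar>a n\<bar> powr p \<le> \<bar>b n\<bar> powr p" for n
      using p by (intro powr_mono2 ab) auto
    have sa: "summable (\<lambda>n. \<bar>a n\<bar> powr p)"
      by (rule summable_comparison_test'[OF sb, of 0]) (simp add: le)
    have "(\<Sum>n. \<bar>a n\<bar> powr p) powr (1/p) \<le> (\<Sum>n. \<bar>b n\<bar> powr p) powr (1/p)"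
      using p by (intro powr_mono2 suminf_le[OF le sa sb] suminf_nonneg sa) auto
    then show ?thesis using sa by (simp add: lp_space_def)
  qed
  show "(\<lambda>n. a n + b n) \<in> carr (lp_space p) \<and>
      nrm (lp_space p) (\<lambda>n. a n + b n) \<le> nrm (lp_space p) a + nrm (lp_space p) b"
    if "a \<in> carr (lp_space p)" "b \<in> carr (lp_space p)" for a b
    using lp_minkowski[OF p] that by (simp add: lp_space_def)
  show "(\<lambda>n. c * a n) \<in> carr (lp_space p) \<and>
      nrm (lp_space p) (\<lambda>n. c * a n) = \<bar>c\<bar> * nrm (lp_space p) a"
    if "a \<in> carr (lp_space p)" for a c
  proof -
    have sa: "summable (\<lambda>n. \<bar>a n\<bar> powr p)" using that by (simp add: lp_space_def)
    have "(\<Sum>n. \<bar>c\<bar> powr p * \<bar>a n\<bar> powr p) powr (1/p) = \<bar>c\<bar> * (\<Sum>n. \<bar>a n\<bar> powr p) powr (1/p)"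
      using p by (simp add: suminf_mult[OF sa] powr_mult suminf_nonneg[OF sa] powr_powr)
    then show ?thesis using summable_mult[OF sa] by (simp add: lp_space_def abs_mult powr_mult)
  qed
  show "\<bar>a n\<bar> \<le> nrm (lp_space p) a" if "a \<in> carr (lp_space p)" for a n
  proof -
    have sa: "summable (\<lambda>n. \<bar>a n\<bar> powr p)" using that by (simp add: lp_space_def)
    have "\<bar>a n\<bar> powr p \<le> (\<Sum>n. \<bar>a n\<bar> powr p)"
      using sum_le_suminf[OF sa, of "{n}"] by simp
    then have "(\<bar>a n\<bar> powr p) powr (1/p) \<le> (\<Sum>n. \<bar>a n\<bar> powr p) powr (1/p)"
      using p by (intro powr_mono2) auto
    then show ?thesis using p by (simp add: powr_powr lp_space_def)
  qed
  show "(\<lambda>k. nrm (lp_space p) (\<lambda>n. if n < k then 0 else a n)) \<longlonglongrightarrow> 0"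
    if "a \<in> carr (lp_space p)" for a
  proof -
    have sa: "summable (\<lambda>n. \<bar>a n\<bar> powr p)" using that by (simp add: lp_space_def)
    define R where "R k = (\<Sum>n. \<bar>a n\<bar> powr p) - (\<Sum>n<k. \<bar>a n\<bar> powr p)" for k
    have R: "(\<Sum>n. \<bar>if n < k then 0 else a n\<bar> powr p) = R k" for k
    proof -
      have "(\<lambda>n. if n \<in> {..<k} then \<bar>a n\<bar> powr p else 0) sums (\<Sum>n<k. \<bar>a n\<bar> powr p)"
        by (rule sums_If_finite_set) simp
      from sums_diff[OF summable_sums[OF sa] this]
      have "(\<lambda>n. \<bar>a n\<bar> powr p - (if n \<in> {..<k} then \<bar>a n\<bar> powr p else 0)) sums R k"
        by (simp add: R_def)
      moreover have "(\<lambda>n. \<bar>a n\<bar> powr p - (if n \<in> {..<k} then \<bar>a n\<bar> powr p else 0))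
          = (\<lambda>n. \<bar>if n < k then 0 else a n\<bar> powr p)"
        by auto
      ultimately show ?thesis by (simp add: sums_iff)
    qed
    have "R \<longlonglongrightarrow> (\<Sum>n. \<bar>a n\<bar> powr p) - (\<Sum>n. \<bar>a n\<bar> powr p)"
      unfolding R_def by (intro tendsto_intros summable_LIMSEQ sa)
    then have R0: "R \<longlonglongrightarrow> 0" by simp
    have "R k \<ge> 0" for k
      unfolding R_def using sum_le_suminf[OF sa, of "{..<k}"] by simp
    then have "(\<lambda>k. R k powr (1/p)) \<longlonglongrightarrow> 0 powr (1/p)"
      using p by (intro tendsto_powr' R0 tendsto_const) auto
    then show ?thesis by (simp add: lp_space_def R)
  qed
  show "(\<lambda>k. if k = n then r else 0) \<in> carr (lp_space p)" for n :: nat and r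
  proof -
    have "summable (\<lambda>k. \<bar>if k = n then r else 0\<bar> powr p)"
      by (rule summable_finite[of "{n}"]) auto
    then show ?thesis by (simp add: lp_space_def)
  qed
qed

lemma sum_fun_apply: "(\<Sum>i\<in>A. f i) x = (\<Sum>i\<in>A. f i x)"
  by (induction A rule: infinite_finite_induct) auto

locale z_sum = sequence_space Z for Z +
  fixes E :: "nat \<Rightarrow> 'a::real_vector nspace"
  assumes normed_E: "normed_space (E n)"
begin

abbreviation "X \<equiv> zsum Z E"

lemma N: "normed (E n)"
  by standard (rule normed_E)

lemma carr_X: "x \<in> carr X \<longleftrightarrow> (\<forall>n. x n \<in> carr (E n)) \<and> (\<lambda>n. nrm (E n) (x n)) \<in> carr Z"
  and nrm_X: "nrm X x = nrm Z (\<lambda>n. nrm (E n) (x n))"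
  by (simp_all add: zsum_def)

lemma coord_X: "x \<in> carr X \<Longrightarrow> nrm (E n) (x n) \<le> nrm X x"
  using coord[of "\<lambda>n. nrm (E n) (x n)" n] by (simp add: carr_X nrm_X)

lemma solid_X:
  assumes "x \<in> carr X" "\<And>n. y n \<in> carr (E n)" "\<And>n. nrm (E n) (y n) \<le> nrm (E n) (x n)"
  shows "y \<in> carr X \<and> nrm X y \<le> nrm X x"
  using solid[of "\<lambda>n. nrm (E n) (x n)" "\<lambda>n. nrm (E n) (y n)"] assms
  by (auto simp: carr_X nrm_X normed.nrm_nonneg[OF N])

lemma add_X:
  assumes "x \<in> carr X" "y \<in> carr X"
  shows "x + y \<in> carr X \<and> nrm X (x + y) \<le> nrm X x + nrm X y"
proof -
  let ?a = "\<lambda>n. nrm (E n) (x n)" and ?b = "\<lambda>n. nrm (E n) (y n)"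
  have mem: "x n \<in> carr (E n)" "y n \<in> carr (E n)" for n using assms by (auto simp: carr_X)
  have ab: "(\<lambda>n. ?a n + ?b n) \<in> carr Z" "nrm Z (\<lambda>n. ?a n + ?b n) \<le> nrm X x + nrm X y"
    using add[of ?a ?b] assms by (auto simp: carr_X nrm_X)
  have "(\<lambda>n. nrm (E n) ((x + y) n)) \<in> carr Z \<and>
      nrm Z (\<lambda>n. nrm (E n) ((x + y) n)) \<le> nrm Z (\<lambda>n. ?a n + ?b n)"
    by (rule solid[OF ab(1)])
      (use mem normed.nrm_triangle[OF N mem] in
        \<open>auto simp: normed.nrm_nonneg[OF N] normed.carr_add[OF N]\<close>)
  then show ?thesis using ab(2) mem by (auto simp: carr_X nrm_X normed.carr_add[OF N])
qed

lemma scale_X: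
  assumes "x \<in> carr X"
  shows "c *\<^sub>R x \<in> carr X \<and> nrm X (c *\<^sub>R x) = \<bar>c\<bar> * nrm X x"
  using assms scale[of "\<lambda>n. nrm (E n) (x n)" "\<bar>c\<bar>"]
  by (auto simp: carr_X nrm_X scaleR_fun_def normed.nrm_scale[OF N] normed.carr_scale[OF N])

lemma single_X: "v \<in> carr (E n) \<Longrightarrow> (\<lambda>k. if k = n then v else 0) \<in> carr X"
proof -
  assume "v \<in> carr (E n)"
  moreover have "(\<lambda>k. nrm (E k) (if k = n then v else 0)) = (\<lambda>k. if k = n then nrm (E n) v else 0)"
    using normed.nrm_eq_0[OF N normed.carr_0[OF N]] by auto
  ultimately show ?thesis using unit by (auto simp: carr_X normed.carr_0[OF N])
qed

lemma nrm_zero_Z: "nrm Z (\<lambda>_. 0) = 0"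
  using scale[where a = "\<lambda>k. if k = 0 then 0 else 0" and c = 0, OF unit] by simp

lemma zero_X: "0 \<in> carr X"
  using single_X[OF normed.carr_0[OF N], of 0] by (simp add: zero_fun_def)

lemma normed_X: "normed_space X"
  unfolding normed_space_def
proof (intro conjI ballI allI)
  show "subspace (carr X)"
    by (intro subspaceI) (use add_X scale_X zero_X in auto)
  show "0 \<le> nrm X x" if "x \<in> carr X" for x
  proof -
    have "x 0 \<in> carr (E 0)" using that by (simp add: carr_X)
    then show ?thesis using coord_X[OF that, of 0] normed.nrm_nonneg[OF N, of "x 0" 0] by linarith
  qed
  show "nrm X x = 0 \<longleftrightarrow> x = 0" if "x \<in> carr X" for x
  proof
    assume 0: "nrm X x = 0"
    have "x n = 0" for n
      using coord_X[OF that, of n] that 0 normed.nrm_nonneg[OF N, of "x n" n]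
        normed.nrm_eq_0[OF N, of "x n" n] by (auto simp: carr_X)
    then show "x = 0" by (simp add: fun_eq_iff)
  next
    assume "x = 0"
    then show "nrm X x = 0"
      using nrm_zero_Z normed.nrm_eq_0[OF N normed.carr_0[OF N]] by (simp add: nrm_X)
  qed
qed (use add_X scale_X in auto)

sublocale XN: normed X
  by standard (rule normed_X)

lemma limit_coord:
  assumes "limitin (ntop X) \<sigma> x sequentially" "\<And>k. \<sigma> k \<in> carr X"
    and "\<And>k. k \<ge> K \<Longrightarrow> \<sigma> k n = v"
  shows "x n = v"
proof -
  have x: "x \<in> carr X" and lim: "(\<lambda>k. nrm X (\<sigma> k - x)) \<longlonglongrightarrow> 0"
    using assms(1) XN.limitin_iff[OF assms(2)] by auto
  have v: "v \<in> carr (E n)" using assms(2)[of K] assms(3)[of K] by (auto simp: carr_X)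
  have vx: "v - x n \<in> carr (E n)" using v x by (auto simp: carr_X normed.carr_diff[OF N])
  have "nrm (E n) (v - x n) \<le> nrm X (\<sigma> k - x)" if "k \<ge> K" for k
    using coord_X[OF XN.carr_diff[OF assms(2)[of k] x], of n] assms(3)[OF that] by simp
  then have "nrm (E n) (v - x n) \<le> 0"
    by (intro LIMSEQ_le_const[OF lim]) auto
  then show ?thesis
    using normed.nrm_nonneg[OF N vx] normed.nrm_eq_0[OF N vx] by simp
qed

lemma summand_iff: "y \<in> summand X n \<longleftrightarrow> y n \<in> carr (E n) \<and> y = (\<lambda>k. if k = n then y n else 0)"
proof
  assume "y \<in> summand X n"
  then show "y n \<in> carr (E n) \<and> y = (\<lambda>k. if k = n then y n else 0)"
    by (auto simp: summand_def carr_X fun_eq_iff)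
next
  assume y: "y n \<in> carr (E n) \<and> y = (\<lambda>k. if k = n then y n else 0)"
  then have "y \<in> carr X" using single_X[of "y n" n] by simp
  moreover have "y k = 0" if "k \<noteq> n" for k using y that by (metis (full_types))
  ultimately show "y \<in> summand X n" by (simp add: summand_def)
qed

lemma partial_in:
  assumes "\<And>n. \<xi> n \<in> summand X n"
  shows "(\<Sum>n<k. \<xi> n) \<in> carr X"
  using assms by (intro subspace_sum[OF XN.subsp]) (auto simp: summand_def)

lemma partial_apply:
  assumes "\<And>n. \<xi> n \<in> summand X n"
  shows "(\<Sum>n<k. \<xi> n) j = (if j < k then \<xi> j j else 0)"
proof -
  have "(\<Sum>n<k. \<xi> n) j = (\<Sum>n<k. if n = j then \<xi> j j else 0)"
    unfolding sum_fun_apply using assms by (intro sum.cong) (auto simp: summand_def)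
  then show ?thesis by simp
qed

lemma nsums_iff:
  assumes "\<And>n. \<xi> n \<in> summand X n"
  shows "nsums X \<xi> x \<longleftrightarrow> x \<in> carr X \<and> (\<forall>n. \<xi> n n = x n)"
proof
  assume s: "nsums X \<xi> x"
  then have "x \<in> carr X" using limitin_topspace[of "ntop X"] by (fastforce simp: nsums_def)
  moreover have "x n = \<xi> n n" for n
    by (rule limit_coord[OF s[unfolded nsums_def] partial_in[OF assms], of "Suc n"])
      (simp add: partial_apply[OF assms])
  ultimately show "x \<in> carr X \<and> (\<forall>n. \<xi> n n = x n)" by simp
next
  assume x: "x \<in> carr X \<and> (\<forall>n. \<xi> n n = x n)"
  have "nrm X ((\<Sum>n<k. \<xi> n) - x) = nrm Z (\<lambda>n. if n < k then 0 else nrm (E n) (x n))" for k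
  proof -
    have "nrm (E n) (((\<Sum>n<k. \<xi> n) - x) n) = (if n < k then 0 else nrm (E n) (x n))" for n
      using x normed.nrm_eq_0[OF N normed.carr_0[OF N]] normed.nrm_minus[OF N, of "x n" n]
      by (auto simp: partial_apply[OF assms] carr_X)
    then show ?thesis by (simp add: nrm_X)
  qed
  then show "nsums X \<xi> x"
    unfolding nsums_def XN.limitin_iff[OF partial_in[OF assms]]
    using x tail[of "\<lambda>n. nrm (E n) (x n)"] by (auto simp: carr_X)
qed

lemma closed_summand: "closed_subspace X (summand X n)"
proof -
  have "subspace (summand X n)"
    using XN.subsp by (auto simp: subspace_def summand_def scaleR_fun_def)
  moreover have "closedin (ntop X) (summand X n)"
    unfolding XN.metric_closedin_iff_sequentially_closed
  proof (intro conjI allI impI)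
    show "summand X n \<subseteq> carr X" by (auto simp: summand_def)
    fix \<sigma> l assume "range \<sigma> \<subseteq> summand X n \<and> limitin (ntop X) \<sigma> l sequentially"
    then have s: "\<And>k. \<sigma> k \<in> summand X n" and l: "limitin (ntop X) \<sigma> l sequentially" by auto
    have c: "\<And>k. \<sigma> k \<in> carr X" using s by (auto simp: summand_def)
    have "l \<in> carr X" using l XN.limitin_iff[OF c] by auto
    moreover have "l k = 0" if "k \<noteq> n" for k
      by (rule limit_coord[OF l c, of 0]) (use s that in \<open>auto simp: summand_def\<close>)
    ultimately show "l \<in> summand X n" by (auto simp: summand_def)
  qed
  ultimately show ?thesis by (simp add: closed_subspace_def)
qed

lemma schauder: "schauder_decomposition X (summand X)"
  unfolding schauder_decomposition_def
proof (intro conjI allI ballI closed_summand)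
  fix x assume x: "x \<in> carr X"
  define \<xi> where "\<xi> n = (\<lambda>k. if k = n then x n else 0)" for n
  have mem: "\<xi> n \<in> summand X n" for n
    using x by (simp add: summand_iff \<xi>_def carr_X)
  show "\<exists>!\<xi>. (\<forall>n. \<xi> n \<in> summand X n) \<and> nsums X \<xi> x"
  proof (rule ex1I[of _ \<xi>])
    show "(\<forall>n. \<xi> n \<in> summand X n) \<and> nsums X \<xi> x"
      using mem x by (auto simp: nsums_iff[OF mem]) (simp add: \<xi>_def)
  next
    fix \<eta> assume e: "(\<forall>n. \<eta> n \<in> summand X n) \<and> nsums X \<eta> x"
    then have diag: "\<And>n. \<eta> n n = x n" using nsums_iff[of \<eta> x] by auto
    show "\<eta> = \<xi>"
    proof (intro ext)
      fix n k
      have "\<eta> n \<in> summand X n" using e by blast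
      then show "\<eta> n k = \<xi> n k" using diag[of n] by (auto simp: summand_def \<xi>_def)
    qed
  qed
qed

lemma unconditional: "unconditional_decomposition X (summand X)"
  unfolding unconditional_decomposition_def
proof (intro exI[of _ 1] allI impI)
  fix \<xi> x and I :: "nat set"
  assume "(\<forall>n. \<xi> n \<in> summand X n) \<and> nsums X \<xi> x"
  then have mem: "\<And>n. \<xi> n \<in> summand X n" and s: "nsums X \<xi> x" by auto
  have x: "x \<in> carr X" and xn: "\<And>n. \<xi> n n = x n" using s nsums_iff[OF mem] by auto
  define y where "y n = (if n \<in> I then x n else 0)" for n
  have y: "y \<in> carr X \<and> nrm X y \<le> nrm X x"
  proof (rule solid_X[OF x])
    show "y n \<in> carr (E n)" for n
      using x by (simp add: y_def carr_X normed.carr_0[OF N])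
    show "nrm (E n) (y n) \<le> nrm (E n) (x n)" for n
      using x normed.nrm_eq_0[OF N normed.carr_0[OF N]]
      by (auto simp: y_def carr_X normed.nrm_nonneg[OF N])
  qed
  have "(if n \<in> I then \<xi> n else 0) \<in> summand X n" for n
    using mem[of n] zero_X by (auto simp: summand_def)
  then have "nsums X (\<lambda>n. if n \<in> I then \<xi> n else 0) y"
    using y xn by (subst nsums_iff) (auto simp: y_def)
  then show "\<exists>y. nsums X (\<lambda>n. if n \<in> I then \<xi> n else 0) y \<and> nrm X y \<le> 1 * nrm X x"
    using y by auto
qed

lemma UFDD:
  assumes "\<And>n. finite_dimensional (carr (E n))"
  shows "UFDD X (summand X)"
  unfolding UFDD_def
proof (intro conjI allI schauder unconditional)
  fix n :: nat
  define e where "e v = (\<lambda>k. if k = n then v else (0::'a))" for v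
  obtain B where B: "finite B" "carr (E n) = span B"
    using assms[of n] by (auto simp: finite_dimensional_def)
  have lin: "linear e"
    by (rule linearI) (auto simp: e_def fun_eq_iff scaleR_fun_def)
  have "summand X n = e ` carr (E n)"
  proof (intro set_eqI iffI)
    fix y assume y: "y \<in> summand X n"
    then have "y = e (y n)" by (auto simp: summand_def e_def fun_eq_iff)
    moreover have "y n \<in> carr (E n)" using y by (simp add: summand_def carr_X)
    ultimately show "y \<in> e ` carr (E n)" by (rule image_eqI)
  next
    fix y assume "y \<in> e ` carr (E n)"
    then show "y \<in> summand X n" by (auto simp: summand_iff e_def)
  qed
  also have "\<dots> = span (e ` B)"
    by (simp add: B linear_span_image[OF lin])
  finally show "finite_dimensional (summand X n)"
    using B by (auto simp: finite_dimensional_def)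
qed

lemma partial_sum_summand:
  "carr (partial_sum X (summand X) I) = {x \<in> carr X. \<forall>n. n \<notin> I \<longrightarrow> x n = 0}"
proof (intro set_eqI iffI)
  fix x assume "x \<in> carr (partial_sum X (summand X) I)"
  then obtain \<xi> where x: "x \<in> carr X" and mem: "\<And>n. \<xi> n \<in> summand X n" and s: "nsums X \<xi> x"
    and z: "\<And>n. n \<notin> I \<Longrightarrow> \<xi> n = 0"
    by (auto simp: partial_sum_def)
  then show "x \<in> {x \<in> carr X. \<forall>n. n \<notin> I \<longrightarrow> x n = 0}"
    proof -
      have "x n = 0" if "n \<notin> I" for n
        using nsums_iff[OF mem, of x] s z[OF that] zero_fun_apply[of n] by metis
      then show ?thesis using x by simp
    qed
next
  fix x assume x: "x \<in> {x \<in> carr X. \<forall>n. n \<notin> I \<longrightarrow> x n = 0}"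
  define \<xi> where "\<xi> n = (\<lambda>k. if k = n then x n else 0)" for n
  have mem: "\<xi> n \<in> summand X n" for n
    using x by (simp add: summand_iff \<xi>_def carr_X)
  have "nsums X \<xi> x" using x by (auto simp: nsums_iff[OF mem]) (simp add: \<xi>_def)
  moreover have "\<forall>n. n \<notin> I \<longrightarrow> \<xi> n = 0" using x by (auto simp: \<xi>_def fun_eq_iff)
  ultimately show "x \<in> carr (partial_sum X (summand X) I)"
    using x mem by (auto simp: partial_sum_def)
qed

end

theorem UFDD_zsum:
  assumes "Z = c0_space \<or> (\<exists>p\<ge>1. Z = lp_space p)"
    and "\<And>n. normed_space (E n)" "\<And>n. finite_dimensional (carr (E n))"
  shows "UFDD (zsum Z E) (summand (zsum Z E))"
proof -
  interpret sequence_space Z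
    using assms(1) sequence_space_c0 sequence_space_lp by auto
  interpret z_sum Z E
    by standard (rule assms(2))
  show ?thesis by (rule UFDD[OF assms(3)])
qed

end

theory Submission
  imports Defs
begin

(*
  Two facts carry the argument. First, finitely many summands are absorbed by any infinite set of other
  summands, up to an isomorphism whose constant does not depend on the infinite set: the sum of
  lines chosen in the summands is a complemented copy of Z, which has room for a shift. Second, either
  the E n are K-complemented, with one K, in all tails of the sum, or for each K some E n is not.

  In the first case the Z-sum of infinitely many copies of X embeds in X, blockwise, as a complemented
  subspace, and Pelczynski's decomposition method yields both conclusions. In the second case the
  indices split into successive finite blocks, the j-th one containing a summand that is not
  j-complemented in the sum over all other blocks. For sets I, J of blocks, an isomorphism of
  the corresponding sums then forces I and J to be almost equal, and almost equal infinite sets give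
  isomorphic sums by absorption. Hence almost equality of sets of blocks, that is, E0, reduces to isomorphism,
  which makes X ergodic and the decomposition perfect.
*)

section \<open>Bounded operators and factorizations\<close>

text \<open>The obstacle is uniformity. By absorption the identity of each \<open>E n\<close>
  factors through every tail, but with a constant depending on n, whereas a blockwise operator on an
  infinite \<open>Z\<close>-sum is bounded only if one constant serves all blocks. So the dichotomy
  concerns constants, and it is stated for factorizations of the identity: their constants multiply
  under composition, and an isomorphism or a complemented embedding is reduced to a single number.
  In the non-uniform case this number decides. An isomorphism has one fixed constant, while the
  distinguished summand of block j resists the constant j, so only finitely many blocks of one side
  can be missing on the other. That summand is chosen against j times the absorption constant of all
  earlier summands; the tail that absorbs them is known only after this constant has been used, so
  the constant must not depend on it. The two codings differ in purpose: for E0 each bit controls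
  one even block and the odd blocks are always present, which keeps the sets infinite; for the
  perfect set each bit is repeated along an infinite column, so that a single differing bit
  separates.\<close>

definition bounded_between ::
    "real \<Rightarrow> 'a::real_vector nspace \<Rightarrow> 'b::real_vector nspace \<Rightarrow> ('a \<Rightarrow> 'b) \<Rightarrow> bool" where
  "bounded_between K X Y T \<longleftrightarrow> 0 \<le> K \<and> linear_between X Y T \<and>
     (\<forall>x\<in>carr X. nrm Y (T x) \<le> K * nrm X x)"

text \<open>The identity of \<open>X\<close> factors through \<open>Y\<close>: \<open>A\<close>
  embeds \<open>X\<close> as a complemented subspace, and \<open>A\<close> after \<open>B\<close> is
  the projection. The one constant bounds \<open>A\<close> and \<open>B\<close> separately.\<close>

definition factors_through :: "real \<Rightarrow> 'a::real_vector nspace \<Rightarrow> 'b::real_vector nspace \<Rightarrow> bool" where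
  "factors_through K X Y \<longleftrightarrow> (\<exists>A B. bounded_between K X Y A \<and> bounded_between K Y X B \<and>
     (\<forall>x\<in>carr X. B (A x) = x))"

lemma bounded_betweenI:
  assumes "0 \<le> K" "\<And>x. x \<in> carr X \<Longrightarrow> T x \<in> carr Y"
    and "\<And>x y. x \<in> carr X \<Longrightarrow> y \<in> carr X \<Longrightarrow> T (x + y) = T x + T y"
    and "\<And>c x. x \<in> carr X \<Longrightarrow> T (c *\<^sub>R x) = c *\<^sub>R T x"
    and "\<And>x. x \<in> carr X \<Longrightarrow> nrm Y (T x) \<le> K * nrm X x"
  shows "bounded_between K X Y T"
  using assms by (auto simp: bounded_between_def linear_between_def)

lemma bounded_betweenD:
  assumes "bounded_between K X Y T"
  shows "0 \<le> K"
    and "x \<in> carr X \<Longrightarrow> T x \<in> carr Y"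
    and "x \<in> carr X \<Longrightarrow> y \<in> carr X \<Longrightarrow> T (x + y) = T x + T y"
    and "x \<in> carr X \<Longrightarrow> T (c *\<^sub>R x) = c *\<^sub>R T x"
    and "x \<in> carr X \<Longrightarrow> nrm Y (T x) \<le> K * nrm X x"
  using assms by (auto simp: bounded_between_def linear_between_def)

lemma bounded_between_minus:
  assumes "bounded_between K X Y T" "x \<in> carr X"
  shows "T (- x) = - T x"
  using bounded_betweenD(4)[OF assms, of "-1"] by simp

lemma bounded_between_diff:
  assumes "normed X" "bounded_between K X Y T" "x \<in> carr X" "y \<in> carr X"
  shows "T (x - y) = T x - T y"
  using bounded_betweenD(3)[OF assms(2,3), of "- y"] bounded_between_minus[OF assms(2,4)]
    subspace_neg[OF normed.subsp[OF assms(1)] assms(4)] by simp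

lemma bounded_between_zero:
  assumes "normed X" "bounded_between K X Y T"
  shows "T 0 = 0"
  using bounded_between_diff[OF assms, of 0 0] normed.carr_0[OF assms(1)] by simp

lemma bounded_between_sum:
  assumes "normed X" "bounded_between K X Y T" "\<And>i. i \<in> I \<Longrightarrow> f i \<in> carr X"
  shows "T (\<Sum>i\<in>I. f i) = (\<Sum>i\<in>I. T (f i))"
  using assms(3)
proof (induction I rule: infinite_finite_induct)
  case (insert i I)
  have "(\<Sum>i\<in>I. f i) \<in> carr X"
    using insert.prems by (intro subspace_sum[OF normed.subsp[OF assms(1)]]) auto
  then show ?case using insert bounded_betweenD(3)[OF assms(2), of "f i"] by simp
qed (use bounded_between_zero[OF assms(1,2)] in auto)

lemma bounded_between_mono:
  assumes "normed X" "bounded_between K X Y T" "K \<le> L"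
  shows "bounded_between L X Y T"
proof (rule bounded_betweenI)
  show "nrm Y (T x) \<le> L * nrm X x" if "x \<in> carr X" for x
    using bounded_betweenD(5)[OF assms(2) that]
      mult_right_mono[OF assms(3) normed.nrm_nonneg[OF assms(1) that]] by linarith
qed (use bounded_betweenD[OF assms(2)] assms(3) in auto)

lemma bounded_between_compose:
  assumes "bounded_between K X Y S" "bounded_between L Y W T"
  shows "bounded_between (L * K) X W (\<lambda>x. T (S x))"
proof (rule bounded_betweenI)
  show "nrm W (T (S x)) \<le> L * K * nrm X x" if "x \<in> carr X" for x
  proof -
    have "nrm W (T (S x)) \<le> L * nrm Y (S x)"
      by (intro bounded_betweenD(5)[OF assms(2)] bounded_betweenD(2)[OF assms(1)] that)
    also have "\<dots> \<le> L * (K * nrm X x)"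
      by (intro mult_left_mono bounded_betweenD(5)[OF assms(1) that] bounded_betweenD(1)[OF assms(2)])
    finally show ?thesis by (simp add: mult.assoc)
  qed
qed (use bounded_betweenD[OF assms(1)] bounded_betweenD[OF assms(2)] in auto)

lemma factors_throughI:
  assumes "bounded_between K X Y A" "bounded_between K Y X B" "\<And>x. x \<in> carr X \<Longrightarrow> B (A x) = x"
  shows "factors_through K X Y"
  using assms unfolding factors_through_def by blast

lemma factors_throughE:
  assumes "factors_through K X Y"
  obtains A B where "bounded_between K X Y A" "bounded_between K Y X B"
    "\<And>x. x \<in> carr X \<Longrightarrow> B (A x) = x"
proof -
  obtain A B where AB: "bounded_between K X Y A" "bounded_between K Y X B"
    "\<forall>x\<in>carr X. B (A x) = x"
    using assms unfolding factors_through_def by blast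
  show thesis by (rule that[OF AB(1,2)]) (use AB(3) in blast)
qed

lemma factors_through_trans:
  assumes "factors_through K X Y" "factors_through L Y W"
  shows "factors_through (L * K) X W"
proof -
  obtain A B where AB: "bounded_between K X Y A" "bounded_between K Y X B"
    "\<And>x. x \<in> carr X \<Longrightarrow> B (A x) = x" using factors_throughE[OF assms(1)] by blast
  obtain C D where CD: "bounded_between L Y W C" "bounded_between L W Y D"
    "\<And>x. x \<in> carr Y \<Longrightarrow> D (C x) = x" using factors_throughE[OF assms(2)] by blast
  show ?thesis
  proof (rule factors_throughI[OF bounded_between_compose[OF AB(1) CD(1)]])
    show "bounded_between (L * K) W X (\<lambda>x. B (D x))"
      using bounded_between_compose[OF CD(2) AB(2)] by (simp add: mult.commute)
  qed (simp add: AB CD bounded_betweenD(2)[OF AB(1)])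
qed

lemma factors_through_mono:
  assumes "normed X" "normed Y" "factors_through K X Y" "K \<le> L"
  shows "factors_through L X Y"
  using assms(3) bounded_between_mono[OF assms(1) _ assms(4)] bounded_between_mono[OF assms(2) _ assms(4)]
  unfolding factors_through_def by blast


section \<open>Bounded versus continuous linear maps, and isomorphisms\<close>

lemma bounded_between_continuous:
  assumes X: "normed X" and Y: "normed Y" and T: "bounded_between K X Y T"
  shows "continuous_map (ntop X) (ntop Y) T"
proof -
  interpret X: normed X by (rule X)
  interpret Y: normed Y by (rule Y)
  have "\<exists>d>0. \<forall>x. x \<in> carr X \<and> ndist X a x < d \<longrightarrow> ndist Y (T a) (T x) < e"
    if a: "a \<in> carr X" and e: "0 < e" for a e
  proof (intro exI[of _ "e / (K + 1)"] conjI allI impI)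
    have K: "0 \<le> K" by (rule bounded_betweenD(1)[OF T])
    show "0 < e / (K + 1)" using e K by simp
    fix x assume x: "x \<in> carr X \<and> ndist X a x < e / (K + 1)"
    have d: "nrm X (a - x) < e / (K + 1)" using x a by (auto simp: ndist_def)
    have "nrm Y (T a - T x) \<le> K * nrm X (a - x)"
      using bounded_betweenD(5)[OF T X.carr_diff[OF a, of x]] bounded_between_diff[OF X T a, of x] x
      by simp
    also have "\<dots> \<le> (K + 1) * nrm X (a - x)"
      using X.nrm_nonneg[OF X.carr_diff[OF a, of x]] x by (intro mult_right_mono) auto
    also have "\<dots> < e" using d K by (simp add: field_simps)
    finally show "ndist Y (T a) (T x) < e" using e by (simp add: ndist_def)
  qed
  then show ?thesis
    unfolding X.metric_continuous_map[OF Y.Metric_space_axioms]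
    using bounded_betweenD(2)[OF T] by blast
qed

lemma continuous_imp_bounded_between:
  assumes X: "normed X" and Y: "normed Y" and T: "linear_between X Y T"
    and c: "continuous_map (ntop X) (ntop Y) T"
  shows "\<exists>K. bounded_between K X Y T"
proof -
  interpret X: normed X by (rule X)
  interpret Y: normed Y by (rule Y)
  have TY: "T x \<in> carr Y" and Ts: "T (c *\<^sub>R x) = c *\<^sub>R T x" if "x \<in> carr X" for x c
    using T that by (auto simp: linear_between_def)
  have T0: "T 0 = 0" using Ts[OF X.carr_0, of 0] by simp
  obtain d where d: "d > 0" and
    "\<And>x. x \<in> carr X \<Longrightarrow> ndist X 0 x < d \<Longrightarrow> ndist Y (T 0) (T x) < 1"
    using c X.carr_0 unfolding X.metric_continuous_map[OF Y.Metric_space_axioms]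
    by (metis zero_less_one)
  moreover have "ndist X 0 x = nrm X x" "ndist Y (T 0) (T x) = nrm Y (T x)" if "x \<in> carr X" for x
    using that X.carr_0 Y.carr_0 X.nrm_minus[of x] Y.nrm_minus[OF TY[of x]] TY[of x]
    by (simp_all add: ndist_def T0)
  ultimately have small: "nrm Y (T x) < 1" if "x \<in> carr X" "nrm X x < d" for x
    using that by simp
  have "nrm Y (T x) \<le> (2 / d) * nrm X x" if x: "x \<in> carr X" for x
  proof (cases "x = 0")
    case True
    then show ?thesis using T0 Y.nrm_eq_0[OF Y.carr_0] X.nrm_eq_0[OF X.carr_0] by simp
  next
    case False
    then have pos: "nrm X x > 0" using X.nrm_nonneg[OF x] X.nrm_eq_0[OF x] by simp
    \<comment> \<open>Scaling by \<open>r\<close> brings x to norm d/2, inside the ball whose image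
      has norm below 1.\<close>
    define r where "r = d / (2 * nrm X x)"
    have r: "r > 0" using d pos by (simp add: r_def)
    have "nrm X (r *\<^sub>R x) = d / 2" using X.nrm_scale[OF x] d pos by (simp add: r_def)
    then have "nrm Y (T (r *\<^sub>R x)) < 1" using d X.carr_scale[OF x] by (intro small) auto
    then have "r * nrm Y (T x) < 1" using r Y.nrm_scale[OF TY[OF x]] by (simp add: Ts[OF x])
    then have "nrm Y (T x) < 1 / r" using r by (simp add: field_simps)
    then show ?thesis by (simp add: r_def)
  qed
  then have "bounded_between (2 / d) X Y T"
    using T d by (auto simp: bounded_between_def)
  then show ?thesis by blast
qed

text \<open>The inverse of a linear homeomorphism is linear, and continuity at 0 bounds both maps;
  the larger bound serves as common constant.\<close>

lemma nisomorphic_iff: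
  assumes X: "normed X" and Y: "normed Y"
  shows "X \<sim>\<^sub>B Y \<longleftrightarrow> (\<exists>K S T. bounded_between K X Y S \<and> bounded_between K Y X T \<and>
    (\<forall>x\<in>carr X. T (S x) = x) \<and> (\<forall>y\<in>carr Y. S (T y) = y))"
proof
  interpret X: normed X by (rule X)
  interpret Y: normed Y by (rule Y)
  {
    assume "X \<sim>\<^sub>B Y"
    then obtain S where S: "linear_between X Y S" "homeomorphic_map (ntop X) (ntop Y) S"
      by (auto simp: nisomorphic_def)
    then obtain T where ST: "homeomorphic_maps (ntop X) (ntop Y) S T"
      by (auto simp: homeomorphic_map_maps)
    then have TS: "\<And>x. x \<in> carr X \<Longrightarrow> T (S x) = x" "\<And>y. y \<in> carr Y \<Longrightarrow> S (T y) = y"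
      and cont: "continuous_map (ntop X) (ntop Y) S" "continuous_map (ntop Y) (ntop X) T"
      by (auto simp: homeomorphic_maps_def)
    have TX: "T y \<in> carr X" if "y \<in> carr Y" for y
      using cont(2) that by (auto simp: continuous_map_def)
    have Sl: "S (x + y) = S x + S y" "S (c *\<^sub>R x) = c *\<^sub>R S x" if "x \<in> carr X" "y \<in> carr X" for x y c
      using S(1) that by (auto simp: linear_between_def)
    have "linear_between Y X T"
      unfolding linear_between_def
    proof (intro conjI allI ballI)
      show "T (x + y) = T x + T y" if "x \<in> carr Y" "y \<in> carr Y" for x y
        using Sl(1)[OF TX[OF that(1)] TX[OF that(2)]] TS(1)[OF X.carr_add[OF TX[OF that(1)] TX[OF that(2)]]]
          TS(2) that by simp
      show "T (c *\<^sub>R x) = c *\<^sub>R T x" if "x \<in> carr Y" for c x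
        using Sl(2)[OF TX[OF that] TX[OF that], of c] TS(1)[OF X.carr_scale[OF TX[OF that], of c]]
          TS(2) that by simp
    qed (use TX in auto)
    then obtain K L where KL: "bounded_between K X Y S" "bounded_between L Y X T"
      using continuous_imp_bounded_between[OF X Y S(1) cont(1)]
        continuous_imp_bounded_between[OF Y X _ cont(2)] by blast
    have "bounded_between (max K L) X Y S" "bounded_between (max K L) Y X T"
      by (rule bounded_between_mono[OF X KL(1)], simp) (rule bounded_between_mono[OF Y KL(2)], simp)
    then show "\<exists>K S T. bounded_between K X Y S \<and> bounded_between K Y X T \<and>
      (\<forall>x\<in>carr X. T (S x) = x) \<and> (\<forall>y\<in>carr Y. S (T y) = y)" using TS by blast
  next
    assume "\<exists>K S T. bounded_between K X Y S \<and> bounded_between K Y X T \<and>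
      (\<forall>x\<in>carr X. T (S x) = x) \<and> (\<forall>y\<in>carr Y. S (T y) = y)"
    then obtain K S T where ST: "bounded_between K X Y S" "bounded_between K Y X T"
      "\<forall>x\<in>carr X. T (S x) = x" "\<forall>y\<in>carr Y. S (T y) = y" by blast
    then have "homeomorphic_maps (ntop X) (ntop Y) S T"
      using bounded_between_continuous[OF X Y ST(1)] bounded_between_continuous[OF Y X ST(2)]
      by (auto simp: homeomorphic_maps_def)
    then show "X \<sim>\<^sub>B Y"
      using ST(1) by (auto simp: nisomorphic_def bounded_between_def dest: homeomorphic_maps_imp_map)
  }
qed

lemma nisomorphicE:
  assumes "normed X" "normed Y" "X \<sim>\<^sub>B Y"
  obtains K S T where "bounded_between K X Y S" "bounded_between K Y X T"
    "\<And>x. x \<in> carr X \<Longrightarrow> T (S x) = x" "\<And>y. y \<in> carr Y \<Longrightarrow> S (T y) = y"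
proof -
  obtain K S T where ST: "bounded_between K X Y S" "bounded_between K Y X T"
    "\<forall>x\<in>carr X. T (S x) = x" "\<forall>y\<in>carr Y. S (T y) = y"
    using nisomorphic_iff[OF assms(1,2)] assms(3) by blast
  show thesis by (rule that[OF ST(1,2)]) (use ST(3,4) in blast)+
qed

lemma nisomorphicI:
  assumes "normed X" "normed Y" "bounded_between K X Y S" "bounded_between L Y X T"
    "\<And>x. x \<in> carr X \<Longrightarrow> T (S x) = x" "\<And>y. y \<in> carr Y \<Longrightarrow> S (T y) = y"
  shows "X \<sim>\<^sub>B Y"
proof -
  have "bounded_between (max K L) X Y S" "bounded_between (max K L) Y X T"
    by (rule bounded_between_mono[OF assms(1,3)], simp) (rule bounded_between_mono[OF assms(2,4)], simp)
  then show ?thesis using nisomorphic_iff[OF assms(1,2)] assms(5,6) by blast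
qed

lemma nisomorphic_sym:
  assumes "normed X" "normed Y" "X \<sim>\<^sub>B Y"
  shows "Y \<sim>\<^sub>B X"
proof -
  obtain K S T where "bounded_between K X Y S" "bounded_between K Y X T"
    "\<And>x. x \<in> carr X \<Longrightarrow> T (S x) = x" "\<And>y. y \<in> carr Y \<Longrightarrow> S (T y) = y"
    using nisomorphicE[OF assms] by blast
  then show ?thesis by (intro nisomorphicI[OF assms(2,1)])
qed

lemma nisomorphic_trans:
  assumes "normed X" "normed Y" "normed W" "X \<sim>\<^sub>B Y" "Y \<sim>\<^sub>B W"
  shows "X \<sim>\<^sub>B W"
proof -
  obtain K S T where ST: "bounded_between K X Y S" "bounded_between K Y X T"
    "\<And>x. x \<in> carr X \<Longrightarrow> T (S x) = x" "\<And>y. y \<in> carr Y \<Longrightarrow> S (T y) = y"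
    using nisomorphicE[OF assms(1,2,4)] by blast
  obtain L U V where UV: "bounded_between L Y W U" "bounded_between L W Y V"
    "\<And>x. x \<in> carr Y \<Longrightarrow> V (U x) = x" "\<And>y. y \<in> carr W \<Longrightarrow> U (V y) = y"
    using nisomorphicE[OF assms(2,3,5)] by blast
  show ?thesis
    by (rule nisomorphicI[OF assms(1,3) bounded_between_compose[OF ST(1) UV(1)]
          bounded_between_compose[OF UV(2) ST(2)]])
      (simp_all add: ST UV bounded_betweenD(2)[OF ST(1)] bounded_betweenD(2)[OF UV(2)])
qed

lemma nisomorphic_imp_factors_through:
  assumes "normed X" "normed Y" "X \<sim>\<^sub>B Y"
  shows "\<exists>K. factors_through K X Y"
proof -
  obtain K S T where "bounded_between K X Y S" "bounded_between K Y X T"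
    "\<And>x. x \<in> carr X \<Longrightarrow> T (S x) = x" "\<And>y. y \<in> carr Y \<Longrightarrow> S (T y) = y"
    using nisomorphicE[OF assms] by blast
  then have "factors_through K X Y" by (intro factors_throughI)
  then show ?thesis by blast
qed

section \<open>Subspaces with the inherited norm, and complemented subspaces as
  factorizations\<close>

lemma normed_restrict_to:
  assumes "normed X" "subspace M" "M \<subseteq> carr X"
  shows "normed (restrict_to X M)"
proof -
  interpret normed X by (rule assms(1))
  have "x \<in> M \<Longrightarrow> x \<in> carr X" for x using assms(3) by blast
  then show ?thesis
    by (simp add: normed_def normed_space_def assms(2) nrm_nonneg nrm_eq_0 nrm_scale nrm_triangle)
qed

text \<open>The two distances may differ outside \<open>M\<close>, where the restricted one takes
  its default value, so only the balls are compared; these involve points of the carrier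
  alone.\<close>

lemma ntop_restrict_to:
  assumes "normed X" "subspace M" "M \<subseteq> carr X"
  shows "ntop (restrict_to X M) = subtopology (ntop X) M"
proof -
  interpret X: normed X by (rule assms(1))
  interpret M: normed "restrict_to X M" by (rule normed_restrict_to[OF assms])
  interpret S: Submetric "carr X" "ndist X" M
    by standard (rule assms(3))
  have *: "ndist (restrict_to X M) x y = ndist X x y" if "x \<in> M" "y \<in> M" for x y
    using that assms(3) by (auto simp: ndist_def)
  have "M.mball x r = S.sub.mball x r" for x r
    unfolding M.mball_def S.sub.mball_def using * by auto
  then have "openin (ntop (restrict_to X M)) U \<longleftrightarrow> openin S.sub.mtopology U" for U
    unfolding M.openin_mtopology S.sub.openin_mtopology by simp
  then have "ntop (restrict_to X M) = S.sub.mtopology" by (simp add: topology_eq)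
  then show ?thesis by (simp add: S.mtopology_submetric)
qed

text \<open>The inclusion of \<open>M\<close> and the projection \<open>P\<close> factor the
  identity of \<open>M\<close> through \<open>X\<close>; the isomorphism transfers this to
  \<open>Y\<close>.\<close>

lemma complemented_imp_factors_through:
  assumes X: "normed X" and Y: "normed Y" and M: "complemented_in X M" and iso: "Y \<sim>\<^sub>B restrict_to X M"
  shows "\<exists>K. factors_through K Y X"
proof -
  interpret X: normed X by (rule X)
  have sM: "subspace M" and MX: "M \<subseteq> carr X"
    using M closedin_subset[of "ntop X" M] by (auto simp: complemented_in_def closed_subspace_def)
  note NM = normed_restrict_to[OF X sM MX]
  obtain P where P: "linear_between X (restrict_to X M) P" "continuous_map (ntop X) (ntop X) P"
    "\<And>x. x \<in> M \<Longrightarrow> P x = x"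
    using M by (auto simp: complemented_in_def)
  have "continuous_map (ntop X) (ntop (restrict_to X M)) P"
    unfolding ntop_restrict_to[OF X sM MX]
    using P(1,2) by (auto simp: continuous_map_in_subtopology linear_between_def)
  then obtain L where L: "bounded_between L X (restrict_to X M) P"
    using continuous_imp_bounded_between[OF X NM P(1)] by blast
  have "bounded_between (max 1 L) (restrict_to X M) X (\<lambda>x. x)"
    using mult_right_mono[of 1 "max 1 L"] X.nrm_nonneg MX
    by (intro bounded_betweenI) (auto simp: subset_iff)
  moreover have "bounded_between (max 1 L) X (restrict_to X M) P"
    by (rule bounded_between_mono[OF X L]) simp
  ultimately have "factors_through (max 1 L) (restrict_to X M) X"
    by (rule factors_throughI) (simp add: P(3))
  then show ?thesis
    using nisomorphic_imp_factors_through[OF Y NM iso] factors_through_trans by blast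
qed

section \<open>Symmetric sequence spaces\<close>

abbreviation spread :: "(nat \<Rightarrow> nat) \<Rightarrow> (nat \<Rightarrow> real) \<Rightarrow> nat \<Rightarrow> real" where
  "spread h a \<equiv> \<lambda>j. if j \<in> range h then a (inv h j) else 0"

abbreviation fibre :: "(nat \<Rightarrow> nat) \<Rightarrow> nat \<Rightarrow> (nat \<Rightarrow> 'a::zero) \<Rightarrow> nat \<Rightarrow> 'a" where
  "fibre g k a \<equiv> \<lambda>j. if g j = k then a j else 0"

text \<open>Two isometric properties shared by c0 and the lp spaces: invariance under spreading
  along an injection, and recovery of the norm as the \<open>Z\<close>-norm of the norms of the
  pieces, for every partition of the indices into fibres of \<open>g\<close>. The second lets
  blockwise operators keep their constant. Empty fibres contribute 0.\<close>

locale symmetric_sequence_space = sequence_space Z for Z +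
  assumes spread_mem: "inj h \<Longrightarrow> spread h a \<in> carr Z \<longleftrightarrow> a \<in> carr Z"
    and spread_nrm: "inj h \<Longrightarrow> a \<in> carr Z \<Longrightarrow> nrm Z (spread h a) = nrm Z a"
    and fibre_mem: "a \<in> carr Z \<longleftrightarrow>
      (\<forall>k. fibre g k a \<in> carr Z) \<and> (\<lambda>k. nrm Z (fibre g k a)) \<in> carr Z"
    and fibre_nrm: "a \<in> carr Z \<Longrightarrow> nrm Z (\<lambda>k. nrm Z (fibre g k a)) = nrm Z a"

text \<open>This form of convergence to 0 ignores the order of the indices, so reindexing and
  grouping become statements about finite sets.\<close>

lemma null_sequence_iff_finite:
  fixes a :: "nat \<Rightarrow> real"
  shows "a \<longlonglongrightarrow> 0 \<longleftrightarrow> (\<forall>e>0. finite {j. e \<le> \<bar>a j\<bar>})"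
proof
  assume a: "a \<longlonglongrightarrow> 0"
  show "\<forall>e>0. finite {j. e \<le> \<bar>a j\<bar>}"
  proof (intro allI impI)
    fix e :: real assume "e > 0"
    then obtain K where "\<And>n. n \<ge> K \<Longrightarrow> \<bar>a n\<bar> < e" using LIMSEQ_D[OF a, of e] by auto
    then have "{j. e \<le> \<bar>a j\<bar>} \<subseteq> {..<K}" by (force simp: not_le[symmetric])
    then show "finite {j. e \<le> \<bar>a j\<bar>}" by (rule finite_subset) simp
  qed
next
  assume f: "\<forall>e>0. finite {j. e \<le> \<bar>a j\<bar>}"
  show "a \<longlonglongrightarrow> 0"
  proof (rule LIMSEQ_I)
    fix e :: real assume "e > 0"
    then obtain K where "\<forall>j\<in>{j. e \<le> \<bar>a j\<bar>}. j < K"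
      using f finite_nat_set_iff_bounded by blast
    then have "\<bar>a n\<bar> < e" if "n \<ge> K" for n using that by (meson mem_Collect_eq not_le)
    then show "\<exists>K. \<forall>n\<ge>K. norm (a n - 0) < e" by auto
  qed
qed

lemma nrm_c0_le_iff:
  assumes "a \<in> carr c0_space"
  shows "nrm c0_space a \<le> r \<longleftrightarrow> (\<forall>n. \<bar>a n\<bar> \<le> r)"
proof -
  interpret sequence_space c0_space by (rule sequence_space_c0)
  show ?thesis
    using coord[OF assms] by (auto simp: c0_space_def intro: order_trans cSUP_least)
qed

lemma symmetric_sequence_space_c0: "symmetric_sequence_space c0_space"
proof -
  interpret sequence_space c0_space by (rule sequence_space_c0)
  have c0: "a \<in> carr c0_space \<longleftrightarrow> (\<forall>e>0. finite {j. e \<le> \<bar>a j\<bar>})" for a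
    by (simp add: c0_space_def null_sequence_iff_finite)
  have eqI: "x = y" if "\<And>r. x \<le> r \<longleftrightarrow> y \<le> r" for x y :: real
    using that[of x] that[of y] by simp
  have nn: "0 \<le> nrm c0_space a" if "a \<in> carr c0_space" for a
    using coord[OF that, of 0] by linarith
  show ?thesis
  proof unfold_locales
    fix h :: "nat \<Rightarrow> nat" and a :: "nat \<Rightarrow> real" assume h: "inj h"
    have "{j. e \<le> \<bar>spread h a j\<bar>} = h ` {i. e \<le> \<bar>a i\<bar>}" if "e > 0" for e
      using that h by (auto simp: inv_f_f inj_eq)
    then show mem: "spread h a \<in> carr c0_space \<longleftrightarrow> a \<in> carr c0_space"
      using h by (auto simp: c0 finite_image_iff inj_on_subset[OF h])
    assume a: "a \<in> carr c0_space"
    have "(\<forall>n. \<bar>spread h a n\<bar> \<le> r) \<longleftrightarrow> (\<forall>n. \<bar>a n\<bar> \<le> r)" for r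
    proof
      assume s: "\<forall>n. \<bar>spread h a n\<bar> \<le> r"
      show "\<forall>n. \<bar>a n\<bar> \<le> r"
      proof
        fix n show "\<bar>a n\<bar> \<le> r" using s[rule_format, of "h n"] h by (simp add: inv_f_f)
      qed
    next
      assume s: "\<forall>n. \<bar>a n\<bar> \<le> r"
      then show "\<forall>n. \<bar>spread h a n\<bar> \<le> r" using order_trans[OF abs_ge_zero s[rule_format]] by simp
    qed
    then show "nrm c0_space (spread h a) = nrm c0_space a"
      using mem a by (intro eqI) (simp add: nrm_c0_le_iff)
  next
    fix g :: "nat \<Rightarrow> nat" and a :: "nat \<Rightarrow> real"
    show mem: "a \<in> carr c0_space \<longleftrightarrow> (\<forall>k. fibre g k a \<in> carr c0_space) \<and>
      (\<lambda>k. nrm c0_space (fibre g k a)) \<in> carr c0_space"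
    proof
      assume a: "a \<in> carr c0_space"
      have f: "fibre g k a \<in> carr c0_space" for k
        using solid[OF a, of "fibre g k a"] by simp
      have "finite {k. e \<le> \<bar>nrm c0_space (fibre g k a)\<bar>}" if e: "e > 0" for e
      proof (rule finite_subset)
        show "finite (g ` {j. e / 2 \<le> \<bar>a j\<bar>})" 
          using a[unfolded c0, rule_format, of "e / 2"] e by (intro finite_imageI) simp
        show "{k. e \<le> \<bar>nrm c0_space (fibre g k a)\<bar>} \<subseteq> g ` {j. e / 2 \<le> \<bar>a j\<bar>}"
        proof
          fix k assume "k \<in> {k. e \<le> \<bar>nrm c0_space (fibre g k a)\<bar>}"
          \<comment> \<open>Halving e avoids the question whether the supremum is attained: a norm
            of at least e exceeds e/2, hence so does some entry.\<close>
          then have "\<not> nrm c0_space (fibre g k a) \<le> e / 2" using e nn[OF f[of k]] by simp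
          then obtain j where "\<not> \<bar>fibre g k a j\<bar> \<le> e / 2" using nrm_c0_le_iff[OF f[of k]] by blast
          then show "k \<in> g ` {j. e / 2 \<le> \<bar>a j\<bar>}" using e by (auto split: if_splits)
        qed
      qed
      then show "(\<forall>k. fibre g k a \<in> carr c0_space) \<and>
        (\<lambda>k. nrm c0_space (fibre g k a)) \<in> carr c0_space" using f by (simp add: c0)
    next
      assume *: "(\<forall>k. fibre g k a \<in> carr c0_space) \<and>
        (\<lambda>k. nrm c0_space (fibre g k a)) \<in> carr c0_space"
      have "finite {j. e \<le> \<bar>a j\<bar>}" if e: "e > 0" for e
      proof (rule finite_subset)
        show "finite (\<Union>k\<in>{k. e \<le> \<bar>nrm c0_space (fibre g k a)\<bar>}. {j. e \<le> \<bar>fibre g k a j\<bar>})"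
          using * e unfolding c0 by (intro finite_UN_I) auto
        show "{j. e \<le> \<bar>a j\<bar>} \<subseteq>
          (\<Union>k\<in>{k. e \<le> \<bar>nrm c0_space (fibre g k a)\<bar>}. {j. e \<le> \<bar>fibre g k a j\<bar>})"
        proof
          fix j assume j: "j \<in> {j. e \<le> \<bar>a j\<bar>}"
          have "\<bar>fibre g (g j) a j\<bar> \<le> nrm c0_space (fibre g (g j) a)"
            using * by (intro coord) blast
          then show "j \<in> (\<Union>k\<in>{k. e \<le> \<bar>nrm c0_space (fibre g k a)\<bar>}. {j. e \<le> \<bar>fibre g k a j\<bar>})"
            using j by (intro UN_I[of "g j"]) auto
        qed
      qed
      then show "a \<in> carr c0_space" by (simp add: c0)
    qed
    assume a: "a \<in> carr c0_space"
    then have f: "fibre g k a \<in> carr c0_space" for k using mem by blast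
    have "(\<forall>k. \<bar>nrm c0_space (fibre g k a)\<bar> \<le> r) \<longleftrightarrow> (\<forall>n. \<bar>a n\<bar> \<le> r)" for r
    proof -
      have "(\<forall>k. \<bar>nrm c0_space (fibre g k a)\<bar> \<le> r) \<longleftrightarrow> (\<forall>k j. \<bar>fibre g k a j\<bar> \<le> r)"
        using nn[OF f] nrm_c0_le_iff[OF f] by simp
      also have "\<dots> \<longleftrightarrow> (\<forall>n. \<bar>a n\<bar> \<le> r)"
        by (auto intro: order_trans[OF abs_ge_zero])
      finally show ?thesis .
    qed
    then show "nrm c0_space (\<lambda>k. nrm c0_space (fibre g k a)) = nrm c0_space a"
      using mem a by (intro eqI) (simp add: nrm_c0_le_iff)
  qed
qed

text \<open>The terms are nonnegative, so the series may be replaced by the unordered sum, which can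
  be reindexed and summed in groups.\<close>

lemma lp_space_mem_iff: "a \<in> carr (lp_space p) \<longleftrightarrow> (\<exists>S. ((\<lambda>n. \<bar>a n\<bar> powr p) has_sum S) UNIV)"
  by (simp add: lp_space_def summable_on_UNIV_nonneg_real_iff[symmetric] summable_on_def)

lemma lp_space_nrm: "((\<lambda>n. \<bar>a n\<bar> powr p) has_sum S) UNIV \<Longrightarrow> nrm (lp_space p) a = S powr (1 / p)"
  by (simp add: lp_space_def sums_unique[OF has_sum_imp_sums, symmetric])

lemma symmetric_sequence_space_lp:
  assumes p: "p \<ge> 1"
  shows "symmetric_sequence_space (lp_space p)"
proof -
  interpret sequence_space "lp_space p" by (rule sequence_space_lp[OF p])
  show ?thesis
  proof unfold_locales
    fix h :: "nat \<Rightarrow> nat" and a :: "nat \<Rightarrow> real" assume h: "inj h"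
    have eq: "((\<lambda>n. \<bar>spread h a n\<bar> powr p) has_sum S) UNIV \<longleftrightarrow> ((\<lambda>n. \<bar>a n\<bar> powr p) has_sum S) UNIV" for S
    proof -
      have "((\<lambda>n. \<bar>spread h a n\<bar> powr p) has_sum S) UNIV \<longleftrightarrow>
          ((\<lambda>n. \<bar>spread h a n\<bar> powr p) has_sum S) (range h)"
        by (rule has_sum_cong_neutral) auto
      also have "\<dots> \<longleftrightarrow> ((\<lambda>n. \<bar>a n\<bar> powr p) has_sum S) UNIV"
        using h by (subst has_sum_reindex) (auto simp: o_def inv_f_f)
      finally show ?thesis .
    qed
    then show "spread h a \<in> carr (lp_space p) \<longleftrightarrow> a \<in> carr (lp_space p)"
      by (simp only: lp_space_mem_iff)
    assume "a \<in> carr (lp_space p)"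
    then obtain S where S: "((\<lambda>n. \<bar>a n\<bar> powr p) has_sum S) UNIV" by (auto simp: lp_space_mem_iff)
    then have "((\<lambda>n. \<bar>spread h a n\<bar> powr p) has_sum S) UNIV" by (simp only: eq)
    then show "nrm (lp_space p) (spread h a) = nrm (lp_space p) a"
      using S by (simp only: lp_space_nrm)
  next
    fix g :: "nat \<Rightarrow> nat" and a :: "nat \<Rightarrow> real"
    let ?f = "\<lambda>n. \<bar>a n\<bar> powr p" and ?S = "Sigma UNIV (\<lambda>k. {j. g j = k})"
    have fib: "((\<lambda>n. \<bar>fibre g k a n\<bar> powr p) has_sum S) UNIV \<longleftrightarrow> (?f has_sum S) {j. g j = k}" for k S
      by (rule has_sum_cong_neutral) auto
    \<comment> \<open>The map sending j to \<open>(g j, j)\<close> identifies the index set with the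
      disjoint union of the fibres, so that summation over fibres becomes an iterated sum.\<close>
    have sig: "(?f has_sum S) UNIV \<longleftrightarrow> ((\<lambda>z. ?f (snd z)) has_sum S) ?S" for S
    proof -
      have "?S = range (\<lambda>j. (g j, j))" by auto
      moreover have "inj (\<lambda>j. (g j, j))" by (auto intro: injI)
      ultimately show ?thesis by (simp add: has_sum_reindex o_def)
    qed
    have pow: "\<bar>nrm (lp_space p) (fibre g k a)\<bar> powr p = S" if "(?f has_sum S) {j. g j = k}" for k S
    proof -
      have "S \<ge> 0" by (rule has_sum_nonneg[OF that]) simp
      then show ?thesis using lp_space_nrm[OF that[folded fib]] p by (simp add: powr_powr)
    qed
    have key: "(?f has_sum S) UNIV \<longleftrightarrow> (\<forall>k. fibre g k a \<in> carr (lp_space p)) \<and>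
        ((\<lambda>k. \<bar>nrm (lp_space p) (fibre g k a)\<bar> powr p) has_sum S) UNIV" for S
    proof
      assume S: "(?f has_sum S) UNIV"
      then have "?f summable_on {j. g j = k}" for k
        using summable_on_subset_banach[of ?f UNIV] by (auto simp: summable_on_def)
      then have s: "(?f has_sum infsum ?f {j. g j = k}) {j. g j = k}" for k by simp
      have "((\<lambda>k. infsum ?f {j. g j = k}) has_sum S) UNIV"
        by (rule has_sum_SigmaD[OF S[unfolded sig]]) (use s in simp)
      then show "(\<forall>k. fibre g k a \<in> carr (lp_space p)) \<and>
          ((\<lambda>k. \<bar>nrm (lp_space p) (fibre g k a)\<bar> powr p) has_sum S) UNIV"
        using s by (auto simp: lp_space_mem_iff fib pow[OF s])
    next
      assume *: "(\<forall>k. fibre g k a \<in> carr (lp_space p)) \<and>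
          ((\<lambda>k. \<bar>nrm (lp_space p) (fibre g k a)\<bar> powr p) has_sum S) UNIV"
      then have "\<exists>S. (?f has_sum S) {j. g j = k}" for k
        by (simp add: lp_space_mem_iff fib)
      then have s: "(?f has_sum \<bar>nrm (lp_space p) (fibre g k a)\<bar> powr p) {j. g j = k}" for k
        using pow by metis
      show "(?f has_sum S) UNIV"
        unfolding sig
      proof (rule has_sum_SigmaI)
        show "(\<lambda>z. ?f (snd z)) summable_on ?S"
          by (rule summable_on_SigmaI[where g = "\<lambda>k. \<bar>nrm (lp_space p) (fibre g k a)\<bar> powr p"])
            (use s * in \<open>auto simp: summable_on_def\<close>)
      qed (use s * in auto)
    qed
    show "a \<in> carr (lp_space p) \<longleftrightarrow> (\<forall>k. fibre g k a \<in> carr (lp_space p)) \<and>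
      (\<lambda>k. nrm (lp_space p) (fibre g k a)) \<in> carr (lp_space p)"
      using key by (simp add: lp_space_mem_iff[of a] lp_space_mem_iff[of "\<lambda>k. nrm _ (fibre g k a)"])
    assume "a \<in> carr (lp_space p)"
    then obtain S where S: "(?f has_sum S) UNIV" by (auto simp: lp_space_mem_iff)
    then have "((\<lambda>k. \<bar>nrm (lp_space p) (fibre g k a)\<bar> powr p) has_sum S) UNIV"
      using key by blast
    then show "nrm (lp_space p) (\<lambda>k. nrm (lp_space p) (fibre g k a)) = nrm (lp_space p) a"
      using S by (simp only: lp_space_nrm)
  qed
qed

section \<open>Subsequences, and double sequences arranged along the pairing of the natural
  numbers\<close>

context symmetric_sequence_space
begin

lemma nrm_Z_nonneg: "a \<in> carr Z \<Longrightarrow> 0 \<le> nrm Z a"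
  using coord[of a 0] by linarith

text \<open>Spreading the subsequence back along \<open>h\<close> gives \<open>a\<close> with the
  entries outside \<open>range h\<close> deleted, which is dominated by \<open>a\<close>.\<close>

lemma compose_inj:
  assumes a: "a \<in> carr Z" and h: "inj h"
  shows "(\<lambda>i. a (h i)) \<in> carr Z \<and> nrm Z (\<lambda>i. a (h i)) \<le> nrm Z a"
proof -
  have s: "spread h (\<lambda>i. a (h i)) \<in> carr Z \<and> nrm Z (spread h (\<lambda>i. a (h i))) \<le> nrm Z a"
    by (rule solid[OF a]) (use h in \<open>auto simp: f_inv_into_f\<close>)
  then have "(\<lambda>i. a (h i)) \<in> carr Z" using spread_mem[OF h, of "\<lambda>i. a (h i)"] by simp
  then show ?thesis using s spread_nrm[OF h, of "\<lambda>i. a (h i)"] by simp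
qed

lemma fibre_prod_decode:
  "fibre (\<lambda>k. fst (prod_decode k)) i (\<lambda>k. case prod_decode k of (i, n) \<Rightarrow> b i n)
     = spread (\<lambda>n. prod_encode (i, n)) (b i)"
proof
  have inj: "inj (\<lambda>n. prod_encode (i, n))" by (auto intro: injI)
  fix j
  obtain i' n where d: "prod_decode j = (i', n)" by fastforce
  then have j: "j = prod_encode (i', n)" by (metis prod_decode_inverse)
  show "fibre (\<lambda>k. fst (prod_decode k)) i (\<lambda>k. case prod_decode k of (i, n) \<Rightarrow> b i n) j
     = spread (\<lambda>n. prod_encode (i, n)) (b i) j"
    using inv_f_f[OF inj, of n] by (auto simp: j)
qed

text \<open>\<open>Z\<close> is isometric to the \<open>Z\<close>-sum of countably many copies of
  itself: under the pairing, row i of the array is a fibre of the first coordinate, where it sits as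
  a spread copy of \<open>b i\<close>.\<close>

lemma double_mem:
  "(\<lambda>k. case prod_decode k of (i, n) \<Rightarrow> b i n) \<in> carr Z \<longleftrightarrow>
    (\<forall>i. b i \<in> carr Z) \<and> (\<lambda>i. nrm Z (b i)) \<in> carr Z"
  and double_nrm:
  "(\<lambda>k. case prod_decode k of (i, n) \<Rightarrow> b i n) \<in> carr Z \<Longrightarrow>
    nrm Z (\<lambda>i. nrm Z (b i)) = nrm Z (\<lambda>k. case prod_decode k of (i, n) \<Rightarrow> b i n)"
proof -
  have inj: "inj (\<lambda>n. prod_encode (i, n))" for i by (auto intro: injI)
  have eq: "(\<forall>i. b i \<in> carr Z) \<Longrightarrow>
    nrm Z (fibre (\<lambda>k. fst (prod_decode k)) i (\<lambda>k. case prod_decode k of (i, n) \<Rightarrow> b i n)) = nrm Z (b i)" for i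
    unfolding fibre_prod_decode by (rule spread_nrm[OF inj]) blast
  have mem: "(\<lambda>k. case prod_decode k of (i, n) \<Rightarrow> b i n) \<in> carr Z \<longleftrightarrow> (\<forall>i. b i \<in> carr Z) \<and>
    (\<lambda>i. nrm Z (fibre (\<lambda>k. fst (prod_decode k)) i (\<lambda>k. case prod_decode k of (i, n) \<Rightarrow> b i n))) \<in> carr Z"
    by (subst fibre_mem[of _ "\<lambda>k. fst (prod_decode k)"]) (simp only: fibre_prod_decode spread_mem[OF inj])
  then show "(\<lambda>k. case prod_decode k of (i, n) \<Rightarrow> b i n) \<in> carr Z \<longleftrightarrow>
    (\<forall>i. b i \<in> carr Z) \<and> (\<lambda>i. nrm Z (b i)) \<in> carr Z"
    using eq by (auto simp del: fibre_prod_decode)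
  assume *: "(\<lambda>k. case prod_decode k of (i, n) \<Rightarrow> b i n) \<in> carr Z"
  then show "nrm Z (\<lambda>i. nrm Z (b i)) = nrm Z (\<lambda>k. case prod_decode k of (i, n) \<Rightarrow> b i n)"
    using fibre_nrm[OF *, of "\<lambda>k. fst (prod_decode k)"] eq mem by simp
qed

end

section \<open>Pelczynski decomposition\<close>

lemma bounded_between_add:
  assumes Y: "normed Y" and S: "bounded_between K X Y S" and T: "bounded_between L X Y T"
  shows "bounded_between (K + L) X Y (\<lambda>x. S x + T x)"
proof (rule bounded_betweenI)
  interpret Y: normed Y by (rule Y)
  show "nrm Y (S x + T x) \<le> (K + L) * nrm X x" if "x \<in> carr X" for x
    using Y.nrm_triangle[of "S x" "T x"] bounded_betweenD(2,5)[OF S that] bounded_betweenD(2,5)[OF T that]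
    by (simp add: distrib_right)
  show "S x + T x \<in> carr Y" if "x \<in> carr X" for x
    using Y.carr_add bounded_betweenD(2)[OF S that] bounded_betweenD(2)[OF T that] by blast
qed (use bounded_betweenD[OF S] bounded_betweenD[OF T] in \<open>auto simp: scaleR_add_right\<close>)

lemma bounded_between_uminus:
  assumes Y: "normed Y" and T: "bounded_between K X Y T"
  shows "bounded_between K X Y (\<lambda>x. - T x)"
proof (rule bounded_betweenI)
  interpret Y: normed Y by (rule Y)
  show "nrm Y (- T x) \<le> K * nrm X x" if "x \<in> carr X" for x
    using Y.nrm_minus[of "T x"] bounded_betweenD(2,5)[OF T that] by simp
  show "- T x \<in> carr Y" if "x \<in> carr X" for x
    using subspace_neg[OF Y.subsp bounded_betweenD(2)[OF T that]] .
qed (use bounded_betweenD[OF T] in auto)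

lemma bounded_between_subtract:
  assumes Y: "normed Y" and S: "bounded_between K X Y S" and T: "bounded_between L X Y T"
  shows "bounded_between (K + L) X Y (\<lambda>x. S x - T x)"
  using bounded_between_add[OF Y S bounded_between_uminus[OF Y T]] by simp

lemma bounded_between_id: "bounded_between 1 X X (\<lambda>x. x)"
  by (intro bounded_betweenI) auto

context symmetric_sequence_space
begin

abbreviation copies :: "'a::real_vector nspace \<Rightarrow> (nat \<Rightarrow> 'a) nspace" where
  "copies X \<equiv> zsum Z (\<lambda>_. X)"

context
  fixes X :: "'a::real_vector nspace"
  assumes X: "normed X"
begin

interpretation N: normed X by (rule X)

interpretation C: z_sum Z "\<lambda>_::nat. X"
  by standard (rule N.normed_space)

lemma copies_map:
  assumes R: "bounded_between M X X R"
  shows "bounded_between M (copies X) (copies X) (\<lambda>x i. R (x i))"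
proof -
  have M: "0 \<le> M" by (rule bounded_betweenD(1)[OF R])
  have *: "(\<lambda>i. R (x i)) \<in> carr (copies X) \<and> nrm (copies X) (\<lambda>i. R (x i)) \<le> M * nrm (copies X) x"
    if x: "x \<in> carr (copies X)" for x
  proof -
    have mem: "x i \<in> carr X" for i using x by (simp add: C.carr_X)
    have Mx: "(\<lambda>i. M * nrm X (x i)) \<in> carr Z" "nrm Z (\<lambda>i. M * nrm X (x i)) = M * nrm (copies X) x"
      using scale[of "\<lambda>i. nrm X (x i)" M] x M by (simp_all add: C.carr_X C.nrm_X)
    have "(\<lambda>i. nrm X (R (x i))) \<in> carr Z \<and> nrm Z (\<lambda>i. nrm X (R (x i))) \<le> nrm Z (\<lambda>i. M * nrm X (x i))"
      using solid[OF Mx(1), of "\<lambda>i. nrm X (R (x i))"] bounded_betweenD(2,5)[OF R mem]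
        N.nrm_nonneg[OF mem] N.nrm_nonneg[OF bounded_betweenD(2)[OF R mem]] M by simp
    then show ?thesis using Mx bounded_betweenD(2)[OF R mem] by (simp add: C.carr_X C.nrm_X)
  qed
  show ?thesis
    by (rule bounded_betweenI)
      (use * M bounded_betweenD(3,4)[OF R] in \<open>auto simp: C.carr_X fun_eq_iff scaleR_fun_def\<close>)
qed

lemma copies_left_shift: "bounded_between 1 (copies X) (copies X) (\<lambda>x i. x (Suc i))"
proof (rule bounded_betweenI)
  fix x assume x: "x \<in> carr (copies X)"
  have "inj Suc" by simp
  then show "(\<lambda>i. x (Suc i)) \<in> carr (copies X)"
    "nrm (copies X) (\<lambda>i. x (Suc i)) \<le> 1 * nrm (copies X) x"
    using compose_inj[of "\<lambda>i. nrm X (x i)" Suc] x by (auto simp: C.carr_X C.nrm_X)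
qed (auto simp: scaleR_fun_def)

lemma copies_right_shift:
  "bounded_between 1 (copies X) (copies X) (\<lambda>x i. if i = 0 then 0 else x (i - 1))"
proof (rule bounded_betweenI)
  fix x assume x: "x \<in> carr (copies X)"
  have eq: "(\<lambda>i. nrm X (if i = 0 then 0 else x (i - 1))) = spread Suc (\<lambda>i. nrm X (x i))"
  proof
    fix i show "nrm X (if i = 0 then 0 else x (i - 1)) = spread Suc (\<lambda>i. nrm X (x i)) i"
      using N.nrm_eq_0[OF N.carr_0] by (cases i) (auto simp: inv_f_f)
  qed
  show "(\<lambda>i. if i = 0 then 0 else x (i - 1)) \<in> carr (copies X)"
    "nrm (copies X) (\<lambda>i. if i = 0 then 0 else x (i - 1)) \<le> 1 * nrm (copies X) x"
    using spread_mem[of Suc "\<lambda>i. nrm X (x i)"] spread_nrm[of Suc "\<lambda>i. nrm X (x i)"] x N.carr_0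
    unfolding C.carr_X C.nrm_X eq by auto
qed (auto simp: scaleR_fun_def fun_eq_iff)

lemma copies_embed_0:
  "bounded_between (nrm Z (\<lambda>i. if i = 0 then 1 else 0)) X (copies X) (\<lambda>v i. if i = 0 then v else 0)"
proof (rule bounded_betweenI)
  let ?u = "\<lambda>i::nat. if i = 0 then 1 else 0 :: real"
  show "0 \<le> nrm Z ?u" by (rule nrm_Z_nonneg[OF unit])
  fix v assume v: "v \<in> carr X"
  show "(\<lambda>i. if i = 0 then v else 0) \<in> carr (copies X)" by (rule C.single_X[OF v])
  have "(\<lambda>i::nat. nrm X (if i = 0 then v else 0)) = (\<lambda>i. nrm X v * ?u i)"
    using N.nrm_eq_0[OF N.carr_0] by auto
  then show "nrm (copies X) (\<lambda>i. if i = 0 then v else 0) \<le> nrm Z ?u * nrm X v"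
    using scale[OF unit, of "nrm X v" 0 1] N.nrm_nonneg[OF v] by (simp add: C.nrm_X)
qed (auto simp: scaleR_fun_def fun_eq_iff)

lemma copies_coordinate: "bounded_between 1 (copies X) X (\<lambda>x. x i)"
  by (rule bounded_betweenI) (use C.coord_X in \<open>auto simp: C.carr_X scaleR_fun_def\<close>)

text \<open>Write \<open>Y = copies X \<oplus> W\<close> and \<open>X = Y \<oplus> V\<close>, so that \<open>copies X = copies (copies X) \<oplus> copies W \<oplus> copies V\<close>.
  Then \<open>R\<close> is the projection of \<open>X\<close> onto \<open>W\<close>, and the isomorphism of \<open>Y\<close> with \<open>copies X\<close> inserts the
  additional copy of \<open>W\<close> by shifting \<open>copies W\<close> by one place.\<close>

theorem decomposition_method:
  fixes Y :: "'b::real_vector nspace"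
  assumes Y: "normed Y" and XY: "factors_through K (copies X) Y" and YX: "factors_through L Y X"
  shows "Y \<sim>\<^sub>B copies X"
proof -
  interpret Y: normed Y by (rule Y)
  note NC = C.XN.normed_axioms
  obtain c d where cd: "bounded_between K (copies X) Y c" "bounded_between K Y (copies X) d"
    "\<And>x. x \<in> carr (copies X) \<Longrightarrow> d (c x) = x" using factors_throughE[OF XY] by blast
  obtain a b where ab: "bounded_between L Y X a" "bounded_between L X Y b"
    "\<And>y. y \<in> carr Y \<Longrightarrow> b (a y) = y" using factors_throughE[OF YX] by blast
  \<comment> \<open>\<open>q\<close> projects \<open>Y\<close> onto the kernel of \<open>d\<close>,
    the complement \<open>W\<close> of the copy of \<open>copies X\<close>; \<open>R\<close> is the
    same projection seen inside \<open>X\<close>.\<close>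
  define q where "q y = y - c (d y)" for y
  define R where "R x = a (q (b x))" for x
  have q: "bounded_between (1 + K * K) Y Y q"
    unfolding q_def
    by (rule bounded_between_subtract[OF Y bounded_between_id bounded_between_compose[OF cd(2,1)]])
  obtain M where R: "bounded_between M X X R"
    unfolding R_def
    using bounded_between_compose[OF bounded_between_compose[OF ab(2) q] ab(1)] by blast
  note mem = bounded_betweenD(2)[OF ab(1)] bounded_betweenD(2)[OF ab(2)] bounded_betweenD(2)[OF cd(1)]
    bounded_betweenD(2)[OF cd(2)] bounded_betweenD(2)[OF q] bounded_betweenD(2)[OF R]
  have dq: "d (q y) = 0" if "y \<in> carr Y" for y
    unfolding q_def using bounded_between_diff[OF Y cd(2) that, of "c (d y)"] that cd(3) mem by simp
  have c0: "c 0 = 0" by (rule bounded_between_zero[OF NC cd(1)])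
  have qq: "q (q y) = q y" if "y \<in> carr Y" for y
    using dq[OF that] c0 by (subst q_def) simp
  have qc: "q (c s) = 0" if "s \<in> carr (copies X)" for s
    unfolding q_def using that cd(3) by simp
  have RR: "R (R x) = R x" if "x \<in> carr X" for x
    unfolding R_def using that by (simp add: mem ab(3) qq)
  have Raq: "R (a (q y)) = a (q y)" if "y \<in> carr Y" for y
    unfolding R_def using that by (simp add: mem ab(3) qq)
  have bR: "b (R x) = q (b x)" if "x \<in> carr X" for x
    unfolding R_def using that by (simp add: mem ab(3))
  \<comment> \<open>\<open>T\<close> keeps the part of each coordinate of \<open>d y\<close> outside
    \<open>W\<close>, moves the parts in \<open>W\<close> one place to the right, and puts
    \<open>q y\<close> in the freed place 0. \<open>U\<close> reads \<open>q y\<close> back from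
    coordinate 0 and moves the remaining parts in \<open>W\<close> to the left.\<close>
  define T where "T y = (d y - (\<lambda>i. R (d y i))) + ((\<lambda>i. if i = 0 then 0 else R (d y (i - 1)))
    + (\<lambda>i. if i = 0 then a (q y) else 0))" for y
  define U where "U x = c ((x - (\<lambda>i. R (x i))) + (\<lambda>i. R (x (Suc i)))) + q (b (x 0))" for x
  have Rd: "bounded_between (M * K) Y (copies X) (\<lambda>y i. R (d y i))"
    by (rule bounded_between_compose[OF cd(2) copies_map[OF R]])
  obtain KT where T: "bounded_between KT Y (copies X) T"
    unfolding T_def
    using bounded_between_add[OF NC bounded_between_subtract[OF NC cd(2) Rd]
        bounded_between_add[OF NC bounded_between_compose[OF Rd copies_right_shift]
          bounded_between_compose[OF bounded_between_compose[OF q ab(1)] copies_embed_0]]] by blast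
  have Ui: "bounded_between (1 + M + M * 1) (copies X) (copies X)
      (\<lambda>x. (x - (\<lambda>i. R (x i))) + (\<lambda>i. R (x (Suc i))))"
    by (rule bounded_between_add[OF NC bounded_between_subtract[OF NC bounded_between_id copies_map[OF R]]
          bounded_between_compose[OF copies_left_shift copies_map[OF R]]])
  obtain KU where U: "bounded_between KU (copies X) Y U"
    unfolding U_def
    using bounded_between_add[OF Y bounded_between_compose[OF Ui cd(1)]
        bounded_between_compose[OF bounded_between_compose[OF copies_coordinate[of 0] ab(2)] q]] by blast
  have memC: "x i \<in> carr X" if "x \<in> carr (copies X)" for x i using that by (simp add: C.carr_X)
  note Radd = bounded_betweenD(3)[OF R] and Rdiff = bounded_between_diff[OF X R]
  show ?thesis
  proof (rule nisomorphicI[OF Y NC T U])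
    fix y assume y: "y \<in> carr Y"
    define s where "s = d y"
    have s: "s \<in> carr (copies X)" "s i \<in> carr X" for i
      using y mem(4) memC by (auto simp: s_def)
    have Ti: "T y i = s i - R (s i) + (if i = 0 then a (q y) else R (s (i - 1)))" for i
      by (simp add: T_def s_def)
    have RT: "R (T y i) = (if i = 0 then a (q y) else R (s (i - 1)))" for i
      unfolding Ti using s y by (simp add: Radd Rdiff RR Raq mem N.carr_diff)
    have "(T y - (\<lambda>i. R (T y i))) + (\<lambda>i. R (T y (Suc i))) = s"
    proof
      fix i show "((T y - (\<lambda>i. R (T y i))) + (\<lambda>i. R (T y (Suc i)))) i = s i"
        unfolding plus_fun_apply fun_diff_def RT by (simp add: Ti)
    qed
    moreover have "q (b (T y 0)) = q y"
      using bR[OF memC[OF bounded_betweenD(2)[OF T y]], of 0] RT[of 0] ab(3) y mem by simp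
    ultimately show "U (T y) = y" by (simp add: U_def s_def q_def)
  next
    fix x assume x: "x \<in> carr (copies X)"
    define s where "s = (x - (\<lambda>i. R (x i))) + (\<lambda>i. R (x (Suc i)))"
    have s: "s \<in> carr (copies X)" using bounded_betweenD(2)[OF Ui x] by (simp add: s_def)
    have si: "s i = x i - R (x i) + R (x (Suc i))" for i by (simp add: s_def)
    have Rs: "R (s i) = R (x (Suc i))" for i
      unfolding si using memC[OF x] by (simp add: Radd Rdiff RR mem N.carr_diff)
    have Ux: "U x = c s + q (b (x 0))" by (simp add: U_def s_def)
    have m: "c s \<in> carr Y" "b (x 0) \<in> carr Y" "q (b (x 0)) \<in> carr Y" using s memC[OF x] mem by auto
    have dU: "d (U x) = s"
      unfolding Ux using bounded_betweenD(3)[OF cd(2) m(1,3)] dq[OF m(2)] cd(3)[OF s] by simp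
    have qU: "q (U x) = q (b (x 0))"
      unfolding Ux using bounded_betweenD(3)[OF q m(1,3)] qc[OF s] qq[OF m(2)] by simp
    show "T (U x) = x"
    proof
      fix i show "T (U x) i = x i"
        unfolding T_def dU qU plus_fun_apply fun_diff_def Rs
        by (cases i) (simp_all add: si R_def)
    qed
  qed
qed

end

end

section \<open>Diagonal factorizations\<close>

locale symmetric_z_sum = symmetric_sequence_space Z + z_sum Z E
  for Z and E :: "nat \<Rightarrow> 'a::real_vector nspace"
begin

abbreviation part :: "nat set \<Rightarrow> (nat \<Rightarrow> 'a) nspace" where
  "part I \<equiv> restrict_to X {x \<in> carr X. \<forall>n. n \<notin> I \<longrightarrow> x n = 0}"

lemma partial_sum_eq_part: "partial_sum X (summand X) I = part I"
  using partial_sum_summand[of I] by (simp add: partial_sum_def)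

lemma nrm_E_zero [simp]: "nrm (E n) 0 = 0"
  using normed.nrm_eq_0[OF N normed.carr_0[OF N]] by simp

lemma part_subspace: "subspace {x \<in> carr X. \<forall>n. n \<notin> I \<longrightarrow> x n = 0}"
  using XN.subsp by (auto simp: subspace_def scaleR_fun_def)

lemma normed_part: "normed (part I)"
  by (rule normed_restrict_to[OF XN.normed_axioms part_subspace]) auto

lemma cutoff_mem:
  assumes "x \<in> carr X"
  shows "(\<lambda>n. if n \<in> I then x n else 0) \<in> carr (part I)"
    and "nrm X (\<lambda>n. if n \<in> I then x n else 0) \<le> nrm X x"
  using solid_X[OF assms, of "\<lambda>n. if n \<in> I then x n else 0"] assms normed.carr_0[OF N]
  by (auto simp: carr_X normed.nrm_nonneg[OF N])

lemma part_mono_factors: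
  assumes "I \<subseteq> J"
  shows "factors_through 1 (part I) (part J)"
proof (rule factors_throughI)
  show "bounded_between 1 (part I) (part J) (\<lambda>x. x)"
    by (rule bounded_betweenI) (use assms in auto)
  show "bounded_between 1 (part J) (part I) (\<lambda>x n. if n \<in> I then x n else 0)"
    by (rule bounded_betweenI) (use cutoff_mem[of _ I] in \<open>auto simp: fun_eq_iff scaleR_fun_def\<close>)
qed (auto simp: fun_eq_iff)

lemma carr_fibre_iff:
  "x \<in> carr X \<longleftrightarrow> (\<forall>j. x j \<in> carr (E j)) \<and> (\<forall>k. fibre g k x \<in> carr X) \<and>
    (\<lambda>k. nrm X (fibre g k x)) \<in> carr Z"
  and nrm_fibre: "x \<in> carr X \<Longrightarrow> nrm Z (\<lambda>k. nrm X (fibre g k x)) = nrm X x"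
proof -
  have eq: "(\<lambda>j. nrm (E j) (fibre g k x j)) = fibre g k (\<lambda>j. nrm (E j) (x j))" for k
    by auto
  show "x \<in> carr X \<longleftrightarrow> (\<forall>j. x j \<in> carr (E j)) \<and> (\<forall>k. fibre g k x \<in> carr X) \<and>
    (\<lambda>k. nrm X (fibre g k x)) \<in> carr Z"
    unfolding carr_X nrm_X eq using fibre_mem[of "\<lambda>j. nrm (E j) (x j)" g] normed.carr_0[OF N] by auto
  show "x \<in> carr X \<Longrightarrow> nrm Z (\<lambda>k. nrm X (fibre g k x)) = nrm X x"
    unfolding carr_X nrm_X eq by (rule fibre_nrm) blast
qed

text \<open>The operators act block by block. Since the norm of a vector is the
  \<open>Z\<close>-norm of the norms of its blocks, a bound common to all blocks is a bound for the
  whole operator, and the constant is unchanged.\<close>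

lemma diagonal_factors:
  fixes G :: "nat \<Rightarrow> 'g::real_vector nspace"
  assumes G: "\<And>k. normed (G k)" and f: "\<And>k. factors_through K (G k) (part {j. g j = k})"
  shows "factors_through K (zsum Z G) X"
proof -
  interpret W: z_sum Z G by standard (rule normed.normed_space[OF G])
  define F where "F k A B \<longleftrightarrow> bounded_between K (G k) (part {j. g j = k}) A \<and>
    bounded_between K (part {j. g j = k}) (G k) B \<and> (\<forall>x\<in>carr (G k). B (A x) = x)" for k A B
  have "\<forall>k. \<exists>A B. F k A B"
    using f unfolding factors_through_def F_def by blast
  then obtain A B where "\<And>k. F k (A k) (B k)" by metis
  then have A: "\<And>k. bounded_between K (G k) (part {j. g j = k}) (A k)"
    and B: "\<And>k. bounded_between K (part {j. g j = k}) (G k) (B k)"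
    and BA: "\<And>k x. x \<in> carr (G k) \<Longrightarrow> B k (A k x) = x"
    by (auto simp: F_def)
  have K: "0 \<le> K" by (rule bounded_betweenD(1)[OF A])
  have dom: "c \<in> carr Z \<and> nrm Z c \<le> K * nrm Z b"
    if "b \<in> carr Z" "\<And>k. 0 \<le> c k" "\<And>k. c k \<le> K * b k" for b c :: "nat \<Rightarrow> real"
  proof -
    have "\<bar>c k\<bar> \<le> \<bar>K * b k\<bar>" for k using that(2,3)[of k] by simp
    then show ?thesis using solid[of "\<lambda>k. K * b k" c] scale[OF that(1), of K] K by simp
  qed
  let ?A = "\<lambda>w j. A (g j) (w (g j)) j" and ?B = "\<lambda>x k. B k (fibre g k x)"
  \<comment> \<open>\<open>A k (w k)\<close> already vanishes outside the k-th block, so assembling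
    the images and then cutting out block k gives it back.\<close>
  have Afib: "fibre g k (?A w) = A k (w k)" if "w \<in> carr (zsum Z G)" for w k
    using bounded_betweenD(2)[OF A[of k], of "w k"] that by (auto simp: W.carr_X fun_eq_iff)
  have fib: "fibre g k x \<in> carr (part {j. g j = k})" if "x \<in> carr X" for x k
    using cutoff_mem(1)[OF that, of "{j. g j = k}"] by simp
  have memA: "?A w \<in> carr X \<and> nrm X (?A w) \<le> K * nrm (zsum Z G) w" if w: "w \<in> carr (zsum Z G)" for w
  proof -
    have wk: "w k \<in> carr (G k)" for k using w by (simp add: W.carr_X)
    have Awk: "A k (w k) \<in> carr X" "nrm X (A k (w k)) \<le> K * nrm (G k) (w k)" for k
      using bounded_betweenD(2,5)[OF A wk, of k] by auto
    have d: "(\<lambda>k. nrm X (fibre g k (?A w))) \<in> carr Z \<and>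
        nrm Z (\<lambda>k. nrm X (fibre g k (?A w))) \<le> K * nrm Z (\<lambda>k. nrm (G k) (w k))"
      unfolding Afib[OF w]
      by (rule dom) (use w Awk XN.nrm_nonneg[OF Awk(1)] in \<open>auto simp: W.carr_X\<close>)
    have "?A w \<in> carr X"
      unfolding carr_fibre_iff[of "?A w" g]
      using d Awk(1) by (auto simp: Afib[OF w]) (simp add: carr_X)
    then show ?thesis using d nrm_fibre[of "?A w" g] by (simp add: W.nrm_X)
  qed
  have memB: "?B x \<in> carr (zsum Z G) \<and> nrm (zsum Z G) (?B x) \<le> K * nrm X x" if x: "x \<in> carr X" for x
  proof -
    have Bk: "?B x k \<in> carr (G k)" "nrm (G k) (?B x k) \<le> K * nrm X (fibre g k x)" for k
      using bounded_betweenD(2,5)[OF B fib[OF x], of k] by auto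
    have "(\<lambda>k. nrm (G k) (?B x k)) \<in> carr Z \<and>
        nrm Z (\<lambda>k. nrm (G k) (?B x k)) \<le> K * nrm Z (\<lambda>k. nrm X (fibre g k x))"
      by (rule dom) (use carr_fibre_iff[of x g] x Bk normed.nrm_nonneg[OF G Bk(1)] in auto)
    then show ?thesis using Bk(1) nrm_fibre[OF x] by (simp add: W.carr_X W.nrm_X)
  qed
  show ?thesis
  proof (rule factors_throughI)
    show "bounded_between K (zsum Z G) X ?A"
    proof (rule bounded_betweenI[OF K])
      show "?A (x + y) = ?A x + ?A y" if "x \<in> carr (zsum Z G)" "y \<in> carr (zsum Z G)" for x y
        using bounded_betweenD(3)[OF A] that by (auto simp: W.carr_X fun_eq_iff)
      show "?A (c *\<^sub>R x) = c *\<^sub>R ?A x" if "x \<in> carr (zsum Z G)" for c x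
        using bounded_betweenD(4)[OF A] that by (auto simp: W.carr_X fun_eq_iff scaleR_fun_def)
    qed (use memA in auto)
    show "bounded_between K X (zsum Z G) ?B"
    proof (rule bounded_betweenI[OF K])
      show "?B (x + y) = ?B x + ?B y" if "x \<in> carr X" "y \<in> carr X" for x y
      proof
        fix k
        have "fibre g k (x + y) = fibre g k x + fibre g k y" by auto
        then show "?B (x + y) k = (?B x + ?B y) k"
          using bounded_betweenD(3)[OF B fib[OF that(1)] fib[OF that(2)]] by simp
      qed
      show "?B (c *\<^sub>R x) = c *\<^sub>R ?B x" if "x \<in> carr X" for c x
      proof
        fix k
        have "fibre g k (c *\<^sub>R x) = c *\<^sub>R fibre g k x" by (auto simp: scaleR_fun_def)
        then show "?B (c *\<^sub>R x) k = (c *\<^sub>R ?B x) k"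
          using bounded_betweenD(4)[OF B fib[OF that]] by (simp add: scaleR_fun_def)
      qed
    qed (use memB in auto)
    show "?B (?A w) = w" if "w \<in> carr (zsum Z G)" for w
      using that BA by (auto simp: Afib[OF that] W.carr_X)
  qed
qed

text \<open>The double sum, flattened by the pairing, is a \<open>Z\<close>-sum of the
  \<open>E n\<close> in which each index n recurs infinitely often. The maps \<open>?A\<close> and
  \<open>?B\<close> are mutually inverse isometries.\<close>

lemma copies_factors:
  "factors_through 1 (copies X) (zsum Z (\<lambda>k. E (snd (prod_decode k))))"
proof -
  let ?G = "\<lambda>k. E (snd (prod_decode k))"
  interpret W: z_sum Z ?G by standard (rule normed_E)
  interpret C: z_sum Z "\<lambda>_::nat. X" by standard (rule normed_X)
  let ?A = "\<lambda>s k. case prod_decode k of (i, n) \<Rightarrow> s i n" and ?B = "\<lambda>w i n. w (prod_encode (i, n))"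
  have eq: "(\<lambda>k. nrm (?G k) (?A s k)) = (\<lambda>k. case prod_decode k of (i, n) \<Rightarrow> nrm (E n) (s i n))" for s
    by (auto split: prod.split)
  have "(\<forall>k. ?A s k \<in> carr (?G k)) \<longleftrightarrow> (\<forall>i n. s i n \<in> carr (E n))" for s
    by (auto split: prod.split) (metis prod_encode_inverse)
  then have mem: "?A s \<in> carr (zsum Z ?G) \<longleftrightarrow> s \<in> carr (copies X)" for s
    unfolding C.carr_X W.carr_X carr_X nrm_X eq double_mem by auto
  have nrm: "nrm (zsum Z ?G) (?A s) = nrm (copies X) s" if "s \<in> carr (copies X)" for s
  proof -
    have "?A s \<in> carr (zsum Z ?G)" using that by (simp only: mem)
    then have "(\<lambda>k. nrm (?G k) (?A s k)) \<in> carr Z" by (simp only: W.carr_X)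
    then show ?thesis unfolding C.nrm_X W.nrm_X nrm_X eq by (rule double_nrm[symmetric])
  qed
  have AB: "?A (?B w) = w" for w by (simp add: case_prod_beta)
  show ?thesis
  proof (rule factors_throughI)
    show "bounded_between 1 (copies X) (zsum Z ?G) ?A"
      by (rule bounded_betweenI) (use mem nrm in \<open>auto split: prod.split simp: scaleR_fun_def\<close>)
    show "bounded_between 1 (zsum Z ?G) (copies X) ?B"
    proof (rule bounded_betweenI)
      fix w assume w: "w \<in> carr (zsum Z ?G)"
      then have "?A (?B w) \<in> carr (zsum Z ?G)" by (simp only: AB)
      then show m: "?B w \<in> carr (copies X)" by (simp only: mem)
      show "nrm (copies X) (?B w) \<le> 1 * nrm (zsum Z ?G) w"
        using nrm[OF m] by (simp only: AB mult_1_left order_refl)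
    qed (auto simp: scaleR_fun_def fun_eq_iff)
  qed auto
qed

end

section \<open>Finite-dimensional spaces\<close>

lemma finite_dimensional_basis:
  assumes "finite_dimensional V"
  obtains B where "finite B" "independent B" "V = span B"
proof -
  obtain A where A: "finite A" "V = span A" using assms by (auto simp: finite_dimensional_def)
  obtain B where B: "B \<subseteq> A" "independent B" "A \<subseteq> span B"
    by (rule real_vector.maximal_independent_subset)
  have "span A = span B"
    using B span_minimal[OF B(3) subspace_span] span_mono[OF B(1)] by blast
  then show thesis using that[of B] A B finite_subset[OF B(1)] by auto
qed

lemma nrm_sum_le:
  assumes V: "normed V" and f: "\<And>i. i \<in> A \<Longrightarrow> f i \<in> carr V"
  shows "nrm V (\<Sum>i\<in>A. f i) \<le> (\<Sum>i\<in>A. nrm V (f i))"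
  using f
proof (induction A rule: infinite_finite_induct)
  case (insert a A)
  have "(\<Sum>i\<in>A. f i) \<in> carr V"
    using insert.prems by (intro subspace_sum[OF normed.subsp[OF V]]) auto
  then show ?case
    using insert normed.nrm_triangle[OF V, of "f a" "\<Sum>i\<in>A. f i"] by fastforce
qed (use normed.nrm_eq_0[OF V normed.carr_0[OF V]] in simp_all)

text \<open>The coefficient functions carry the product topology, in which the unit sphere of the maximum
  norm is compact.\<close>

lemma coefficients_bounded:
  fixes V :: "'a::real_vector nspace"
  assumes V: "normed V" and B: "finite B" "independent B" "carr V = span B"
  obtains C where "0 \<le> C" "\<forall>c. \<forall>b\<in>B. \<bar>c b\<bar> \<le> C * nrm V (\<Sum>b\<in>B. c b *\<^sub>R b)"
proof (cases "B = {}")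
  case True
  then show thesis using that[of 0] by simp
next
  case False
  interpret V: normed V by (rule V)
  have bV: "b \<in> carr V" if "b \<in> B" for b using that B(3) span_base by blast
  let ?v = "\<lambda>c. \<Sum>b\<in>B. c b *\<^sub>R b"
  have v: "?v c \<in> carr V" for c
    by (intro subspace_sum[OF V.subsp] V.carr_scale bV)
  have nrm_sum: "nrm V (?v c) \<le> (\<Sum>b\<in>B. \<bar>c b\<bar> * nrm V b)" for c
    using nrm_sum_le[OF V, of B "\<lambda>b. c b *\<^sub>R b"] V.carr_scale bV V.nrm_scale by simp
  define f where "f c = nrm V (?v c)" for c
  have lip: "\<bar>f c - f d\<bar> \<le> (\<Sum>b\<in>B. \<bar>c b - d b\<bar> * nrm V b)" for c d
  proof -
    have cd: "?v c - ?v d = ?v (\<lambda>b. c b - d b)" "?v d - ?v c = ?v (\<lambda>b. d b - c b)"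
      by (simp_all add: sum_subtractf scaleR_diff_left)
    have "f c \<le> f d + nrm V (?v (\<lambda>b. c b - d b))" "f d \<le> f c + nrm V (?v (\<lambda>b. d b - c b))"
      unfolding f_def
      using V.nrm_triangle[OF v[of d] v[of "\<lambda>b. c b - d b"]] V.nrm_triangle[OF v[of c] v[of "\<lambda>b. d b - c b"]]
      by (simp_all add: cd[symmetric])
    then show ?thesis
      using nrm_sum[of "\<lambda>b. c b - d b"] nrm_sum[of "\<lambda>b. d b - c b"] by (simp add: abs_minus_commute)
  qed
  have "(f \<longlongrightarrow> f d) (at d)" for d
  proof -
    have co: "((\<lambda>c. c b) \<longlongrightarrow> d b) (at d)" for b
    proof -
      have "continuous_on UNIV (\<lambda>c::'a \<Rightarrow> real. c b)" by simp
      then show ?thesis by (simp add: continuous_on_def)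
    qed
    have "((\<lambda>c. \<Sum>b\<in>B. \<bar>c b - d b\<bar> * nrm V b) \<longlongrightarrow> (\<Sum>b\<in>B. \<bar>d b - d b\<bar> * nrm V b)) (at d)"
      by (intro tendsto_intros co)
    then have g: "((\<lambda>c. \<Sum>b\<in>B. \<bar>c b - d b\<bar> * nrm V b) \<longlongrightarrow> 0) (at d)" by simp
    have "((\<lambda>c. f c - f d) \<longlongrightarrow> 0) (at d)"
      by (rule Lim_null_comparison[OF always_eventually g]) (simp add: lip)
    then show ?thesis by (simp add: LIM_zero_iff)
  qed
  then have cont: "continuous_on S f" for S
    using continuous_on_subset[of UNIV f S] by (simp add: continuous_on_def)
  \<comment> \<open>Coefficients outside \<open>B\<close> are pinned to 0, which makes the box a
    product of compact sets over all indices; the closed union selects its maximum-norm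
    sphere.\<close>
  define S where "S = Pi\<^sub>E UNIV (\<lambda>b. if b \<in> B then {-1..1} else {0::real}) \<inter> (\<Union>b\<in>B. {c. \<bar>c b\<bar> = 1})"
  have "compactin euclidean (Pi\<^sub>E UNIV (\<lambda>b. if b \<in> B then {-1..1} else {0::real}))"
    unfolding euclidean_product_topology[symmetric] compactin_PiE by auto
  moreover have "closed (\<Union>b\<in>B. {c. \<bar>c b\<bar> = (1::real)})"
    using B(1) by (intro closed_UN ballI closed_Collect_eq continuous_on_rabs) auto
  ultimately have "compact S" unfolding S_def by (simp add: compact_Int_closed)
  moreover obtain b0 where "b0 \<in> B" using False by blast
  then have "(\<lambda>b. if b = b0 then 1 else 0) \<in> S" by (auto simp: S_def)
  ultimately obtain m where m: "m \<in> S" "\<And>c. c \<in> S \<Longrightarrow> f m \<le> f c"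
    using continuous_attains_inf[of S f] cont by blast
  have "f m \<noteq> 0"
  proof
    assume "f m = 0"
    then have "?v m = 0" using V.nrm_eq_0[OF v] by (simp add: f_def)
    then have "m b = 0" if "b \<in> B" for b
      using real_vector.independentD[OF B(2,1) subset_refl, of m b] that by simp
    then show False using m(1) by (auto simp: S_def)
  qed
  then have pos: "f m > 0" using V.nrm_nonneg[OF v] by (simp add: f_def less_le)
  have "\<forall>c. \<forall>b\<in>B. \<bar>c b\<bar> \<le> 1 / f m * nrm V (?v c)"
  proof (intro allI ballI)
    fix c :: "'a \<Rightarrow> real" and b assume b: "b \<in> B"
    define M where "M = Max ((\<lambda>b. \<bar>c b\<bar>) ` B)"
    have le: "\<bar>c b\<bar> \<le> M" if "b \<in> B" for b unfolding M_def using that B(1) by simp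
    have "M \<in> (\<lambda>b. \<bar>c b\<bar>) ` B" unfolding M_def using B(1) False by (intro Max_in) auto
    then obtain b1 where b1: "b1 \<in> B" "M = \<bar>c b1\<bar>" by blast
    show "\<bar>c b\<bar> \<le> 1 / f m * nrm V (?v c)"
    proof (cases "M = 0")
      case True
      then show ?thesis using le[OF b] pos V.nrm_nonneg[OF v[of c]] by simp
    next
      case False
      then have M: "M > 0" using b1 by simp
      \<comment> \<open>Dividing by the largest coefficient and resetting the values off
        \<open>B\<close> brings \<open>c\<close> onto \<open>S\<close>; homogeneity then turns the
        minimum \<open>f m\<close> into the constant \<open>1 / f m\<close>.\<close>
      let ?c = "\<lambda>b. if b \<in> B then c b / M else 0"
      have "- M \<le> c b \<and> c b \<le> M" if "b \<in> B" for b using le[OF that] by linarith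
      then have "?c \<in> S" using M b1 by (auto simp: S_def field_simps intro!: bexI[of _ b1])
      then have "f m \<le> f ?c" by (rule m(2))
      also have "?v ?c = (1 / M) *\<^sub>R ?v c"
        by (simp add: scaleR_sum_right)
      then have "f ?c = nrm V (?v c) / M"
        using V.nrm_scale[OF v[of c], of "1 / M"] M by (simp add: f_def)
      finally have "M \<le> nrm V (?v c) / f m" using M pos by (simp add: field_simps)
      then show ?thesis using le[OF b] by simp
    qed
  qed
  then show thesis by (rule that[rotated]) (use pos in simp)
qed

lemma representation_bounded:
  fixes V :: "'a::real_vector nspace"
  assumes V: "normed V" and B: "finite B" "independent B" "carr V = span B"
  obtains C where "0 \<le> C" "\<forall>x\<in>carr V. \<forall>b\<in>B. \<bar>representation B x b\<bar> \<le> C * nrm V x"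
proof -
  obtain C where C: "0 \<le> C" "\<forall>c. \<forall>b\<in>B. \<bar>c b\<bar> \<le> C * nrm V (\<Sum>b\<in>B. c b *\<^sub>R b)"
    using coefficients_bounded[OF assms] by blast
  have "\<bar>representation B x b\<bar> \<le> C * nrm V x" if "x \<in> carr V" "b \<in> B" for x b
    using C(2)[rule_format, OF that(2), of "representation B x"] that(1) B(3)
      real_vector.sum_representation_eq[OF B(2) _ B(1) subset_refl, of x] by simp
  then show thesis using that[OF C(1)] by blast
qed

abbreviation real_line :: "real nspace" where
  "real_line \<equiv> \<lparr>carr = UNIV, nrm = abs\<rparr>"

text \<open>A coordinate functional divided by its norm \<open>s\<close> gives \<phi>, and rescaling
  a vector at which it exceeds half its norm gives \<open>e\<close>. The 2 is the price for not
  attaining the supremum.\<close>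

lemma almost_norming_functional:
  fixes V :: "'a::real_vector nspace"
  assumes V: "normed V" and fd: "finite_dimensional (carr V)" and nz: "carr V \<noteq> {0}"
  obtains \<phi> e where "bounded_between 1 V real_line \<phi>" "e \<in> carr V" "\<phi> e = 1" "nrm V e \<le> 2"
proof -
  interpret V: normed V by (rule V)
  obtain B where B: "finite B" "independent B" "carr V = span B"
    using finite_dimensional_basis[OF fd] by blast
  obtain C where C: "0 \<le> C" "\<forall>x\<in>carr V. \<forall>b\<in>B. \<bar>representation B x b\<bar> \<le> C * nrm V x"
    using representation_bounded[OF V B] by blast
  have "B \<noteq> {}" using nz B(3) real_vector.span_empty by metis
  then obtain b where b: "b \<in> B" by blast
  define r where "r x = representation B x b" for x
  have rlin: "r (x + y) = r x + r y" "r (c *\<^sub>R x) = c * r x" if "x \<in> carr V" "y \<in> carr V" for x y c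
    using that real_vector.representation_add[OF B(2)] real_vector.representation_scale[OF B(2)] B(3)
    by (auto simp: r_def)
  have bV: "b \<in> carr V" using b B(3) span_base by blast
  have b0: "b \<noteq> 0" using b B(2) real_vector.dependent_zero by blast
  have nb: "nrm V b > 0" using V.nrm_nonneg[OF bV] V.nrm_eq_0[OF bV] b0 by simp
  define A where "A = (\<lambda>x. \<bar>r x\<bar>) ` {x \<in> carr V. nrm V x \<le> 1}"
  define s where "s = Sup A"
  have "a \<le> C" if a: "a \<in> A" for a
  proof -
    obtain x where "x \<in> carr V" "nrm V x \<le> 1" "a = \<bar>r x\<bar>" using a by (auto simp: A_def)
    then show ?thesis using C(2)[rule_format, of x b] b mult_left_mono[of "nrm V x" 1 C] C(1) by (simp add: r_def)
  qed
  then have bdd: "bdd_above A" by (auto simp: bdd_above_def)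
  have up: "\<bar>r x\<bar> \<le> s" if "x \<in> carr V" "nrm V x \<le> 1" for x
    unfolding s_def using that bdd by (intro cSup_upper) (auto simp: A_def)
  have sx: "\<bar>r x\<bar> \<le> s * nrm V x" if x: "x \<in> carr V" for x
  proof (cases "x = 0")
    case True
    then show ?thesis using rlin(2)[OF x x, of 0] V.nrm_eq_0[OF x] by simp
  next
    case False
    then have nx: "nrm V x > 0" using V.nrm_nonneg[OF x] V.nrm_eq_0[OF x] by simp
    then show ?thesis
      using up[OF V.carr_scale[OF x, of "1 / nrm V x"]] V.nrm_scale[OF x, of "1 / nrm V x"]
        rlin(2)[OF x x, of "1 / nrm V x"] by (simp add: abs_mult field_simps)
  qed
  have "r b = 1" using real_vector.representation_basis[OF B(2) b] by (simp add: r_def)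
  then have "1 \<le> s * nrm V b" using sx[OF bV] by simp
  then have s: "s > 0" using nb by (smt (verit) mult_nonpos_nonneg)
  have "A \<noteq> {}" using V.carr_0 V.nrm_eq_0[OF V.carr_0] by (auto simp: A_def)
  then obtain a where "a \<in> A" "s / 2 < a"
    using less_cSup_iff[OF _ bdd, of "s / 2"] s by (auto simp: s_def)
  then obtain x where x: "x \<in> carr V" "nrm V x \<le> 1" "s / 2 < \<bar>r x\<bar>" by (auto simp: A_def)
  show thesis
  \<comment> \<open>The factor \<open>s / r x\<close> forces the value 1; its modulus is below 2
    because \<open>\<bar>r x\<bar>\<close> exceeds \<open>s / 2\<close>.\<close>
  proof (rule that[of "\<lambda>x. r x / s" "(s / r x) *\<^sub>R x"])
    show "bounded_between 1 V real_line (\<lambda>x. r x / s)"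
      by (rule bounded_betweenI) (use rlin sx s in \<open>auto simp: field_simps\<close>)
    show "(s / r x) *\<^sub>R x \<in> carr V" using x(1) V.carr_scale by blast
    show "r ((s / r x) *\<^sub>R x) / s = 1" using rlin(2)[OF x(1) x(1)] s x(3) by auto
    have "nrm V ((s / r x) *\<^sub>R x) = s / \<bar>r x\<bar> * nrm V x"
      using V.nrm_scale[OF x(1)] s by simp
    also have "\<dots> \<le> s / \<bar>r x\<bar> * 1" using x s by (intro mult_left_mono) auto
    also have "\<dots> \<le> 2" using x(3) s by (simp add: field_simps)
    finally show "nrm V ((s / r x) *\<^sub>R x) \<le> 2" .
  qed
qed

text \<open>A dimension count: a vector missed by the image, joined to the image of a basis, would
  give more independent vectors than the dimension allows. \<open>U\<close> is linear on the carrier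
  only, so it is first replaced by a linear map \<open>h\<close> of the ambient space that agrees
  with it there.\<close>

lemma bounded_between_injective_imp_surjective:
  fixes V :: "'a::real_vector nspace"
  assumes V: "normed V" and fd: "finite_dimensional (carr V)" and U: "bounded_between K V V U"
    and inj: "\<And>x. x \<in> carr V \<Longrightarrow> U x = 0 \<Longrightarrow> x = 0"
  shows "U ` carr V = carr V"
proof -
  interpret V: normed V by (rule V)
  obtain B where B: "finite B" "independent B" "carr V = span B"
    using finite_dimensional_basis[OF fd] by blast
  obtain h where h: "linear h" "\<And>b. b \<in> B \<Longrightarrow> h b = U b"
    using real_vector.linear_independent_extend[OF B(2), of U] by blast
  have "x \<in> carr V \<and> h x = U x" if "x \<in> span B" for x
    using that
  proof (induction rule: span_induct_alt)
    case base
    then show ?case using linear_0[OF h(1)] bounded_between_zero[OF V U] V.carr_0 by simp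
  next
    case (step c b y)
    have b: "b \<in> carr V" using step(1) span_base[of b B] B(3) by simp
    have "h (c *\<^sub>R b + y) = c *\<^sub>R U b + U y"
      using step h by (simp add: linear_add linear_scale)
    also have "\<dots> = U (c *\<^sub>R b + y)"
      using bounded_betweenD(3)[OF U V.carr_scale[OF b], of y c] bounded_betweenD(4)[OF U b, of c] step
      by simp
    finally show ?case using V.carr_add[OF V.carr_scale[OF b]] step by simp
  qed
  then have hU: "h x = U x" if "x \<in> carr V" for x using that B(3) by blast
  have ker: "x = y" if "x \<in> carr V" "y \<in> carr V" "h x = h y" for x y
  proof -
    have "h (x - y) = 0" using that(3) by (simp add: linear_diff[OF h(1)])
    then show ?thesis using inj[of "x - y"] hU[of "x - y"] V.carr_diff[OF that(1,2)] by simp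
  qed
  have injB: "inj_on h (span B)" using ker by (auto simp: inj_on_def B(3))
  have ind: "independent (h ` B)"
    by (rule linear_independent_injective_image[OF h(1) B(2) injB])
  have sub: "h ` carr V \<subseteq> carr V" using hU bounded_betweenD(2)[OF U] by auto
  have "h ` carr V = span (h ` B)" by (simp add: B(3) linear_span_image[OF h(1)])
  moreover have "y \<in> span (h ` B)" if y: "y \<in> carr V" for y
  proof (rule ccontr)
    assume "y \<notin> span (h ` B)"
    then have "independent (insert y (h ` B))" "y \<notin> h ` B"
      using ind span_base[of y "h ` B"] by (auto simp: real_vector.independent_insert)
    moreover have "insert y (h ` B) \<subseteq> span B"
      using y sub B(3) span_superset[of B] by blast
    ultimately have "card (insert y (h ` B)) \<le> card B" "y \<notin> h ` B"
      using real_vector.independent_span_bound[OF B(1)] by auto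
    moreover have "card (h ` B) = card B"
      by (rule card_image[OF inj_on_subset[OF injB span_superset]])
    ultimately show False using B(1) by simp
  qed
  ultimately have "h ` carr V = carr V" using sub by blast
  then show ?thesis using hU by (metis image_cong)
qed

text \<open>The triangle inequality makes \<open>U\<close> bounded below by 1/2, hence injective
  and, by finite dimension, onto; the bound 2 for the inverse is the reciprocal of that lower
  bound.\<close>

lemma near_identity_left_inverse:
  fixes V :: "'a::real_vector nspace"
  assumes V: "normed V" and fd: "finite_dimensional (carr V)" and U: "bounded_between K V V U"
    and near: "\<And>x. x \<in> carr V \<Longrightarrow> nrm V (x - U x) \<le> nrm V x / 2"
  obtains W where "bounded_between 2 V V W" "\<And>x. x \<in> carr V \<Longrightarrow> W (U x) = x"
proof -
  interpret V: normed V by (rule V)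
  have UV: "U x \<in> carr V" if "x \<in> carr V" for x using bounded_betweenD(2)[OF U that] .
  have low: "nrm V x \<le> 2 * nrm V (U x)" if "x \<in> carr V" for x
    using V.nrm_triangle[OF V.carr_diff[OF that UV[OF that]] UV[OF that]] near[OF that] by simp
  have ker: "x = 0" if "x \<in> carr V" "U x = 0" for x
    using low[OF that(1)] that(2) V.nrm_nonneg[OF that(1)] V.nrm_eq_0[OF that(1)]
      V.nrm_eq_0[OF V.carr_0] by simp
  have surj: "U ` carr V = carr V"
    by (rule bounded_between_injective_imp_surjective[OF V fd U ker])
  have inj: "inj_on U (carr V)"
    using ker[OF V.carr_diff] bounded_between_diff[OF V U] by (auto simp: inj_on_def)
  define W where "W = inv_into (carr V) U"
  have WU: "W (U x) = x" if "x \<in> carr V" for x using inv_into_f_f[OF inj that] by (simp add: W_def)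
  have "bounded_between 2 V V W"
  proof (rule bounded_betweenI)
    fix x y assume "x \<in> carr V" "y \<in> carr V"
    then obtain x' y' where xy: "x = U x'" "y = U y'" "x' \<in> carr V" "y' \<in> carr V" using surj by blast
    show "W x \<in> carr V" "nrm V (W x) \<le> 2 * nrm V x" using low xy by (simp_all add: WU)
    show "W (x + y) = W x + W y"
      using WU[OF V.carr_add[OF xy(3,4)]] xy bounded_betweenD(3)[OF U xy(3,4)] by (simp add: WU)
    show "W (c *\<^sub>R x) = c *\<^sub>R W x" for c
      using WU[OF V.carr_scale[OF xy(3)]] xy bounded_betweenD(4)[OF U xy(3)] by (simp add: WU)
  qed simp
  then show thesis using that WU by blast
qed

section \<open>Finite sums of operators, shifts of the sequence space, and interval blocks\<close>

lemma bounded_between_finite_sum: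
  assumes X: "normed X" and Y: "normed Y" and T: "\<And>i. i \<in> A \<Longrightarrow> bounded_between (K i) X Y (T i)"
  shows "bounded_between (\<Sum>i\<in>A. K i) X Y (\<lambda>x. \<Sum>i\<in>A. T i x)"
  using T
proof (induction A rule: infinite_finite_induct)
  case (insert a A)
  then show ?case using bounded_between_add[OF Y, of "K a" X "T a" "\<Sum>i\<in>A. K i"] by simp
qed (use normed.nrm_eq_0[OF Y normed.carr_0[OF Y]] in
    \<open>simp_all add: bounded_between_def linear_between_def image_subset_iff normed.carr_0[OF Y]\<close>)

lemma (in sequence_space) normed_Z: "normed Z"
proof
  have zero: "(\<lambda>_. 0) \<in> carr Z" using unit[of 0 0] by simp
  have nn: "0 \<le> nrm Z a" if "a \<in> carr Z" for a using coord[OF that, of 0] by linarith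
  have "nrm Z a = 0 \<longleftrightarrow> a = 0" if "a \<in> carr Z" for a
  proof
    show "a = 0" if "nrm Z a = 0" using coord[OF \<open>a \<in> carr Z\<close>] that by (auto simp: fun_eq_iff)
    show "nrm Z a = 0" if "a = 0" using scale[OF zero, of 0] that by (simp add: zero_fun_def)
  qed
  moreover have "subspace (carr Z)"
    using zero add scale by (auto simp: subspace_def zero_fun_def plus_fun_def scaleR_fun_def)
  ultimately show "normed_space Z"
    using nn add scale by (auto simp: normed_space_def plus_fun_def scaleR_fun_def)
qed

lemma (in symmetric_sequence_space) left_shift_Z: "bounded_between 1 Z Z (\<lambda>a i. a (i + D))"
  by (rule bounded_betweenI) (use compose_inj[of _ "\<lambda>i. i + D"] in \<open>auto simp: scaleR_fun_def\<close>)

lemma (in symmetric_sequence_space) right_shift_Z: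
  "bounded_between 1 Z Z (\<lambda>a i. if i < D then 0 else a (i - D))"
proof -
  have inj: "inj (\<lambda>i. i + D)" by simp
  have "(\<lambda>i. if i < D then 0 else a (i - D)) = spread (\<lambda>i. i + D) a" for a :: "nat \<Rightarrow> real"
  proof
    fix i show "(if i < D then 0 else a (i - D)) = spread (\<lambda>i. i + D) a i"
    proof (cases "i < D")
      case True
      then have "i \<notin> range (\<lambda>i. i + D)" by auto
      then show ?thesis using True by simp
    next
      case False
      then obtain k where "i = k + D" using le_Suc_ex[of D i] by (auto simp: add.commute)
      then show ?thesis using inv_f_f[OF inj, of k] by simp
    qed
  qed
  then show ?thesis
    using spread_mem[OF inj] spread_nrm[OF inj]
    by (intro bounded_betweenI) (auto simp: fun_eq_iff scaleR_fun_def)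
qed

text \<open>\<open>g j\<close> is the first k whose right end \<open>m (Suc k)\<close> lies beyond
  j. Minimality puts the left end at or before j when k is positive, and \<open>m 0 = 0\<close> does
  so for k = 0.\<close>

lemma block_index:
  fixes m :: "nat \<Rightarrow> nat"
  assumes m: "strict_mono m" and m0: "m 0 = 0"
  obtains g where "\<And>j k. g j = k \<longleftrightarrow> m k \<le> j \<and> j < m (Suc k)"
proof -
  define g where "g j = (LEAST k. j < m (Suc k))" for j
  have ex: "j < m (Suc j)" for j using strict_mono_imp_increasing[OF m, of "Suc j"] by simp
  have lt: "j < m (Suc (g j))" for j unfolding g_def by (rule LeastI[of "\<lambda>k. j < m (Suc k)", OF ex])
  have le: "m (g j) \<le> j" for j
  proof (cases "g j")
    case (Suc k)
    then have "\<not> j < m (Suc k)" using not_less_Least[of k "\<lambda>k. j < m (Suc k)"] by (simp add: g_def)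
    then show ?thesis using Suc by simp
  qed (simp add: m0)
  have "g j = k" if "m k \<le> j" "j < m (Suc k)" for j k
  proof (rule antisym)
    show "g j \<le> k" unfolding g_def by (rule Least_le[of "\<lambda>k. j < m (Suc k)", OF that(2)])
    have "m k < m (Suc (g j))" using that(1) lt[of j] by simp
    then show "k \<le> g j" using strict_mono_less[OF m] by simp
  qed
  then show thesis using that[of g] lt le by blast
qed

section \<open>Sums of nonzero finite-dimensional spaces\<close>

locale fd_z_sum = symmetric_z_sum Z E
  for Z and E :: "nat \<Rightarrow> 'a::real_vector nspace" +
  assumes fd: "finite_dimensional (carr (E n))" and nonzero: "carr (E n) \<noteq> {0}"
begin

section \<open>Operators on partial sums from which absorption is built\<close>

lemma single_bounded:
  assumes "n \<in> I"
  shows "bounded_between (nrm Z (\<lambda>k. if k = n then 1 else 0)) (E n) (part I)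
    (\<lambda>v k. if k = n then v else 0)"
proof (rule bounded_betweenI)
  let ?u = "\<lambda>k. if k = n then 1 else 0 :: real"
  show "0 \<le> nrm Z ?u" by (rule nrm_Z_nonneg[OF unit])
  fix v assume v: "v \<in> carr (E n)"
  show "(\<lambda>k. if k = n then v else 0) \<in> carr (part I)" using single_X[OF v] assms by auto
  have "(\<lambda>k. nrm (E k) (if k = n then v else 0)) = (\<lambda>k. nrm (E n) v * ?u k)" by auto
  then show "nrm (part I) (\<lambda>k. if k = n then v else 0) \<le> nrm Z ?u * nrm (E n) v"
    using scale[OF unit, of "nrm (E n) v" n 1] normed.nrm_nonneg[OF N v] by (simp add: nrm_X)
qed (auto simp: scaleR_fun_def fun_eq_iff)

lemma coordinate_bounded: "bounded_between 1 (part I) (E n) (\<lambda>x. x n)"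
  by (rule bounded_betweenI) (use coord_X in \<open>auto simp: carr_X scaleR_fun_def\<close>)

lemma cutoff_bounded: "bounded_between 1 (part J) (part I) (\<lambda>x n. if n \<in> I then x n else 0)"
  by (rule bounded_betweenI) (use cutoff_mem[of _ I] in \<open>auto simp: fun_eq_iff scaleR_fun_def\<close>)

lemma inclusion_bounded: "I \<subseteq> J \<Longrightarrow> bounded_between 1 (part I) (part J) (\<lambda>x. x)"
  by (rule bounded_betweenI) auto

text \<open>The constant 2 is the bound on the vectors \<open>e n\<close>. When functionals with
  value 1 at \<open>e n\<close> read off the coefficients, as in \<open>functionals_bounded\<close>,
  this map becomes a complemented embedding of \<open>Z\<close> across the summands in
  \<open>range h\<close>.\<close>

lemma line_bounded:
  assumes h: "inj h" and e: "\<And>n. e n \<in> carr (E n)" "\<And>n. nrm (E n) (e n) \<le> 2"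
  shows "bounded_between 2 Z (part (range h)) (\<lambda>u n. if n \<in> range h then u (inv h n) *\<^sub>R e n else 0)"
proof (rule bounded_betweenI)
  fix u assume u: "u \<in> carr Z"
  let ?x = "\<lambda>n. if n \<in> range h then u (inv h n) *\<^sub>R e n else 0"
  have s: "spread h u \<in> carr Z" "nrm Z (spread h u) = nrm Z u"
    using spread_mem[OF h] spread_nrm[OF h] u by auto
  have "\<bar>nrm (E n) (?x n)\<bar> \<le> \<bar>2 * spread h u n\<bar>" for n
    using mult_left_mono[OF e(2)[of n], of "\<bar>u (inv h n)\<bar>"] normed.nrm_scale[OF N e(1)]
      normed.nrm_nonneg[OF N e(1)[of n]] by (simp add: abs_mult)
  then have "(\<lambda>n. nrm (E n) (?x n)) \<in> carr Z \<and> nrm Z (\<lambda>n. nrm (E n) (?x n)) \<le> nrm Z (\<lambda>n. 2 * spread h u n)"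
    by (rule solid[OF scale[OF s(1), THEN conjunct1]])
  then show "?x \<in> carr (part (range h))" "nrm (part (range h)) ?x \<le> 2 * nrm Z u"
    using scale[OF s(1), of 2] s(2) e(1) normed.carr_scale[OF N] normed.carr_0[OF N]
    by (auto simp: carr_X nrm_X)
qed (auto simp: scaleR_fun_def fun_eq_iff scaleR_add_left)

lemma functionals_bounded:
  assumes h: "inj h" and \<phi>: "\<And>n. bounded_between 1 (E n) real_line (\<phi> n)"
  shows "bounded_between 1 (part J) Z (\<lambda>x i. \<phi> (h i) (x (h i)))"
proof (rule bounded_betweenI)
  fix x assume x: "x \<in> carr (part J)"
  then have xE: "x n \<in> carr (E n)" and xZ: "(\<lambda>n. nrm (E n) (x n)) \<in> carr Z" for n
    by (auto simp: carr_X)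
  have c: "(\<lambda>i. nrm (E (h i)) (x (h i))) \<in> carr Z"
    "nrm Z (\<lambda>i. nrm (E (h i)) (x (h i))) \<le> nrm X x"
    using compose_inj[OF xZ h] by (simp_all add: nrm_X)
  have "(\<lambda>i. \<phi> (h i) (x (h i))) \<in> carr Z \<and>
      nrm Z (\<lambda>i. \<phi> (h i) (x (h i))) \<le> nrm Z (\<lambda>i. nrm (E (h i)) (x (h i)))"
    by (rule solid[OF c(1)]) (use bounded_betweenD(5)[OF \<phi> xE] in \<open>simp add: normed.nrm_nonneg[OF N xE]\<close>)
  then show "(\<lambda>i. \<phi> (h i) (x (h i))) \<in> carr Z" "nrm Z (\<lambda>i. \<phi> (h i) (x (h i))) \<le> 1 * nrm (part J) x"
    using c(2) by auto
qed (use bounded_betweenD(3,4)[OF \<phi>] in \<open>auto simp: carr_X scaleR_fun_def fun_eq_iff\<close>)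

text \<open>Plain isomorphism hides its constant, but the later choice of blocks needs one
  absorption constant valid for all infinite sets at once.\<close>

definition part_iso :: "real \<Rightarrow> nat set \<Rightarrow> nat set \<Rightarrow> bool" where
  "part_iso C I J \<longleftrightarrow> (\<exists>S T. bounded_between C (part I) (part J) S \<and> bounded_between C (part J) (part I) T \<and>
    (\<forall>x\<in>carr (part I). T (S x) = x) \<and> (\<forall>y\<in>carr (part J). S (T y) = y))"

lemma part_isoI:
  assumes "bounded_between C (part I) (part J) S" "bounded_between C (part J) (part I) T"
    "\<And>x. x \<in> carr (part I) \<Longrightarrow> T (S x) = x" "\<And>y. y \<in> carr (part J) \<Longrightarrow> S (T y) = y"
  shows "part_iso C I J"
  unfolding part_iso_def
  by (rule exI[of _ S], rule exI[of _ T]) (use assms in simp)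

lemma part_isoE:
  assumes "part_iso C I J"
  obtains S T where "bounded_between C (part I) (part J) S" "bounded_between C (part J) (part I) T"
    "\<forall>x\<in>carr (part I). T (S x) = x" "\<forall>y\<in>carr (part J). S (T y) = y"
  using assms unfolding part_iso_def by (elim exE conjE)

lemma part_iso_trans:
  assumes IJ: "part_iso C I J" and JL: "part_iso D J L"
  shows "part_iso (D * C) I L"
proof (rule part_isoE[OF IJ], rule part_isoE[OF JL])
  fix S T U V
  assume ST: "bounded_between C (part I) (part J) S" "bounded_between C (part J) (part I) T"
    "\<forall>x\<in>carr (part I). T (S x) = x" "\<forall>y\<in>carr (part J). S (T y) = y"
  assume UV: "bounded_between D (part J) (part L) U" "bounded_between D (part L) (part J) V"
    "\<forall>x\<in>carr (part J). V (U x) = x" "\<forall>y\<in>carr (part L). U (V y) = y"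
  show "part_iso (D * C) I L"
  proof (rule part_isoI[OF bounded_between_compose[OF ST(1) UV(1)]])
    show "bounded_between (D * C) (part L) (part I) (\<lambda>x. T (V x))"
      using bounded_between_compose[OF UV(2) ST(2)] by (simp only: mult.commute)
    show "T (V (U (S x))) = x" if "x \<in> carr (part I)" for x
      using ST(3)[rule_format, OF that] UV(3)[rule_format, OF bounded_betweenD(2)[OF ST(1) that]]
      by simp
    show "U (S (T (V y))) = y" if "y \<in> carr (part L)" for y
      using UV(4)[rule_format, OF that] ST(4)[rule_format, OF bounded_betweenD(2)[OF UV(2) that]]
      by simp
  qed
qed

lemma part_iso_imp_factors:
  assumes "part_iso C I J"
  shows "factors_through C (part I) (part J)"
proof (rule part_isoE[OF assms])
  fix S T
  assume ST: "bounded_between C (part I) (part J) S" "bounded_between C (part J) (part I) T"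
    "\<forall>x\<in>carr (part I). T (S x) = x"
  show "factors_through C (part I) (part J)"
    by (rule factors_throughI[OF ST(1,2)]) (use ST(3) in blast)
qed

lemma part_iso_imp_nisomorphic:
  assumes "part_iso C I J"
  shows "part I \<sim>\<^sub>B part J"
  using assms unfolding nisomorphic_iff[OF normed_part normed_part] part_iso_def by (rule exI[of _ C])

text \<open>In an infinite sum one additional summand is absorbed: choose in each summand a line spanned
  by \<open>e n\<close>, complemented by \<open>\<phi> n\<close> uniformly in \<open>n\<close>; these lines span a complemented copy of \<open>Z\<close>, which
  makes room for \<open>D\<close> more dimensions by a shift.  The constant does not depend on the infinite set.\<close>

lemma absorb_one:
  "\<exists>C. \<forall>\<beta>. infinite \<beta> \<and> m \<notin> \<beta> \<longrightarrow> part_iso C (insert m \<beta>) \<beta>"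
proof -
  define F where "F n \<phi> e \<longleftrightarrow> bounded_between 1 (E n) real_line \<phi> \<and> e \<in> carr (E n) \<and>
    \<phi> e = 1 \<and> nrm (E n) e \<le> 2" for n \<phi> e
  have "\<exists>\<phi> e. F n \<phi> e" for n
    unfolding F_def by (rule almost_norming_functional[OF N fd nonzero]) (intro exI conjI; assumption)
  then obtain \<phi> e where "\<And>n. F n (\<phi> n) (e n)" by metis
  then have \<phi>: "\<And>n. bounded_between 1 (E n) real_line (\<phi> n)" and e: "\<And>n. e n \<in> carr (E n)"
    "\<And>n. nrm (E n) (e n) \<le> 2" and \<phi>e: "\<And>n. \<phi> n (e n) = 1" by (auto simp: F_def)
  obtain B where B: "finite B" "independent B" "carr (E m) = span B"
    using finite_dimensional_basis[OF fd] by blast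
  obtain C where C: "0 \<le> C" "\<forall>x\<in>carr (E m). \<forall>b\<in>B. \<bar>representation B x b\<bar> \<le> C * nrm (E m) x"
    using representation_bounded[OF N B] by blast
  define D where "D = card B"
  obtain p where p: "bij_betw p {..<D} B"
    using ex_bij_betw_nat_finite[OF B(1)] by (auto simp: D_def lessThan_atLeast0)
  have pB: "p i \<in> B" if "i < D" for i using p that by (auto simp: bij_betw_def)
  have pE: "p i \<in> carr (E m)" if "i < D" for i using pB[OF that] B(3) span_base by blast
  let ?u = "\<lambda>n k. if k = n then 1 else 0 :: real"
  \<comment> \<open>With a basis of \<open>E m\<close>, \<rho> stores a vector in the first
    \<open>D\<close> places of \<open>Z\<close> and \<sigma> reads it back. Writing \<rho> as a sum
    of multiples of unit vectors reduces its boundedness to that of finitely many simple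
    operators.\<close>
  define \<rho> where "\<rho> v i = (\<Sum>k<D. (\<lambda>j. if j = k then representation B v (p k) else 0)) i" for v i
  define \<sigma> where "\<sigma> u = (\<Sum>k<D. u k *\<^sub>R p k)" for u :: "nat \<Rightarrow> real"
  have \<rho>_apply: "\<rho> v i = (if i < D then representation B v (p i) else 0)" for v i
    by (simp add: \<rho>_def sum_fun_apply)
  have "bounded_between (\<Sum>k<D. C * nrm Z (?u k)) (E m) Z \<rho>"
    unfolding \<rho>_def
  proof (intro bounded_between_finite_sum[OF N normed_Z])
    fix k assume "k \<in> {..<D}"
    then have k: "p k \<in> B" using pB by simp
    show "bounded_between (C * nrm Z (?u k)) (E m) Z (\<lambda>v j. if j = k then representation B v (p k) else 0)"
    proof (rule bounded_betweenI)
      show "0 \<le> C * nrm Z (?u k)" using C(1) nrm_Z_nonneg[OF unit] by simp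
      fix v assume v: "v \<in> carr (E m)"
      show "(\<lambda>j. if j = k then representation B v (p k) else 0) \<in> carr Z" by (rule unit)
      have "(\<lambda>j. if j = k then representation B v (p k) else 0) = (\<lambda>j. representation B v (p k) * ?u k j)"
        by auto
      then have "nrm Z (\<lambda>j. if j = k then representation B v (p k) else 0)
          = \<bar>representation B v (p k)\<bar> * nrm Z (?u k)"
        using scale[OF unit, of "representation B v (p k)" k 1] by simp
      also have "\<dots> \<le> C * nrm (E m) v * nrm Z (?u k)"
        using C(2) v k by (intro mult_right_mono nrm_Z_nonneg[OF unit]) blast
      finally show "nrm Z (\<lambda>j. if j = k then representation B v (p k) else 0)
          \<le> C * nrm Z (?u k) * nrm (E m) v" by (simp add: mult_ac)
    qed (use real_vector.representation_add[OF B(2)] real_vector.representation_scale[OF B(2)] B(3)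
        in \<open>auto simp: fun_eq_iff scaleR_fun_def\<close>)
  qed
  then obtain Kr where \<rho>: "bounded_between Kr (E m) Z \<rho>" by blast
  have "bounded_between (\<Sum>k<D. nrm (E m) (p k)) Z (E m) \<sigma>"
    unfolding \<sigma>_def
  proof (intro bounded_between_finite_sum[OF normed_Z N])
    fix k assume "k \<in> {..<D}"
    then have k: "p k \<in> carr (E m)" using pE by simp
    show "bounded_between (nrm (E m) (p k)) Z (E m) (\<lambda>u. u k *\<^sub>R p k)"
      by (rule bounded_betweenI)
        (use k normed.carr_scale[OF N k] normed.nrm_scale[OF N k] normed.nrm_nonneg[OF N k] coord
          in \<open>auto simp: scaleR_add_left scaleR_fun_def mult.commute intro!: mult_right_mono\<close>)
  qed
  then obtain Ks where \<sigma>: "bounded_between Ks Z (E m) \<sigma>" by blast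
  have \<sigma>\<rho>: "\<sigma> (\<lambda>i. if i < D then representation B v (p i) else w i) = v" if "v \<in> carr (E m)" for v w
  proof -
    have "\<sigma> (\<lambda>i. if i < D then representation B v (p i) else w i)
        = (\<Sum>k<D. representation B v (p k) *\<^sub>R p k)" by (simp add: \<sigma>_def)
    also have "\<dots> = (\<Sum>b\<in>B. representation B v b *\<^sub>R b)"
      by (rule sum.reindex_bij_betw[OF p])
    also have "\<dots> = v"
      using real_vector.sum_representation_eq[OF B(2) _ B(1) subset_refl, of v] that B(3) by simp
    finally show ?thesis .
  qed
  have \<rho>\<sigma>: "representation B (\<sigma> u) (p i) = u i" if i: "i < D" for u i
  proof -
    have ps: "p k \<in> span B" if "k < D" for k using pB[OF that] by (rule span_base)
    have "representation B (\<sigma> u) = (\<lambda>b. \<Sum>k<D. representation B (u k *\<^sub>R p k) b)"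
      unfolding \<sigma>_def using pB B(2)
      by (intro real_vector.representation_sum) (auto intro: span_scale span_base)
    then have "representation B (\<sigma> u) (p i) = (\<Sum>k<D. u k * representation B (p k) (p i))"
      using real_vector.representation_scale[OF B(2) ps] by (auto intro!: sum.cong)
    also have "\<dots> = (\<Sum>k<D. if k = i then u i else 0)"
      using pB B(2) i bij_betw_imp_inj_on[OF p]
      by (intro sum.cong) (auto simp: real_vector.representation_basis inj_on_def)
    finally show ?thesis using i by simp
  qed
  \<comment> \<open>These are the bounds for \<open>S\<close> and \<open>T\<close> obtained term by
    term below. They involve m and its basis, but are fixed before the infinite set \<beta>
    appears.\<close>
  define K1 where "K1 = (1 + 2 * 1) + 2 * (1 * 1 + Kr * 1)"
  define K2 where "K2 = 1 * ((1 + 2 * 1) + 2 * (1 * 1)) + nrm Z (?u m) * (Ks * 1)"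
  have "part_iso (max K1 K2) (insert m \<beta>) \<beta>" if "infinite \<beta>" "m \<notin> \<beta>" for \<beta>
  proof -
    define h where "h = enumerate \<beta>"
    have h: "inj h" "range h = \<beta>"
      using that strict_mono_enumerate[of \<beta>] range_enumerate[of \<beta>] strict_mono_imp_inj_on by (auto simp: h_def)
    have ih: "inv h (h i) = i" "n \<in> \<beta> \<Longrightarrow> h (inv h n) = n" for i n
      using h by (auto simp: inv_f_f f_inv_into_f)
    note NP = normed_part
    define t where "t x i = \<phi> (h i) (x (h i))" for x and i :: nat
    define l where "l u n = (if n \<in> \<beta> then u (inv h n) *\<^sub>R e n else 0)" for u :: "nat \<Rightarrow> real" and n
    define cut where "cut x n = (if n \<in> \<beta> then x n else 0)" for x :: "nat \<Rightarrow> 'a" and n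
    define rs where "rs u i = (if i < D then 0 else u (i - D))" for u :: "nat \<Rightarrow> real" and i
    define ls where "ls u i = u (i + D)" for u :: "nat \<Rightarrow> real" and i
    define sg where "sg v k = (if k = m then v else 0)" for v :: 'a and k
    have t: "bounded_between 1 (part J) Z t" for J
      unfolding t_def by (rule functionals_bounded[OF h(1) \<phi>])
    have l: "bounded_between 2 Z (part \<beta>) l"
      using line_bounded[OF h(1) e] unfolding l_def h(2) .
    have cut: "bounded_between 1 (part J) (part \<beta>) cut" for J
      unfolding cut_def by (rule cutoff_bounded)
    have rs: "bounded_between 1 Z Z rs" unfolding rs_def by (rule right_shift_Z)
    have ls: "bounded_between 1 Z Z ls" unfolding ls_def by (rule left_shift_Z)
    have sg: "bounded_between (nrm Z (?u m)) (E m) (part (insert m \<beta>)) sg"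
      unfolding sg_def by (rule single_bounded) simp
    \<comment> \<open>Outside the lines the summands of \<beta> stay untouched. Along the lines
      \<open>S\<close> writes the \<open>D\<close> coordinates of \<open>x m\<close> followed by the
      old coefficients moved right by \<open>D\<close>; \<open>T\<close> returns the first
      \<open>D\<close> coefficients to \<open>E m\<close> and moves the others left.\<close>
    define S where "S x = (cut x - l (t x)) + l (rs (t x) + \<rho> (x m))" for x
    define T where "T y = ((cut y - l (t y)) + l (ls (t y))) + sg (\<sigma> (t y))" for y
    have S: "bounded_between K1 (part (insert m \<beta>)) (part \<beta>) S"
      unfolding S_def K1_def
      by (intro bounded_between_add[OF NP] bounded_between_subtract[OF NP] cut
          bounded_between_compose[OF t l] bounded_between_compose[OF _ l]
          bounded_between_add[OF normed_Z] bounded_between_compose[OF t rs]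
          bounded_between_compose[OF coordinate_bounded \<rho>])
    have T1: "bounded_between ((1 + 2 * 1) + 2 * (1 * 1)) (part \<beta>) (part \<beta>)
        (\<lambda>y. (cut y - l (t y)) + l (ls (t y)))"
      by (intro bounded_between_add[OF NP] bounded_between_subtract[OF NP] cut
          bounded_between_compose[OF t l] bounded_between_compose[OF _ l] bounded_between_compose[OF t ls])
    have T: "bounded_between K2 (part \<beta>) (part (insert m \<beta>)) T"
      unfolding T_def K2_def
      by (rule bounded_between_add[OF NP bounded_between_compose[OF T1 inclusion_bounded]
            bounded_between_compose[OF bounded_between_compose[OF t \<sigma>] sg]]) auto
    \<comment> \<open>Exchanging the component of v along \<open>e n\<close> for a multiple c of
      \<open>e n\<close> makes the functional take the value c. This is what lets \<open>S\<close>
      and \<open>T\<close> be checked on coefficients.\<close>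
    have \<phi>lin: "\<phi> n ((v - \<phi> n v *\<^sub>R e n) + c *\<^sub>R e n) = c" if v: "v \<in> carr (E n)" for n v c
    proof -
      have ce: "d *\<^sub>R e n \<in> carr (E n)" "\<phi> n (d *\<^sub>R e n) = d" for d
        using normed.carr_scale[OF N e(1)] bounded_betweenD(4)[OF \<phi> e(1)] \<phi>e by simp_all
      show ?thesis
        using bounded_betweenD(3)[OF \<phi> normed.carr_diff[OF N v ce(1)] ce(1)]
          bounded_between_diff[OF N \<phi> v ce(1)] ce(2) by simp
    qed
    have memE: "x n \<in> carr (E n)" if "x \<in> carr (part J)" for x n J using that by (simp add: carr_X)
    have S\<beta>: "S x n = (x n - \<phi> n (x n) *\<^sub>R e n) +
        (if inv h n < D then representation B (x m) (p (inv h n)) else t x (inv h n - D)) *\<^sub>R e n"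
      if "n \<in> \<beta>" for x n
      using that ih by (simp add: S_def cut_def l_def t_def rs_def \<rho>_apply)
    have T\<beta>: "T y n = (y n - \<phi> n (y n) *\<^sub>R e n) + t y (inv h n + D) *\<^sub>R e n"
      if "n \<in> \<beta>" for y n
      using that ih \<open>m \<notin> \<beta>\<close> by (auto simp: T_def cut_def l_def t_def ls_def sg_def)
    have Tm: "T y m = \<sigma> (t y)" for y
      using \<open>m \<notin> \<beta>\<close> by (simp add: T_def cut_def l_def sg_def)
    have h\<beta>: "h i \<in> \<beta>" for i using h(2) by blast
    have tS: "t (S x) = (\<lambda>i. if i < D then representation B (x m) (p i) else t x (i - D))"
      if "x \<in> carr (part (insert m \<beta>))" for x
      using \<phi>lin[OF memE[OF that]] by (intro ext) (simp add: t_def[of "S x"] S\<beta>[OF h\<beta>] ih)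
    have tT: "t (T y) i = t y (i + D)" if "y \<in> carr (part \<beta>)" for y i
      using \<phi>lin[OF memE[OF that]] by (simp add: t_def[of "T y"] T\<beta>[OF h\<beta>] ih)
    have TS: "T (S x) = x" if x: "x \<in> carr (part (insert m \<beta>))" for x
    proof
      fix n
      have \<phi>S: "\<phi> n (S x n) = (if inv h n < D then representation B (x m) (p (inv h n)) else t x (inv h n - D))"
        if "n \<in> \<beta>" using \<phi>lin[OF memE[OF x]] S\<beta>[OF that] by simp
      consider "n \<in> \<beta>" | "n = m" | "n \<notin> \<beta>" "n \<noteq> m" by blast
      then show "T (S x) n = x n"
      proof cases
        case 1
        have "T (S x) n = (S x n - (if inv h n < D then representation B (x m) (p (inv h n))
            else t x (inv h n - D)) *\<^sub>R e n) + t x (inv h n) *\<^sub>R e n"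
          by (simp only: T\<beta>[OF 1] \<phi>S[OF 1] tS[OF x]) simp
        then show ?thesis unfolding S\<beta>[OF 1] using ih(2)[OF 1] by (simp add: t_def)
      next
        case 2
        then show ?thesis using \<sigma>\<rho>[OF memE[OF x]] by (simp add: Tm tS[OF x])
      next
        case 3
        then show ?thesis using x bounded_betweenD(2)[OF T bounded_betweenD(2)[OF S x]] by auto
      qed
    qed
    have ST: "S (T y) = y" if y: "y \<in> carr (part \<beta>)" for y
    proof
      fix n
      show "S (T y) n = y n"
      proof (cases "n \<in> \<beta>")
        case True
        have \<phi>T: "\<phi> n (T y n) = t y (inv h n + D)" using \<phi>lin[OF memE[OF y]] T\<beta>[OF True] by simp
        have "(if inv h n < D then representation B (T y m) (p (inv h n)) else t (T y) (inv h n - D))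
            = t y (inv h n)"
          using \<rho>\<sigma> tT[OF y] by (simp add: Tm)
        then have "S (T y) n = (T y n - t y (inv h n + D) *\<^sub>R e n) + t y (inv h n) *\<^sub>R e n"
          by (simp only: S\<beta>[OF True] \<phi>T)
        then show ?thesis unfolding T\<beta>[OF True] using ih(2)[OF True] by (simp add: t_def)
      next
        case False
        then show ?thesis using y bounded_betweenD(2)[OF S bounded_betweenD(2)[OF T y]] by auto
      qed
    qed
    show ?thesis
      by (rule part_isoI[OF bounded_between_mono[OF NP S max.cobounded1]
            bounded_between_mono[OF NP T max.cobounded2] TS ST])
  qed
  then show ?thesis by blast
qed

text \<open>The new summand is absorbed by \<alpha> \<union> \<beta>, and then \<alpha> by \<beta>.
  Constants multiply along the induction and depend on the finite set alone.\<close>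

lemma absorb_finite:
  assumes "finite \<alpha>"
  shows "\<exists>C\<ge>0. \<forall>\<beta>. infinite \<beta> \<and> \<alpha> \<inter> \<beta> = {} \<longrightarrow> part_iso C (\<alpha> \<union> \<beta>) \<beta>"
  using assms
proof (induction \<alpha> rule: finite_induct)
  case empty
  have "part_iso 1 \<beta> \<beta>" for \<beta> using part_isoI[OF bounded_between_id bounded_between_id] by simp
  then show ?case by (intro exI[of _ 1]) simp
next
  case (insert m \<alpha>)
  then obtain C where C: "C \<ge> 0" "\<And>\<beta>. infinite \<beta> \<Longrightarrow> \<alpha> \<inter> \<beta> = {} \<Longrightarrow> part_iso C (\<alpha> \<union> \<beta>) \<beta>" by blast
  obtain D where D: "\<And>\<beta>. infinite \<beta> \<Longrightarrow> m \<notin> \<beta> \<Longrightarrow> part_iso D (insert m \<beta>) \<beta>"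
    using absorb_one[of m] by blast
  have "part_iso (C * D) (insert m \<alpha> \<union> \<beta>) \<beta>" if "infinite \<beta>" "insert m \<alpha> \<inter> \<beta> = {}" for \<beta>
    using part_iso_trans[OF D[of "\<alpha> \<union> \<beta>"] C(2)[of \<beta>]] that insert.hyps by auto
  \<comment> \<open>One instance settles the sign, since \<open>bounded_between\<close> records that
    its constant is nonnegative.\<close>
  moreover have "D \<ge> 0"
    using D[of "{Suc m..}"] by (auto simp: infinite_Ici elim!: part_isoE dest: bounded_betweenD(1))
  ultimately show ?case using C(1) by (intro exI[of _ "C * D"]) simp
qed

text \<open>Finite dimension makes the truncation error of \<open>A x\<close> uniformly small
  relative to x, as it suffices to control it on a basis. For large \<open>M\<close> the truncated
  composition is then close to the identity and has a left inverse of norm at most 2, whence the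
  doubled constant.\<close>

lemma factors_tail_imp_interval:
  assumes "factors_through K (E n) (part {m..})"
  obtains M where "m < M" "factors_through (2 * K) (E n) (part {m..<M})"
proof -
  obtain A B where A: "bounded_between K (E n) (part {m..}) A" and B: "bounded_between K (part {m..}) (E n) B"
    and BA: "\<And>x. x \<in> carr (E n) \<Longrightarrow> B (A x) = x" using factors_throughE[OF assms] by blast
  have K: "0 \<le> K" by (rule bounded_betweenD(1)[OF A])
  obtain b where b: "finite b" "independent b" "carr (E n) = span b"
    using finite_dimensional_basis[OF fd] by blast
  have bE: "v \<in> carr (E n)" if "v \<in> b" for v using that b(3) span_base by blast
  obtain C where C: "0 \<le> C" "\<forall>x\<in>carr (E n). \<forall>v\<in>b. \<bar>representation b x v\<bar> \<le> C * nrm (E n) x"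
    using representation_bounded[OF N b] by blast
  define cut where "cut M x j = (if j \<in> {m..<M} then x j else 0)" for M and x :: "nat \<Rightarrow> 'a" and j
  have cut: "bounded_between 1 (part {m..}) (part {m..<M}) (cut M)" for M
    unfolding cut_def by (rule cutoff_bounded)
  have incl: "bounded_between 1 (part {m..<M}) (part {m..}) (\<lambda>x. x)" for M
    by (rule inclusion_bounded) auto
  define G where "G M x = A x - cut M (A x)" for M x
  have G: "bounded_between (K + 1 * (1 * K)) (E n) (part {m..}) (G M)" for M
    unfolding G_def
    by (rule bounded_between_subtract[OF normed_part A
          bounded_between_compose[OF bounded_between_compose[OF A cut] incl]])
  have "(\<lambda>M. nrm X (G M x)) \<longlonglongrightarrow> 0" if x: "x \<in> carr (E n)" for x
  proof -
    have Ax: "A x \<in> carr (part {m..})" using bounded_betweenD(2)[OF A x] .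
    have "nrm (E j) (G M x j) = (if j < M then 0 else nrm (E j) (A x j))" for M j
      using Ax by (auto simp: G_def cut_def)
    then show ?thesis
      using tail[of "\<lambda>j. nrm (E j) (A x j)"] Ax by (simp add: nrm_X carr_X)
  qed
  \<comment> \<open>This quantity will bound the norm of \<open>x - B (cut M (A x))\<close> relative
    to that of x: \<open>C\<close> controls the basis coefficients of x, and \<open>K\<close> the
    operator \<open>B\<close>.\<close>
  then have "(\<lambda>M. K * C * (\<Sum>v\<in>b. nrm X (G M v))) \<longlonglongrightarrow> K * C * (\<Sum>v\<in>b. 0)"
    using bE by (intro tendsto_intros) auto
  then have "eventually (\<lambda>M. K * C * (\<Sum>v\<in>b. nrm X (G M v)) < 1 / 2) sequentially"
    by (rule order_tendstoD) simp
  then have "eventually (\<lambda>M. K * C * (\<Sum>v\<in>b. nrm X (G M v)) < 1 / 2 \<and> m < M) sequentially"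
    using eventually_gt_at_top[of m] by (rule eventually_conj)
  then obtain M where M: "K * C * (\<Sum>v\<in>b. nrm X (G M v)) < 1 / 2" "m < M"
    unfolding eventually_sequentially by blast
  have cA: "bounded_between (1 * K) (E n) (part {m..<M}) (\<lambda>x. cut M (A x))"
    by (rule bounded_between_compose[OF A cut])
  have U: "bounded_between (K * (1 * (1 * K))) (E n) (E n) (\<lambda>x. B (cut M (A x)))"
    by (rule bounded_between_compose[OF bounded_between_compose[OF cA incl] B])
  have near: "nrm (E n) (x - B (cut M (A x))) \<le> nrm (E n) x / 2" if x: "x \<in> carr (E n)" for x
  proof -
    have Gm: "G M v \<in> carr (part {m..})" if "v \<in> carr (E n)" for v by (rule bounded_betweenD(2)[OF G that])
    have nx: "0 \<le> nrm (E n) x" by (rule normed.nrm_nonneg[OF N x])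
    have "x - B (cut M (A x)) = B (G M x)"
      unfolding G_def
      using bounded_between_diff[OF normed_part B, of "A x" "cut M (A x)"] BA[OF x]
        bounded_betweenD(2)[OF A x] bounded_betweenD(2)[OF incl bounded_betweenD(2)[OF cA x]] by simp
    then have KG: "nrm (E n) (x - B (cut M (A x))) \<le> K * nrm X (G M x)"
      using bounded_betweenD(5)[OF B Gm[OF x]] by simp
    have "nrm X (G M x) \<le> (\<Sum>v\<in>b. nrm X (G M (representation b x v *\<^sub>R v)))"
    proof -
      have "x = (\<Sum>v\<in>b. representation b x v *\<^sub>R v)"
        using real_vector.sum_representation_eq[OF b(2) _ b(1) subset_refl, of x] x b(3) by simp
      then have "G M x = (\<Sum>v\<in>b. G M (representation b x v *\<^sub>R v))"
        using bounded_between_sum[OF N G, of b "\<lambda>v. representation b x v *\<^sub>R v"] bE normed.carr_scale[OF N]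
        by simp
      then show ?thesis
        using nrm_sum_le[OF normed_part[of "{m..}"], of b "\<lambda>v. G M (representation b x v *\<^sub>R v)"]
          Gm[OF normed.carr_scale[OF N bE]] by simp
    qed
    also have "\<dots> \<le> (\<Sum>v\<in>b. (C * nrm (E n) x) * nrm X (G M v))"
    proof (rule sum_mono)
      fix v assume v: "v \<in> b"
      have "nrm X (G M (representation b x v *\<^sub>R v)) = \<bar>representation b x v\<bar> * nrm X (G M v)"
        using bounded_betweenD(4)[OF G bE[OF v]] scale_X Gm[OF bE[OF v]] by simp
      also have "\<dots> \<le> (C * nrm (E n) x) * nrm X (G M v)"
        using C(2) x v Gm[OF bE[OF v]] XN.nrm_nonneg by (intro mult_right_mono) auto
      finally show "nrm X (G M (representation b x v *\<^sub>R v)) \<le> (C * nrm (E n) x) * nrm X (G M v)" .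
    qed
    finally have "nrm X (G M x) \<le> C * nrm (E n) x * (\<Sum>v\<in>b. nrm X (G M v))"
      by (simp add: sum_distrib_left)
    from order_trans[OF KG mult_left_mono[OF this K]]
    have "nrm (E n) (x - B (cut M (A x))) \<le> (K * C * (\<Sum>v\<in>b. nrm X (G M v))) * nrm (E n) x"
      by (simp add: mult_ac)
    also have "\<dots> \<le> 1 / 2 * nrm (E n) x" using M(1) nx by (intro mult_right_mono) auto
    finally show ?thesis by simp
  qed
  obtain W where W: "bounded_between 2 (E n) (E n) W" "\<And>x. x \<in> carr (E n) \<Longrightarrow> W (B (cut M (A x))) = x"
    using near_identity_left_inverse[OF N fd U near] by blast
  have "factors_through (2 * K) (E n) (part {m..<M})"
  proof (rule factors_throughI)
    show "bounded_between (2 * K) (E n) (part {m..<M}) (\<lambda>x. cut M (A x))"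
      by (rule bounded_between_mono[OF N cA]) (use K in simp)
    show "bounded_between (2 * K) (part {m..<M}) (E n) (\<lambda>x. W (B x))"
      using bounded_between_compose[OF bounded_between_compose[OF incl B] W(1)] by simp
  qed (rule W(2))
  then show thesis using that M(2) by blast
qed

text \<open>Consecutive intervals are chosen so that the k-th carries the summand
  \<open>E (snd (prod_decode k))\<close>. Since the tails may start anywhere at the same constant,
  each interval can begin where the previous one ends, and the blockwise operators add up.\<close>

lemma copies_factor_if_uniform:
  assumes K: "\<And>n m. factors_through K (E n) (part {m..})"
  shows "factors_through (2 * K) (copies X) X"
proof -
  define F where "F n m M \<longleftrightarrow> m < M \<and> factors_through (2 * K) (E n) (part {m..<M})" for n m M
  have "\<exists>M. F n m M" for n m
    unfolding F_def
    by (rule factors_tail_imp_interval[OF K[of n m]]) (intro exI conjI; assumption)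
  then obtain f where "\<And>n m. F n m (f n m)" by metis
  then have f: "\<And>n m. f n m > m" "\<And>n m. factors_through (2 * K) (E n) (part {m..<f n m})"
    by (simp_all add: F_def)
  define m where "m = rec_nat 0 (\<lambda>k m. f (snd (prod_decode k)) m)"
  have m: "m 0 = 0" "m (Suc k) = f (snd (prod_decode k)) (m k)" for k by (simp_all add: m_def)
  have "strict_mono m" by (simp add: strict_mono_Suc_iff m f(1))
  then obtain g where g: "\<And>j k. g j = k \<longleftrightarrow> m k \<le> j \<and> j < m (Suc k)"
    using block_index[of m] m(1) by blast
  have "factors_through (2 * K) (E (snd (prod_decode k))) (part {j. g j = k})" for k
  proof -
    have "{j. g j = k} = {m k..<m (Suc k)}" by (auto simp: g)
    then show ?thesis using f(2)[of "snd (prod_decode k)" "m k"] by (simp add: m)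
  qed
  then have "factors_through (2 * K) (zsum Z (\<lambda>k. E (snd (prod_decode k)))) X"
    by (intro diagonal_factors N)
  from factors_through_trans[OF copies_factors this] show ?thesis by simp
qed

end

section \<open>Reducing almost equality of sets of blocks to isomorphism\<close>

context fd_z_sum
begin

text \<open>Shifting moves the unit vector at 0 to place n without increasing the norm, so the
  constant is the same for all n. The added 1 covers the coordinate map, whose bound is 1.\<close>

lemma summand_factors:
  assumes "n \<in> I"
  shows "factors_through (nrm Z (\<lambda>k. if k = 0 then 1 else 0) + 1) (E n) (part I)"
proof -
  let ?u = "\<lambda>n k. if k = n then 1 else 0 :: real"
  have "?u n = (\<lambda>i. if i < n then 0 else ?u 0 (i - n))" by auto
  then have "nrm Z (?u n) \<le> nrm Z (?u 0)"
    using bounded_betweenD(5)[OF right_shift_Z unit, of n 0 1] by simp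
  moreover have "0 \<le> nrm Z (?u n)" for n by (rule nrm_Z_nonneg[OF unit])
  ultimately have u: "nrm Z (?u n) \<le> nrm Z (?u 0) + 1" "1 \<le> nrm Z (?u 0) + 1"
    by (simp_all add: add_increasing2)
  show ?thesis
    by (rule factors_throughI[OF bounded_between_mono[OF N single_bounded[OF assms] u(1)]
          bounded_between_mono[OF normed_part coordinate_bounded u(2)]]) simp
qed

text \<open>The indices up to n are absorbed by a tail beyond them. The resulting constant depends
  on n but not on m, so uniformity can fail only along infinitely many summands.\<close>

lemma summand_factors_through_tails: "\<exists>K. \<forall>m. factors_through K (E n) (part {m..})"
proof -
  obtain C where C: "\<And>\<beta>. infinite \<beta> \<Longrightarrow> {..<Suc n} \<inter> \<beta> = {} \<Longrightarrow> part_iso C ({..<Suc n} \<union> \<beta>) \<beta>"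
    using absorb_finite[of "{..<Suc n}"] by blast
  let ?K = "nrm Z (\<lambda>k. if k = 0 then 1 else 0) + 1"
  have "factors_through (1 * (C * ?K)) (E n) (part {m..})" for m
  proof -
    let ?\<beta> = "{max m (Suc n)..}"
    have "factors_through C (part ({..<Suc n} \<union> ?\<beta>)) (part ?\<beta>)"
      by (intro part_iso_imp_factors C) (auto simp: infinite_Ici)
    then show ?thesis
      by (intro factors_through_trans[OF _ part_mono_factors[of ?\<beta>]]
          factors_through_trans[OF summand_factors[of n "{..<Suc n} \<union> ?\<beta>"]]) auto
  qed
  then show ?thesis by blast
qed

text \<open>The summands before \<open>N0\<close> have a common constant, included in
  \<open>K'\<close>; a failure at \<open>K'\<close> must therefore occur at \<open>N0\<close> or
  later.\<close>

lemma not_uniform_summand: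
  assumes not: "\<not> (\<exists>K. \<forall>n m. factors_through K (E n) (part {m..}))"
  obtains n m where "N0 \<le> n" "n < m" "\<not> factors_through K (E n) (part {m..})"
proof -
  have "\<exists>L. \<forall>n. \<forall>m. factors_through (L n) (E n) (part {m..})"
    using summand_factors_through_tails by (intro choice allI)
  then obtain L where L: "\<And>n m. factors_through (L n) (E n) (part {m..})" by blast
  define K' where "K' = \<bar>K\<bar> + (\<Sum>n<N0. \<bar>L n\<bar>)"
  have "0 \<le> (\<Sum>n<N0. \<bar>L n\<bar>)" by (rule sum_nonneg) simp
  then have K': "K \<le> K'" unfolding K'_def by linarith
  obtain n m where nm: "\<not> factors_through K' (E n) (part {m..})" using not by blast
  have "N0 \<le> n"
  proof (rule ccontr)
    assume "\<not> N0 \<le> n"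
    then have "\<bar>L n\<bar> \<le> (\<Sum>n<N0. \<bar>L n\<bar>)" by (intro member_le_sum) auto
    then have "L n \<le> K'" unfolding K'_def by linarith
    then show False using nm factors_through_mono[OF N normed_part L] by blast
  qed
  \<comment> \<open>A later tail is contained in an earlier one and is harder to factor through, so
    it may be taken to begin after n.\<close>
  moreover have "\<not> factors_through K (E n) (part {max m (Suc n)..})"
  proof
    assume "factors_through K (E n) (part {max m (Suc n)..})"
    from factors_through_trans[OF this part_mono_factors, of "{m..}"]
    have "factors_through K (E n) (part {m..})" by simp
    then show False using nm factors_through_mono[OF N normed_part _ K'] by blast
  qed
  ultimately show thesis using that[of n "max m (Suc n)"] by simp
qed

text \<open>By absorption, the finitely many summands before a block cannot help to accommodate the
  distinguished summand of the block, if this is chosen with a large enough constant.\<close>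

lemma next_block:
  assumes not: "\<not> (\<exists>K. \<forall>n m. factors_through K (E n) (part {m..}))"
  shows "\<exists>M>N0. \<exists>c. N0 \<le> c \<and> c < M \<and> \<not> factors_through K (E c) (part (- {N0..<M}))"
proof -
  obtain C where C: "\<And>\<beta>. infinite \<beta> \<Longrightarrow> {..<N0} \<inter> \<beta> = {} \<Longrightarrow> part_iso C ({..<N0} \<union> \<beta>) \<beta>"
    using absorb_finite[of "{..<N0}"] by blast
  \<comment> \<open>Passing from the complement of the block to the tail costs the factor
    \<open>C\<close>, so the failure is requested at \<open>C * K\<close> to obtain failure at
    \<open>K\<close> off the block.\<close>
  obtain n M where nM: "N0 \<le> n" "n < M" "\<not> factors_through (C * K) (E n) (part {M..})"
    by (rule not_uniform_summand[OF not])
  have "part_iso C ({..<N0} \<union> {M..}) {M..}" using nM by (intro C) (auto simp: infinite_Ici)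
  moreover have "{..<N0} \<union> {M..} = - {N0..<M}" using nM by auto
  ultimately have "part_iso C (- {N0..<M}) {M..}" by (simp only:)
  then have "factors_through C (part (- {N0..<M})) (part {M..})" by (rule part_iso_imp_factors)
  then have "\<not> factors_through K (E n) (part (- {N0..<M}))"
    using factors_through_trans nM(3) by blast
  then show ?thesis using nM by (intro exI[of _ M] conjI exI[of _ n]) auto
qed

text \<open>If block j belongs to \<open>I\<close> but not to \<open>J\<close>, an isomorphism makes
  the summand \<open>c j\<close> factor through the sum over the other blocks, with a constant
  independent of j. As \<open>c j\<close> resists the constant j, this bounds j.\<close>

lemma separated_blocks:
  assumes not: "\<not> (\<exists>K. \<forall>n m. factors_through K (E n) (part {m..}))"
  obtains g :: "nat \<Rightarrow> nat" where "\<And>k. finite {n. g n = k}" "surj g"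
    "\<And>I J. part {n. g n \<in> I} \<sim>\<^sub>B part {n. g n \<in> J} \<Longrightarrow> finite (I - J)"
proof -
  define F where "F N0 j M c \<longleftrightarrow> N0 < M \<and> N0 \<le> c \<and> c < M \<and>
    \<not> factors_through (real j) (E c) (part (- {N0..<M}))" for N0 j M c
  have "\<exists>M c. F N0 j M c" for N0 j
    using next_block[OF not, of N0 "real j"] unfolding F_def by blast
  then obtain f d where fd: "\<And>N0 j. F N0 j (f N0 j) (d N0 j)" by metis
  define m where "m = rec_nat 0 (\<lambda>j m. f m j)"
  have m: "m 0 = 0" "m (Suc j) = f (m j) j" for j by (simp_all add: m_def)
  define c where "c j = d (m j) j" for j
  have F: "F (m j) j (m (Suc j)) (c j)" for j using fd[of "m j" j] by (simp add: m c_def)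
  have "strict_mono m" using F by (simp add: strict_mono_Suc_iff F_def)
  then obtain g where g: "\<And>j k. g j = k \<longleftrightarrow> m k \<le> j \<and> j < m (Suc k)"
    using block_index[of m] m(1) by blast
  have gc: "g (c j) = j" for j using F[of j] by (simp add: g F_def)
  show thesis
  proof (rule that[of g])
    have "{n. g n = k} = {m k..<m (Suc k)}" for k by (auto simp: g)
    then show "finite {n. g n = k}" for k by simp
    show "surj g" using gc by (rule surjI)
    fix I J
    assume iso: "part {n. g n \<in> I} \<sim>\<^sub>B part {n. g n \<in> J}"
    obtain K where K: "factors_through K (part {n. g n \<in> I}) (part {n. g n \<in> J})"
      using nisomorphic_imp_factors_through[OF normed_part normed_part iso] by blast
    \<comment> \<open>The three factors belong to the summand in its partial sum, the isomorphism,
      and the inclusion in the complement of block j.\<close>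
    let ?L = "1 * (K * (nrm Z (\<lambda>k. if k = 0 then 1 else 0) + 1))"
    have "\<not> ?L \<le> real j" if j: "j \<in> I - J" for j
    proof
      assume "?L \<le> real j"
      have "factors_through ?L (E (c j)) (part (- {m j..<m (Suc j)}))"
      proof (rule factors_through_trans[OF factors_through_trans[OF summand_factors K] part_mono_factors])
        show "c j \<in> {n. g n \<in> I}" using j gc by simp
        have "g n = j" if "n \<in> {m j..<m (Suc j)}" for n using that by (simp add: g)
        then show "{n. g n \<in> J} \<subseteq> - {m j..<m (Suc j)}" using j by blast
      qed
      then have "factors_through (real j) (E (c j)) (part (- {m j..<m (Suc j)}))"
        using \<open>?L \<le> real j\<close> by (rule factors_through_mono[OF N normed_part])
      then show False using F[of j] by (simp add: F_def)
    qed
    then have "I - J \<subseteq> {j. real j \<le> ?L}" by (auto simp: not_le less_imp_le)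
    moreover have "finite {j. real j \<le> ?L}"
    proof -
      obtain b where "?L < real b" using reals_Archimedean2 by blast
      then have "{j. real j \<le> ?L} \<subseteq> {..<b}" by (auto simp del: mult_1_left)
      then show ?thesis by (rule finite_subset) simp
    qed
    ultimately show "finite (I - J)" by (rule finite_subset)
  qed
qed

text \<open>Both sums are compared with the one over \<open>I \<inter> J\<close>. The differences
  amount to finitely many summands because blocks are finite, and surjectivity of \<open>g\<close>
  makes the absorbing set of summands infinite.\<close>

lemma almost_equal_imp_nisomorphic:
  assumes g: "\<And>k. finite {n. g n = k}" "surj g"
    and fin: "finite (I - J)" "finite (J - I)" and inf: "infinite I"
  shows "part {n. g n \<in> I} \<sim>\<^sub>B part {n. g n \<in> J}"
proof -
  have *: "part {n. g n \<in> A} \<sim>\<^sub>B part {n. g n \<in> B}"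
    if "finite (A - B)" "infinite B" "B \<subseteq> A" for A B
  proof -
    have "{n. g n \<in> A - B} = (\<Union>k\<in>A - B. {n. g n = k})" by auto
    then have "finite {n. g n \<in> A - B}" using that(1) g(1) by simp
    moreover have "infinite {n. g n \<in> B}"
    proof
      assume "finite {n. g n \<in> B}"
      then have "finite (g ` {n. g n \<in> B})" by (rule finite_imageI)
      moreover have "g ` {n. g n \<in> B} = B" using g(2) by (force simp: surj_def)
      ultimately show False using that(2) by simp
    qed
    moreover have "{n. g n \<in> A - B} \<union> {n. g n \<in> B} = {n. g n \<in> A}" using that(3) by auto
    ultimately show ?thesis
      using absorb_finite[of "{n. g n \<in> A - B}"] part_iso_imp_nisomorphic by fastforce
  qed
  have "I = (I - J) \<union> (I \<inter> J)" by blast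
  then have "infinite (I \<inter> J)" using inf fin(1) by (metis finite_Un)
  moreover have "I - I \<inter> J = I - J" "J - I \<inter> J = J - I" by auto
  ultimately have I: "part {n. g n \<in> I} \<sim>\<^sub>B part {n. g n \<in> I \<inter> J}"
    and J: "part {n. g n \<in> J} \<sim>\<^sub>B part {n. g n \<in> I \<inter> J}"
    using fin by (intro *[of I "I \<inter> J"] *[of J "I \<inter> J"]; simp)+
  show ?thesis
    by (rule nisomorphic_trans[OF normed_part normed_part normed_part I
          nisomorphic_sym[OF normed_part normed_part J]])
qed

end

section \<open>Perfect decompositions and ergodic spaces\<close>

lemma open_fun_finite_support:
  fixes T :: "('i \<Rightarrow> 'b::topological_space) set"
  assumes "open T" "x \<in> T"
  obtains A where "finite A" "\<And>y. (\<And>i. i \<in> A \<Longrightarrow> y i = x i) \<Longrightarrow> y \<in> T"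
proof -
  obtain U where U: "x \<in> (\<Pi>\<^sub>E i\<in>UNIV. U i)" "finite {i. U i \<noteq> UNIV}" "(\<Pi>\<^sub>E i\<in>UNIV. U i) \<subseteq> T"
    using product_topology_open_contains_basis[of "\<lambda>i. euclidean" UNIV T x] assms
    by (auto simp: open_fun_def)
  have "y \<in> T" if "\<And>i. i \<in> {i. U i \<noteq> UNIV} \<Longrightarrow> y i = x i" for y
  proof -
    have "y i \<in> U i" for i using that[of i] U(1) by (cases "U i = UNIV") (auto simp: PiE_iff)
    then show ?thesis using U(3) by auto
  qed
  then show thesis using that U(2) by blast
qed

lemma infinite_column: "infinite {k. fst (prod_decode k) = i}"
proof -
  have "inj (\<lambda>n. prod_encode (i, n))" by (auto intro: injI)
  then have "infinite (range (\<lambda>n. prod_encode (i, n)))" by (simp add: range_inj_infinite)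
  moreover have "range (\<lambda>n. prod_encode (i, n)) \<subseteq> {k. fst (prod_decode k) = i}" by auto
  ultimately show ?thesis using infinite_super by blast
qed

text \<open>Column \<open>0\<close> keeps these sets from being almost equal to the complement of one another.\<close>

definition column_set :: "(nat \<Rightarrow> bool) \<Rightarrow> nat set" where
  "column_set \<alpha> = {k. case fst (prod_decode k) of 0 \<Rightarrow> True | Suc i \<Rightarrow> \<alpha> i}"

text \<open>A bit in which \<alpha> and \<beta> differ is repeated along a whole column, which then
  lies in one set and misses the other.\<close>

lemma column_set_infinite_difference:
  assumes "\<alpha> \<noteq> \<beta>"
  shows "infinite (column_set \<alpha> - column_set \<beta>) \<or> infinite (column_set \<beta> - column_set \<alpha>)"
proof -
  obtain i where i: "\<alpha> i \<noteq> \<beta> i" using assms by blast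
  show ?thesis
  proof (cases "\<alpha> i")
    case True
    then have "{k. fst (prod_decode k) = Suc i} \<subseteq> column_set \<alpha> - column_set \<beta>"
      using i by (auto simp: column_set_def)
    then show ?thesis using infinite_column infinite_super by blast
  next
    case False
    then have "{k. fst (prod_decode k) = Suc i} \<subseteq> column_set \<beta> - column_set \<alpha>"
      using i by (auto simp: column_set_def)
    then show ?thesis using infinite_column infinite_super by blast
  qed
qed

lemma column_set_infinite_inter: "infinite (column_set \<alpha> \<inter> column_set \<beta>)"
proof -
  have "{k. fst (prod_decode k) = 0} \<subseteq> column_set \<alpha> \<inter> column_set \<beta>" by (auto simp: column_set_def)
  then show ?thesis using infinite_column infinite_super by blast
qed

text \<open>The range is cut out by equations between coordinates (true on column 0, constant on
  each column), hence closed. No point is isolated: a basic neighbourhood restricts finitely many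
  coordinates, and the bit of a column beyond all of them can be flipped.\<close>

lemma perfect_set_column_sets:
  fixes g :: "nat \<Rightarrow> nat"
  assumes g: "surj g"
  shows "perfect_set (range (\<lambda>\<alpha> n. g n \<in> column_set \<alpha>))"
proof -
  let ?\<Phi> = "\<lambda>\<alpha> n. g n \<in> column_set \<alpha>" and ?i = "\<lambda>n. fst (prod_decode (g n))"
  have eq: "range ?\<Phi> = (\<Inter>n\<in>{n. ?i n = 0}. {\<gamma>. \<gamma> n = True}) \<inter>
      (\<Inter>z\<in>{(n, n'). ?i n = ?i n'}. {\<gamma>. \<gamma> (fst z) = \<gamma> (snd z)})" (is "_ = ?R")
  proof
    show "range ?\<Phi> \<subseteq> ?R"
    proof
      fix \<gamma> assume "\<gamma> \<in> range ?\<Phi>"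
      then obtain \<alpha> where \<gamma>: "\<gamma> = ?\<Phi> \<alpha>" by blast
      show "\<gamma> \<in> ?R" by (simp add: \<gamma> column_set_def split: prod.split)
    qed
    show "?R \<subseteq> range ?\<Phi>"
    proof
      fix \<gamma> assume \<gamma>: "\<gamma> \<in> ?R"
      have \<gamma>0: "\<gamma> n" if "?i n = 0" for n using IntD1[OF \<gamma>] that by simp
      have \<gamma>eq: "\<gamma> n = \<gamma> n'" if "?i n = ?i n'" for n n'
        using INT_D[OF IntD2[OF \<gamma>], of "(n, n')"] that by simp
      \<comment> \<open>\<open>s i\<close> is a representative index in column \<open>Suc i\<close>,
        where the i-th bit of the preimage is read off.\<close>
      define s where "s i = inv g (prod_encode (Suc i, 0))" for i
      have s: "?i (s i) = Suc i" for i using surj_f_inv_f[OF g] by (simp add: s_def)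
      have "\<gamma> n = ?\<Phi> (\<lambda>i. \<gamma> (s i)) n" for n
      proof (cases "?i n")
        case 0
        then show ?thesis using \<gamma>0 by (simp add: column_set_def)
      next
        case (Suc i)
        then have "\<gamma> n = \<gamma> (s i)" by (intro \<gamma>eq) (simp add: s)
        then show ?thesis using Suc by (simp add: column_set_def)
      qed
      then have *: "\<gamma> = ?\<Phi> (\<lambda>i. \<gamma> (s i))" by (rule ext)
      show "\<gamma> \<in> range ?\<Phi>"
        by (rule image_eqI[where x = "\<lambda>i. \<gamma> (s i)"], rule *, rule UNIV_I)
    qed
  qed
  have "closed {\<gamma> :: nat \<Rightarrow> bool. \<gamma> n = True}" "closed {\<gamma> :: nat \<Rightarrow> bool. \<gamma> n = \<gamma> n'}" for n n'
    by (intro closed_Collect_eq continuous_on_const continuous_on_product_coordinates)+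
  then have "closed (range ?\<Phi>)" unfolding eq by (intro closed_Int closed_INT ballI) auto
  moreover have "x islimpt range ?\<Phi>" if xr: "x \<in> range ?\<Phi>" for x
  proof (rule islimptI)
    obtain \<alpha> where x: "x = ?\<Phi> \<alpha>" using xr by blast
    fix T assume T: "x \<in> T" "open T"
    obtain A where A: "finite A" "\<And>y. (\<And>i. i \<in> A \<Longrightarrow> y i = x i) \<Longrightarrow> y \<in> T"
      using open_fun_finite_support[OF T(2,1)] by blast
    obtain b where b: "\<And>n. n \<in> A \<Longrightarrow> ?i n < b"
      using A(1) finite_nat_set_iff_bounded[of "?i ` A"] by auto
    define y where "y = ?\<Phi> (\<alpha>(b := \<not> \<alpha> b))"
    have "y n = x n" if "n \<in> A" for n
      using b[OF that] by (auto simp: x y_def column_set_def split: nat.split)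
    then have "y \<in> T" by (rule A(2))
    moreover have "y \<noteq> x"
    proof
      assume "y = x"
      then have "y (inv g (prod_encode (Suc b, 0))) = x (inv g (prod_encode (Suc b, 0)))" by simp
      then show False by (simp add: x y_def column_set_def surj_f_inv_f[OF g])
    qed
    ultimately show "\<exists>y\<in>range ?\<Phi>. y \<in> T \<and> y \<noteq> x" by (auto simp: y_def)
  qed
  ultimately show ?thesis by (simp add: perfect_set_def)
qed

section \<open>From separated blocks to perfectness and ergodicity\<close>

context fd_z_sum
begin

lemma closed_subspace_part: "closed_subspace X (carr (part I))"
proof -
  have "closedin (ntop X) {x \<in> carr X. \<forall>n. n \<notin> I \<longrightarrow> x n = 0}"
    unfolding XN.metric_closedin_iff_sequentially_closed
  proof (intro conjI allI impI)
    fix \<sigma> l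
    assume *: "range \<sigma> \<subseteq> {x \<in> carr X. \<forall>n. n \<notin> I \<longrightarrow> x n = 0} \<and> limitin (ntop X) \<sigma> l sequentially"
    then have "\<sigma> k \<in> {x \<in> carr X. \<forall>n. n \<notin> I \<longrightarrow> x n = 0}" for k by blast
    then have s: "\<And>k. \<sigma> k \<in> carr X" "\<And>k n. n \<notin> I \<Longrightarrow> \<sigma> k n = 0" by simp_all
    have l: "limitin (ntop X) \<sigma> l sequentially" using * by (rule conjunct2)
    have "l \<in> carr X" using l XN.limitin_iff[OF s(1)] by auto
    moreover have "l n = 0" if "n \<notin> I" for n
      by (rule limit_coord[OF l s(1), of 0]) (rule s(2)[OF that])
    ultimately show "l \<in> {x \<in> carr X. \<forall>n. n \<notin> I \<longrightarrow> x n = 0}" by simp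
  qed (rule Collect_restrict)
  then show ?thesis using part_subspace by (simp add: closed_subspace_def)
qed

text \<open>Tails of a vector tend to 0 in norm, so open sets can be tested on vectors with finitely
  many nonzero coordinates; this gives the measurability of the reduction of E0.\<close>

lemma truncation_in_open:
  assumes U: "openin (ntop X) U" and x: "x \<in> U"
  obtains k where "(\<lambda>n. if n < k then x n else 0) \<in> U"
proof -
  obtain r where r: "r > 0" "XN.mball x r \<subseteq> U" and xX: "x \<in> carr X"
    using U x unfolding XN.openin_mtopology by blast
  let ?t = "\<lambda>k n. if n < k then x n else 0"
  have t: "?t k \<in> carr X" for k using cutoff_mem(1)[OF xX, of "{..<k}"] by simp
  have "nrm (E n) ((x - ?t k) n) = (if n < k then 0 else nrm (E n) (x n))" for n k by auto
  then have "(\<lambda>k. nrm X (x - ?t k)) \<longlonglongrightarrow> 0"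
    using tail[of "\<lambda>n. nrm (E n) (x n)"] xX by (simp add: nrm_X carr_X)
  then have "eventually (\<lambda>k. nrm X (x - ?t k) < r) sequentially"
    by (rule order_tendstoD) (rule r(1))
  then obtain k where "nrm X (x - ?t k) < r" unfolding eventually_sequentially by blast
  then have "?t k \<in> XN.mball x r" using xX t[of k] by (simp add: ndist_def)
  then show thesis using that r(2) by blast
qed

theorem perfect_if_not_uniform:
  assumes not: "\<not> (\<exists>K. \<forall>n m. factors_through K (E n) (part {m..}))"
  shows "perfect_decomposition X (summand X)"
proof -
  obtain g :: "nat \<Rightarrow> nat" where g: "\<And>k. finite {n. g n = k}" "surj g"
    "\<And>I J. part {n. g n \<in> I} \<sim>\<^sub>B part {n. g n \<in> J} \<Longrightarrow> finite (I - J)"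
    using separated_blocks[OF not] by blast
  have fin: "finite (I - J) \<and> finite (J - I)" if "part {n. g n \<in> I} \<sim>\<^sub>B part {n. g n \<in> J}" for I J
    using g(3) nisomorphic_sym[OF normed_part normed_part that] that by blast
  show ?thesis
    unfolding perfect_decomposition_def partial_sum_eq_part
  proof (intro exI[of _ "range (\<lambda>\<alpha> n. g n \<in> column_set \<alpha>)"] conjI perfect_set_column_sets[OF g(2)] ballI impI)
    fix \<gamma> \<delta>
    assume "\<gamma> \<in> range (\<lambda>\<alpha> n. g n \<in> column_set \<alpha>)" "\<delta> \<in> range (\<lambda>\<alpha> n. g n \<in> column_set \<alpha>)" "\<gamma> \<noteq> \<delta>"
    then obtain \<alpha> \<beta> where \<gamma>: "\<gamma> = (\<lambda>n. g n \<in> column_set \<alpha>)" and \<delta>: "\<delta> = (\<lambda>n. g n \<in> column_set \<beta>)"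
      and ne: "\<alpha> \<noteq> \<beta>" by blast
    note d = column_set_infinite_difference[OF ne]
    have compl: "{n. g n \<notin> column_set \<alpha>} = {n. g n \<in> - column_set \<alpha>}" for \<alpha> by simp
    show "\<not> part {n. \<gamma> n} \<sim>\<^sub>B part {n. \<delta> n}"
      using fin d unfolding \<gamma> \<delta> by blast
    show "\<not> part {n. \<not> \<gamma> n} \<sim>\<^sub>B part {n. \<delta> n}"
    proof
      assume "part {n. \<not> \<gamma> n} \<sim>\<^sub>B part {n. \<delta> n}"
      \<comment> \<open>This difference is the intersection of the two column sets, which contains
        the infinite column 0.\<close>
      then have "finite (column_set \<beta> - - column_set \<alpha>)"
        unfolding \<gamma> \<delta> compl using fin by blast
      then show False using column_set_infinite_inter[of \<beta> \<alpha>] by (simp add: Diff_Compl)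
    qed
    show "\<not> part {n. \<not> \<gamma> n} \<sim>\<^sub>B part {n. \<not> \<delta> n}"
    proof
      assume "part {n. \<not> \<gamma> n} \<sim>\<^sub>B part {n. \<not> \<delta> n}"
      then have "finite (- column_set \<alpha> - - column_set \<beta>) \<and> finite (- column_set \<beta> - - column_set \<alpha>)"
        unfolding \<gamma> \<delta> compl by (rule fin)
      \<comment> \<open>Complementation only exchanges the two differences, so the argument for the
        sets themselves applies.\<close>
      moreover have "- column_set \<alpha> - - column_set \<beta> = column_set \<beta> - column_set \<alpha>"
        "- column_set \<beta> - - column_set \<alpha> = column_set \<alpha> - column_set \<beta>" by auto
      ultimately show False using d by simp
    qed
  qed simp
qed

theorem ergodic_if_not_uniform:
  assumes not: "\<not> (\<exists>K. \<forall>n m. factors_through K (E n) (part {m..}))"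
  shows "ergodic X"
proof -
  obtain g :: "nat \<Rightarrow> nat" where g: "\<And>k. finite {n. g n = k}" "surj g"
    "\<And>I J. part {n. g n \<in> I} \<sim>\<^sub>B part {n. g n \<in> J} \<Longrightarrow> finite (I - J)"
    using separated_blocks[OF not] by blast
  \<comment> \<open>Bits occupy the even blocks. The odd blocks belong to every set, since
    absorption needs infinite sets and an eventually false \<alpha> would otherwise give a finite
    one.\<close>
  define A where "A \<alpha> = {k. odd k \<or> \<alpha> (k div 2)}" for \<alpha> :: "nat \<Rightarrow> bool"
  have inf: "infinite (A \<alpha>)" for \<alpha>
  proof -
    have "infinite (range (\<lambda>k::nat. 2 * k + 1))" by (rule range_inj_infinite) (auto intro: injI)
    moreover have "range (\<lambda>k. 2 * k + 1) \<subseteq> A \<alpha>" by (auto simp: A_def)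
    ultimately show ?thesis using infinite_super by blast
  qed
  have E0_iff: "E0 \<alpha> \<beta> \<longleftrightarrow> finite (A \<alpha> - A \<beta>) \<and> finite (A \<beta> - A \<alpha>)" for \<alpha> \<beta>
  proof
    assume "E0 \<alpha> \<beta>"
    then obtain m where m: "\<And>n. n \<ge> m \<Longrightarrow> \<alpha> n = \<beta> n" by (auto simp: E0_def)
    have "k < 2 * m" if "k \<in> (A \<alpha> - A \<beta>) \<union> (A \<beta> - A \<alpha>)" for k
    proof (rule ccontr)
      assume "\<not> k < 2 * m"
      then have "\<alpha> (k div 2) = \<beta> (k div 2)" by (intro m) simp
      then show False using that by (auto simp: A_def)
    qed
    then have "(A \<alpha> - A \<beta>) \<union> (A \<beta> - A \<alpha>) \<subseteq> {..<2 * m}" by blast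
    then have "finite ((A \<alpha> - A \<beta>) \<union> (A \<beta> - A \<alpha>))" by (rule finite_subset) simp
    then show "finite (A \<alpha> - A \<beta>) \<and> finite (A \<beta> - A \<alpha>)" by simp
  next
    assume "finite (A \<alpha> - A \<beta>) \<and> finite (A \<beta> - A \<alpha>)"
    then have "finite ((A \<alpha> - A \<beta>) \<union> (A \<beta> - A \<alpha>))" by simp
    then obtain m where m: "\<forall>k\<in>(A \<alpha> - A \<beta>) \<union> (A \<beta> - A \<alpha>). k < m"
      unfolding finite_nat_set_iff_bounded by blast
    have "\<alpha> n = \<beta> n" if "n \<ge> m" for n
    proof (rule ccontr)
      assume "\<alpha> n \<noteq> \<beta> n"
      then have "2 * n \<in> (A \<alpha> - A \<beta>) \<union> (A \<beta> - A \<alpha>)" by (auto simp: A_def)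
      then have "2 * n < m" using m by blast
      then show False using that by simp
    qed
    then show "E0 \<alpha> \<beta>" by (auto simp: E0_def)
  qed
  define f where "f \<alpha> = carr (part {n. g n \<in> A \<alpha>})" for \<alpha>
  have cl: "closed_subspace X (f \<alpha>)" for \<alpha> unfolding f_def by (rule closed_subspace_part)
  have "\<forall>\<alpha> \<beta>. E0 \<alpha> \<beta> \<longleftrightarrow> restrict_to X (f \<alpha>) \<sim>\<^sub>B restrict_to X (f \<beta>)"
  proof (intro allI)
    fix \<alpha> \<beta>
    have part: "restrict_to X (f \<alpha>) = part {n. g n \<in> A \<alpha>}" for \<alpha> by (simp add: f_def)
    show "E0 \<alpha> \<beta> \<longleftrightarrow> restrict_to X (f \<alpha>) \<sim>\<^sub>B restrict_to X (f \<beta>)"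
      unfolding part E0_iff
    proof
      assume "finite (A \<alpha> - A \<beta>) \<and> finite (A \<beta> - A \<alpha>)"
      then show "part {n. g n \<in> A \<alpha>} \<sim>\<^sub>B part {n. g n \<in> A \<beta>}"
        by (intro almost_equal_imp_nisomorphic[OF g(1,2) _ _ inf]) auto
    next
      assume iso: "part {n. g n \<in> A \<alpha>} \<sim>\<^sub>B part {n. g n \<in> A \<beta>}"
      show "finite (A \<alpha> - A \<beta>) \<and> finite (A \<beta> - A \<alpha>)"
        by (intro conjI g(3)[OF iso] g(3)[OF nisomorphic_sym[OF normed_part normed_part iso]])
    qed
  qed
  moreover have "f \<in> borel \<rightarrow>\<^sub>M effros_borel X"
    unfolding effros_borel_def
  proof (rule measurable_measure_of)
    show "f \<in> space borel \<rightarrow> {F. closed_subspace X F}"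
      using cl by blast
    fix S assume "S \<in> {{F. closed_subspace X F \<and> F \<inter> U \<noteq> {}} |U. openin (ntop X) U}"
    then obtain U where U: "openin (ntop X) U" "S = {F. closed_subspace X F \<and> F \<inter> U \<noteq> {}}" by blast
    have "\<exists>T. open T \<and> \<alpha> \<in> T \<and> T \<subseteq> f -` S" if fS: "\<alpha> \<in> f -` S" for \<alpha>
    proof -
      obtain x where x: "x \<in> f \<alpha>" "x \<in> U" using fS U(2) by auto
      obtain k where k: "(\<lambda>n. if n < k then x n else 0) \<in> U" 
        using truncation_in_open[OF U(1) x(2)] by blast
      \<comment> \<open>Only the bits consulted by the first k summands are fixed, so
        \<open>T\<close> is open; the preimage of each generator of the Effros structure is
        therefore open, not merely Borel.\<close>
      define T where "T = {\<beta>. \<forall>n\<in>{..<k}. \<beta> (g n div 2) \<in> {\<alpha> (g n div 2)}}"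
      have "open T" unfolding T_def
        by (intro product_topology_basis') (simp_all add: open_discrete)
      moreover have "\<alpha> \<in> T" by (simp add: T_def)
      moreover have "\<beta> \<in> f -` S" if "\<beta> \<in> T" for \<beta>
      proof -
        have "(\<lambda>n. if n < k then x n else 0) \<in> carr X"
          using cutoff_mem(1)[of x "{..<k}"] x(1) by (simp add: f_def)
        \<comment> \<open>A block outside \<open>A \<beta>\<close> is even with false bit in
          \<beta>; for n < k that bit agrees with the one of \<alpha>, so the block is outside
          \<open>A \<alpha>\<close> too and x vanishes there.\<close>
        moreover have "n < k \<Longrightarrow> g n \<notin> A \<beta> \<Longrightarrow> x n = 0" for n
          using that x(1) by (auto simp: f_def T_def A_def)
        ultimately have "(\<lambda>n. if n < k then x n else 0) \<in> f \<beta>" by (simp add: f_def)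
        then show ?thesis using k U(2) cl by blast
      qed
      ultimately show ?thesis by blast
    qed
    then have "open (f -` S)" by (subst open_subopen) blast
    then show "f -` S \<inter> space borel \<in> sets borel" by simp
  qed auto
  ultimately show ?thesis unfolding ergodic_def by (intro bexI[of _ f])
qed

end

text \<open>The decomposition method is applied to \<open>X\<close> itself and to the competitor
  \<open>Y\<close>: each factors through \<open>X\<close>, and \<open>copies X\<close> factors
  through each, so both are isomorphic to \<open>copies X\<close>.\<close>

theorem corollary2p12:
  fixes Z :: "(nat \<Rightarrow> real) nspace"
    and E :: "nat \<Rightarrow> 'a::real_vector nspace"
    and X :: "(nat \<Rightarrow> 'a) nspace"
  assumes "Z = c0_space \<or> (\<exists>p\<ge>1. Z = lp_space p)"
    and "\<And>n. normed_space (E n)"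
    and "\<And>n. finite_dimensional (carr (E n))"
    and "\<And>n. carr (E n) \<noteq> {0}"
    and "X = zsum Z E"
    and "\<not> perfect_decomposition X (summand X) \<or> \<not> ergodic X"
  shows "X \<sim>\<^sub>B zsum Z (\<lambda>_::nat. X) \<and> schroeder_bernstein TYPE('c::real_vector) X"
proof -
  interpret symmetric_sequence_space Z
    using assms(1) by (auto intro: symmetric_sequence_space_c0 symmetric_sequence_space_lp)
  interpret S: fd_z_sum Z E
    by unfold_locales (rule assms(2), rule assms(3), rule assms(4))
  note NX = S.XN.normed_axioms[folded assms(5)]
  interpret C: z_sum Z "\<lambda>_::nat. X"
    by unfold_locales (rule normed.normed_space[OF NX])
  note NC = C.XN.normed_axioms
  obtain K where "\<And>n m. factors_through K (E n) (S.part {m..})"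
    using S.perfect_if_not_uniform S.ergodic_if_not_uniform assms(5,6) by blast
  then have copies: "factors_through (2 * K) (copies X) X"
    unfolding assms(5) by (rule S.copies_factor_if_uniform)
  have "factors_through 1 X X" by (rule factors_throughI[OF bounded_between_id bounded_between_id]) simp
  then have XC: "X \<sim>\<^sub>B copies X" by (rule decomposition_method[OF NX NX copies])
  moreover have "schroeder_bernstein TYPE('c) X"
    unfolding schroeder_bernstein_def
  proof (intro allI impI)
    fix Y :: "'c nspace"
    assume Y: "banach_space Y" and YX: "\<exists>M. complemented_in X M \<and> Y \<sim>\<^sub>B restrict_to X M"
      and XY: "\<exists>N. complemented_in Y N \<and> X \<sim>\<^sub>B restrict_to Y N"
    have NY: "normed Y" using Y by (simp add: banach_space_def normed_def)
    obtain L where L: "factors_through L Y X"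
      using YX complemented_imp_factors_through[OF NX NY] by blast
    obtain L' where "factors_through L' X Y"
      using XY complemented_imp_factors_through[OF NY NX] by blast
    from decomposition_method[OF NX NY factors_through_trans[OF copies this] L]
    show "Y \<sim>\<^sub>B X"
      using nisomorphic_trans[OF NY NC NX] nisomorphic_sym[OF NX NC XC] by blast
  qed
  ultimately show ?thesis by blast
qed

end
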